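(* Let $d\ge 2$ be an integer, $D=[0,1]^d$, let $\Omega$ be a positive continuous function on $D$, let $0\le k\le d$ be an integer, and let $f\in C^2_k(D)$. Then $$ \lim_{N\to\infty} N^{\frac 2d}\,\mathbf{R}_N(f)=\gamma_{k,d}\left(\int_D |H(f;\mathbf{x})|^{\frac12}\,\Omega(\mathbf{x})^{\frac d2}\,d\mathbf{x}\right)^{\frac 2d}. $$ Furthermore, there exist a sequence of admissible box partitions $\{\tilde\square_N\}_{N=1}^\infty$ of $D$ and a sequence of continuous quasi interpolating splines $\tilde s(f,\tilde\square_N)$ such that $$ \lim_{N\to\infty}\frac{\|f-\tilde s(f,\tilde\square_N)\|_{\infty,\Omega}}{\mathbf{R}_N(f)}=1 . $$
   Context: **Function class.** $C^2_k(D)$ is the set of $f\in C^2(D)$ such that for all $\mathbf{x}\in D$: $\frac{\partial^2 f}{\partial x_i^2}(\mathbf{x})>0$ for $1\le i\le k$, and $\frac{\partial^2 f}{\partial x_i^2}(\mathbf{x})<0$ for $k<i\le d$. For $f\in C^2(D)$ put $H(f;\mathbf{x}):=\prod_{i=1}^d\frac{\partial^2 f}{\partial x_i^2}(\mathbf{x})$. **Constant.** $\gamma_{k,d}:=\frac18 k^{\frac kd}(d-k)^{1-\frac kd}$ if $0<k<d$, and $\gamma_{k,d}:=\frac d8$ if $k=0$ or $k=d$. **Weighted norm.** $\|g\|_{\infty,\Omega}:=\sup\{|g(\mathbf{x})|\,\Omega(\mathbf{x}):\mathbf{x}\in D\}$. **Box partitions.** A box partition $\square_N=\{R_i\}_{i=1}^N$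 of $D$ is a partition of $D$ into $N$ boxes (parallelepipeds) with sides parallel to the coordinate axes. The vertices of the partition are the vertices of its boxes. A sequence $\{\square_N\}_{N=1}^\infty$ of box partitions, $\square_N$ having $N$ boxes, is called admissible if $\sup_N N^{\frac1d}\max_{R\in\square_N}\operatorname{diam}(R)<\infty$. Only admissible box partitions are considered throughout. **Interpolating splines.** Let $\mathcal{P}_1^*$ be the space of polynomials in $d$ variables that are linear (degree at most 1) in each variable separately. For $f$ on $D$ and a box partition $\square_N$, the function $s(f,\square_N)$ on $D$ is defined as follows: on the interior of each box $R_i$ it is the polynomial from $\mathcal{P}_1^*$ interpolating $f$ at the vertices of $R_i$; at every point $x$ of the union of the boundaries of the boxes, its value is the average of the values at $x$ of the interpolating polynomials of all boxes whose boundaries contain $x$. **Optimal error.** $\mathbf{R}_N(f):=\inf_{\square_N}\|f-s(f,\square_N)\|_{\infty,\Omega}$, where the infimum is taken over all admissible box partitions $\square_N$ of $D$ into $N$ boxes. **Quasi interpolating splines.** Continuous quasi interpolating splines $\tilde s(f,\tilde\square_N)$ are continuous functions on $D$ whose restriction to each box of $\tilde\square_N$ belongs to $\mathcal{P}_1^*$, and which interpolate $f$ at all but $o(N)$ of the vertices of $\tilde\square_N$ as $N\to\infty$. *)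

theory Defs
  imports "HOL-Analysis.Analysis" "HOL-Library.Landau_Symbols"
begin

text \<open>Partial derivative in direction \<open>i\<close>, taken within \<open>D\<close>: at points of \<open>D\<close> on faces of a box
  it is the one-sided one, so that no values outside \<open>D\<close> enter.\<close>

definition has_pderiv :: "(real^'n) set \<Rightarrow> 'n \<Rightarrow> (real^'n \<Rightarrow> real) \<Rightarrow> real^'n \<Rightarrow> bool" where
  "has_pderiv D i f x \<longleftrightarrow>
     (\<lambda>t. f (x + t *\<^sub>R axis i 1)) differentiable (at 0 within {t. x + t *\<^sub>R axis i 1 \<in> D})"

definition pderiv_within :: "(real^'n) set \<Rightarrow> 'n \<Rightarrow> (real^'n \<Rightarrow> real) \<Rightarrow> real^'n \<Rightarrow> real" where
  "pderiv_within D i f x =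
     vector_derivative (\<lambda>t. f (x + t *\<^sub>R axis i 1)) (at 0 within {t. x + t *\<^sub>R axis i 1 \<in> D})"

definition C2 :: "(real^'n) set \<Rightarrow> (real^'n \<Rightarrow> real) set" where
  "C2 D = {f. continuous_on D f
     \<and> (\<forall>i. (\<forall>x\<in>D. has_pderiv D i f x) \<and> continuous_on D (pderiv_within D i f))
     \<and> (\<forall>i j. (\<forall>x\<in>D. has_pderiv D j (pderiv_within D i f) x)
              \<and> continuous_on D (pderiv_within D j (pderiv_within D i f)))}"

text \<open>The index type \<open>'n\<close> carries no order; \<open>idx\<close> numbers the coordinates by \<open>1, \<dots>, d\<close>.\<close>

definition C2k :: "(real^'n) set \<Rightarrow> ('n \<Rightarrow> nat) \<Rightarrow> nat \<Rightarrow> (real^'n \<Rightarrow> real) set" where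
  "C2k D idx k = {f \<in> C2 D. \<forall>x\<in>D. \<forall>i.
     (idx i \<le> k \<longrightarrow> pderiv_within D i (pderiv_within D i f) x > 0) \<and>
     (k < idx i \<longrightarrow> pderiv_within D i (pderiv_within D i f) x < 0)}"

definition H :: "(real^'n) set \<Rightarrow> (real^'n \<Rightarrow> real) \<Rightarrow> real^'n \<Rightarrow> real" where
  "H D f x = (\<Prod>i\<in>UNIV. pderiv_within D i (pderiv_within D i f) x)"

definition gamma_const :: "nat \<Rightarrow> nat \<Rightarrow> real" where
  "gamma_const k d =
     (if 0 < k \<and> k < d
      then 1 / 8 * real k powr (real k / real d) * real (d - k) powr (1 - real k / real d)
      else real d / 8)"

definition wnorm :: "(real^'n) set \<Rightarrow> (real^'n \<Rightarrow> real) \<Rightarrow> (real^'n \<Rightarrow> real) \<Rightarrow> real" where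
  "wnorm D \<Omega> g = (SUP x\<in>D. \<bar>g x\<bar> * \<Omega> x)"

text \<open>\<open>division_of\<close> allows degenerate boxes, hence the extra condition.\<close>

definition box_partition :: "(real^'n) set \<Rightarrow> nat \<Rightarrow> (real^'n) set set \<Rightarrow> bool" where
  "box_partition D N P \<longleftrightarrow> P division_of D \<and> (\<forall>R\<in>P. interior R \<noteq> {}) \<and> card P = N"

definition box_vertices :: "(real^'n) set \<Rightarrow> (real^'n) set" where
  "box_vertices R =
     {v. \<forall>i. v $ i = interval_lowerbound R $ i \<or> v $ i = interval_upperbound R $ i}"

definition partition_vertices :: "(real^'n) set set \<Rightarrow> (real^'n) set" where
  "partition_vertices P = (\<Union>R\<in>P. box_vertices R)"

text \<open>Sequences of partitions start at \<open>N = 1\<close>; the value at \<open>0\<close> is irrelevant.\<close>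

definition admissible :: "(real^'n) set \<Rightarrow> (nat \<Rightarrow> (real^'n) set set) \<Rightarrow> bool" where
  "admissible D P \<longleftrightarrow>
     (\<forall>N\<ge>1. box_partition D N (P N)) \<and>
     bdd_above ((\<lambda>N. real N powr (1 / real CARD('n)) * Max (diameter ` P N)) ` {1..})"

text \<open>Polynomials of degree at most 1 in each variable separately.\<close>

definition P1 :: "(real^'n \<Rightarrow> real) set" where
  "P1 = {p. \<exists>c. p = (\<lambda>x. \<Sum>S\<in>Pow UNIV. c S * (\<Prod>i\<in>S. x $ i))}"

definition interp :: "(real^'n \<Rightarrow> real) \<Rightarrow> (real^'n) set \<Rightarrow> real^'n \<Rightarrow> real" where
  "interp f R = (THE p. p \<in> P1 \<and> (\<forall>v\<in>box_vertices R. p v = f v))"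

definition spline :: "(real^'n \<Rightarrow> real) \<Rightarrow> (real^'n) set set \<Rightarrow> real^'n \<Rightarrow> real" where
  "spline f P x =
     (if x \<in> (\<Union>R\<in>P. frontier R)
      then (\<Sum>R\<in>{R\<in>P. x \<in> frontier R}. interp f R x) / real (card {R\<in>P. x \<in> frontier R})
      else interp f (THE R. R \<in> P \<and> x \<in> interior R) x)"

text \<open>Admissibility is a property of sequences, so an admissible partition into \<open>N\<close> boxes is read
  as the \<open>N\<close>-th term of an admissible sequence. (Changing one term does not affect admissibility,
  so for \<open>N \<ge> 1\<close> and \<open>D\<close> the unit cube these are all box partitions into \<open>N\<close> boxes.)\<close>

definition opt_error :: "(real^'n) set \<Rightarrow> (real^'n \<Rightarrow> real) \<Rightarrow> (real^'n \<Rightarrow> real) \<Rightarrow> nat \<Rightarrow> real" where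
  "opt_error D \<Omega> f N =
     (INF P\<in>{S N |S. admissible D S}. wnorm D \<Omega> (\<lambda>x. f x - spline f P x))"

definition quasi_interpolating ::
    "(real^'n) set \<Rightarrow> (real^'n \<Rightarrow> real) \<Rightarrow> (nat \<Rightarrow> (real^'n) set set) \<Rightarrow> (nat \<Rightarrow> real^'n \<Rightarrow> real) \<Rightarrow> bool"
  where
  "quasi_interpolating D f P s \<longleftrightarrow>
     (\<forall>N\<ge>1. continuous_on D (s N) \<and> (\<forall>R\<in>P N. \<exists>p\<in>P1. \<forall>x\<in>R. s N x = p x)) \<and>
     (\<lambda>N. real (card {v \<in> partition_vertices (P N). s N v \<noteq> f v})) \<in> o(\<lambda>N. real N)"

end

theory Submission
  imports Defs
begin

text \<open>Multilinear interpolation on a box does not see the mixed terms of a quadratic polynomial, since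
  \<open>x\<^sub>i x\<^sub>j\<close> is itself linear in each variable.  On a box with sides \<open>h\<^sub>i\<close> on which the pure second
  derivatives \<open>f\<^sub>i\<^sub>i\<close> hardly vary, \<open>f\<close> minus its interpolant therefore ranges, up to a factor close to
  one, from \<open>-S\<^sub>+\<close> to \<open>S\<^sub>-\<close>, where \<open>S\<^sub>+\<close> and \<open>S\<^sub>-\<close> are the sums of \<open>|f\<^sub>i\<^sub>i| h\<^sub>i\<^sup>2 / 8\<close> over the coordinates
  \<open>i\<close> with \<open>f\<^sub>i\<^sub>i > 0\<close> and with \<open>f\<^sub>i\<^sub>i < 0\<close>.  Both bounds need only the one-dimensional estimate for linear
  interpolation along the axes (\<open>chord_gap_bounds\<close>), which an induction on the number of coordinates
  that are not at a vertex carries to the box (\<open>chordwise_bound\<close>, \<open>error_le\<close>).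

  Lower bound.  If both sums, times the weight, are at most \<open>E\<close>, the inequality of the arithmetic and
  geometric mean (\<open>prod_\<kappa>_le\<close>) bounds the volume of the box: it is at most \<open>E\<^bsup>d/2\<^esup>\<close> divided by
  \<open>\<Gamma> |H(f)|\<^bsup>1/2\<^esup> \<Omega>\<^bsup>d/2\<^esup>\<close>, where \<open>\<Gamma>\<^bsup>2/d\<^esup> = \<gamma>\<^bsub>k,d\<^esub>\<close> (\<open>box_volume_bound\<close>).  A small error forces every side
  to be short (\<open>box_sides_small\<close>), so this applies to all boxes of a good partition, and adding up the
  \<open>N\<close> boxes gives \<open>\<Gamma> \<integral> |H(f)|\<^bsup>1/2\<^esup> \<Omega>\<^bsup>d/2\<^esup> \<le> N E\<^bsup>d/2\<^esup>\<close> up to a factor close to one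
  (\<open>partition_lower_bound\<close>).

  Upper bound.  Cut the unit cube into \<open>m\<^sup>d\<close> cubes and fill each of them with equal boxes of the shape for
  which the mean inequality is an equality.  To make everything combinatorial, all boxes are unions of
  cells of one uniform grid of mesh of order \<open>N\<^bsup>-1/d\<^esup>\<close> with a small constant: inside a cube the boxes are
  blocks of \<open>r\<^sub>1 \<times> \<dots> \<times> r\<^sub>d\<close> cells, and the cells left over near the faces of the cubes stay single.
  There are only \<open>O(N\<^bsup>1-1/d\<^esup>)\<close> of the latter, which is \<open>o(N)\<close>.  The cell at the origin is finally cut
  into slabs so that there are exactly \<open>N\<close> boxes; the lower bound, applied to the partition before this
  cut, shows that only a small proportion of the boxes are slabs (\<open>refined_partition\<close>, \<open>near_optimal_exists\<close>).

  Continuous splines.  The grids of neighbouring cubes do not match, but the layer of single cells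
  separates the blocks of different cubes.  The piecewise multilinear interpolant, on the fine grid, of
  the nodal values that agree with the interpolants of \<open>f\<close> on the blocks and with \<open>f\<close> at all
  other nodes is continuous, reproduces the interpolants on the blocks, and deviates from \<open>f\<close> on the layer
  by little more than it does on the blocks (\<open>quasi_spline_on_block\<close>, \<open>quasi_spline_error\<close>).  A spline
  of this kind need not interpolate everywhere and could in principle beat \<open>R\<^sub>N(f)\<close>; its value at the
  origin is therefore moved off \<open>f\<close> by as much as the bound for the error of the partition permits, so
  that the quotient of the two errors cannot drop below one.  A diagonal argument over finer and finer
  choices of the parameters (\<open>optimal_sequence_exists\<close>) yields the sequence.\<close>

section \<open>Functions that are linear along the axes\<close>

definition upd :: "real^'n \<Rightarrow> 'n \<Rightarrow> real \<Rightarrow> real^'n" where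
  "upd x i t = (\<chi> j. if j = i then t else x $ j)"

lemma upd_nth [simp]: "upd x i t $ j = (if j = i then t else x $ j)"
  by (simp add: upd_def)

lemma upd_same [simp]: "upd x i (x $ i) = x"
  by (simp add: vec_eq_iff)

text \<open>The value at \<open>x\<close> of the linear interpolant of \<open>f\<close> along axis \<open>i\<close> with nodes \<open>l\<close> and \<open>u\<close>.\<close>

definition chord :: "(real^'n \<Rightarrow> real) \<Rightarrow> 'n \<Rightarrow> real \<Rightarrow> real \<Rightarrow> real^'n \<Rightarrow> real" where
  "chord f i l u x = ((u - x $ i) * f (upd x i l) + (x $ i - l) * f (upd x i u)) / (u - l)"

lemma chord_linear: "chord (\<lambda>y. c * (f y - g y)) i l u x = c * (chord f i l u x - chord g i l u x)"
proof -
  have "(u - x $ i) * (c * (f (upd x i l) - g (upd x i l))) + (x $ i - l) * (c * (f (upd x i u) - g (upd x i u)))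
    = c * (((u - x $ i) * f (upd x i l) + (x $ i - l) * f (upd x i u)) - ((u - x $ i) * g (upd x i l) + (x $ i - l) * g (upd x i u)))"
    by (simp add: algebra_simps)
  then show ?thesis unfolding chord_def by (simp only: diff_divide_distrib[symmetric] times_divide_eq_right)
qed

lemma P1_affine_along_axis:
  assumes "p \<in> P1" "l \<noteq> u"
  shows "p x = chord p i l u x"
proof -
  obtain c where p: "p = (\<lambda>x. \<Sum>S\<in>Pow UNIV. c S * (\<Prod>j\<in>S. x $ j))"
    using assms(1) by (auto simp: P1_def)
  have mono: "(u - l) * (\<Prod>j\<in>S. x $ j) =
      (u - x $ i) * (\<Prod>j\<in>S. upd x i l $ j) + (x $ i - l) * (\<Prod>j\<in>S. upd x i u $ j)" for S
  proof (cases "i \<in> S")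
    case True
    have fin: "finite S" by simp
    have e: "(\<Prod>j\<in>S. upd x i t $ j) = t * (\<Prod>j\<in>S-{i}. x $ j)" for t
      by (subst prod.remove[OF fin True]) (auto intro!: prod.cong)
    have "(\<Prod>j\<in>S. x $ j) = x $ i * (\<Prod>j\<in>S-{i}. x $ j)"
      by (subst prod.remove[OF fin True]) auto
    then show ?thesis unfolding e by (simp add: algebra_simps)
  next
    case False
    then have "(\<Prod>j\<in>S. upd x i t $ j) = (\<Prod>j\<in>S. x $ j)" for t
      by (intro prod.cong) auto
    then show ?thesis by (simp add: algebra_simps)
  qed
  have "(u - l) * p x = (\<Sum>S\<in>Pow UNIV. c S * ((u - l) * (\<Prod>j\<in>S. x $ j)))"
    by (simp add: p sum_distrib_left algebra_simps)
  also have "\<dots> = (u - x $ i) * p (upd x i l) + (x $ i - l) * p (upd x i u)"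
    unfolding mono p by (simp add: sum_distrib_left distrib_left sum.distrib mult.left_commute)
  finally show ?thesis using assms(2) by (simp add: chord_def field_simps)
qed

text \<open>The multilinear functions that occur below arise as sums of products of affine functions of one variable
  each; expanding the products shows that they have the monomial form required by \<^const>\<open>P1\<close>.\<close>

lemma P1_sum_prod:
  assumes "finite V"
  shows "(\<lambda>x::real^'n. \<Sum>v\<in>V. c v * (\<Prod>i\<in>UNIV. \<alpha> v i + \<beta> v i * x $ i)) \<in> P1"
proof -
  have "(\<Sum>v\<in>V. c v * (\<Prod>i\<in>UNIV. \<alpha> v i + \<beta> v i * x $ i)) =
    (\<Sum>S\<in>Pow UNIV. (\<Sum>v\<in>V. c v * prod (\<beta> v) S * prod (\<alpha> v) (UNIV - S)) * (\<Prod>i\<in>S. x $ i))"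
    for x :: "real^'n"
  proof -
    have "(\<Prod>i\<in>UNIV. \<alpha> v i + \<beta> v i * x $ i) =
      (\<Sum>S\<in>Pow UNIV. prod (\<beta> v) S * prod (\<alpha> v) (UNIV - S) * (\<Prod>i\<in>S. x $ i))" for v
    proof -
      have "(\<Prod>i\<in>UNIV. \<alpha> v i + \<beta> v i * x $ i) = (\<Prod>i\<in>UNIV. \<beta> v i * x $ i + \<alpha> v i)"
        by (simp add: add.commute)
      also have "\<dots> = (\<Sum>S\<in>Pow UNIV. (\<Prod>i\<in>S. \<beta> v i * x $ i) * prod (\<alpha> v) (UNIV - S))"
        by (rule prod_add) simp
      finally show ?thesis by (simp add: prod.distrib mult_ac)
    qed
    then have "(\<Sum>v\<in>V. c v * (\<Prod>i\<in>UNIV. \<alpha> v i + \<beta> v i * x $ i)) =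
      (\<Sum>v\<in>V. \<Sum>S\<in>Pow UNIV. c v * prod (\<beta> v) S * prod (\<alpha> v) (UNIV - S) * (\<Prod>i\<in>S. x $ i))"
      by (simp add: sum_distrib_left mult_ac)
    also have "\<dots> = (\<Sum>S\<in>Pow UNIV. \<Sum>v\<in>V. c v * prod (\<beta> v) S * prod (\<alpha> v) (UNIV - S) * (\<Prod>i\<in>S. x $ i))"
      by (rule sum.swap)
    finally show ?thesis by (simp add: sum_distrib_right)
  qed
  then show ?thesis unfolding P1_def by (intro CollectI exI) (rule ext)
qed

lemma P1_continuous: "p \<in> P1 \<Longrightarrow> continuous_on A p"
  unfolding P1_def by (auto intro!: continuous_intros)

text \<open>Both functions are linear along every axis, so agreement spreads from the vertices to the points that have
  all coordinates outside \<open>A\<close> at a vertex, by induction on \<open>A\<close>.\<close>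

lemma P1_unique:
  fixes l u :: "real^'n"
  assumes "p \<in> P1" "q \<in> P1" "\<And>i. l $ i < u $ i"
    and "\<And>v. (\<And>i. v $ i = l $ i \<or> v $ i = u $ i) \<Longrightarrow> p v = q v"
  shows "p = q"
proof
  fix x
  have "\<forall>x. (\<forall>i. i \<notin> A \<longrightarrow> x $ i = l $ i \<or> x $ i = u $ i) \<longrightarrow> p x = q x" if "finite A" for A
    using that
  proof (induction A)
    case empty
    then show ?case using assms(4) by auto
  next
    case (insert i A)
    show ?case
    proof (intro allI impI)
      fix x :: "real^'n"
      assume x: "\<forall>j. j \<notin> insert i A \<longrightarrow> x $ j = l $ j \<or> x $ j = u $ j"
      have "p (upd x i (l$i)) = q (upd x i (l$i))" "p (upd x i (u$i)) = q (upd x i (u$i))"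
        using insert.IH x by auto
      moreover have "l $ i \<noteq> u $ i" using assms(3)[of i] by simp
      ultimately show "p x = q x"
        using P1_affine_along_axis[OF assms(1), of "l$i" "u$i" x i]
          P1_affine_along_axis[OF assms(2), of "l$i" "u$i" x i] by (simp add: chord_def)
    qed
  qed
  from this[of UNIV] show "p x = q x" by simp
qed

text \<open>The passage from one variable to all of them.  If \<open>F\<close> exceeds its chord along each axis \<open>i\<close> by at most
  \<open>B i\<close>, a quantity that depends on the \<open>i\<close>-th coordinate only, then the excesses simply add up: replacing
  a coordinate by its two end values leaves the contributions of the other coordinates untouched, and the
  weights of the chord sum to one.  The parameter \<open>\<delta>\<close> allows for functions that interpolate only
  approximately at the vertices.\<close>

lemma chordwise_bound:
  fixes l u :: "real^'n"
  assumes lu: "\<And>i. l $ i < u $ i"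
    and step: "\<And>x i. x \<in> cbox l u \<Longrightarrow>
       F x \<le> chord F i (l$i) (u$i) x + B i (x$i)"
    and vert: "\<And>v. (\<And>i. v$i = l$i \<or> v$i = u$i) \<Longrightarrow> F v \<le> \<delta>"
    and x: "x \<in> cbox l u"
  shows "F x \<le> \<delta> + (\<Sum>i\<in>UNIV. B i (x$i))"
proof -
  have "\<forall>x\<in>cbox l u. (\<forall>i. i \<notin> A \<longrightarrow> x $ i = l $ i \<or> x $ i = u $ i) \<longrightarrow> F x \<le> \<delta> + (\<Sum>i\<in>A. B i (x$i))"
    if "finite A" for A
    using that
  proof (induction A)
    case empty
    then show ?case using vert by auto
  next
    case (insert i A)
    show ?case
    proof (intro ballI impI)
      fix x
      assume xb: "x \<in> cbox l u" and x: "\<forall>j. j \<notin> insert i A \<longrightarrow> x $ j = l $ j \<or> x $ j = u $ j"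
      let ?S = "\<Sum>j\<in>A. B j (x$j)"
      have inb: "upd x i t \<in> cbox l u" if "l$i \<le> t" "t \<le> u$i" for t
        using xb that by (auto simp: mem_box_cart)
      have S: "(\<Sum>j\<in>A. B j (upd x i t $ j)) = ?S" for t
        using insert.hyps by (intro sum.cong) auto
      have a: "F (upd x i (l$i)) \<le> \<delta> + ?S" "F (upd x i (u$i)) \<le> \<delta> + ?S"
        using insert.IH[rule_format, of "upd x i (l$i)"] insert.IH[rule_format, of "upd x i (u$i)"]
          inb[of "l$i"] inb[of "u$i"] lu[of i] x S by (auto simp: less_imp_le)
      have w: "0 \<le> u$i - x$i" "0 \<le> x$i - l$i" using xb by (auto simp: mem_box_cart)
      have "(u$i - x$i) * F (upd x i (l$i)) + (x$i - l$i) * F (upd x i (u$i))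
          \<le> (u$i - x$i) * (\<delta> + ?S) + (x$i - l$i) * (\<delta> + ?S)"
        using a w by (intro add_mono mult_left_mono) auto
      also have "\<dots> = (u$i - l$i) * (\<delta> + ?S)" by (simp add: algebra_simps)
      finally have "chord F i (l$i) (u$i) x \<le> \<delta> + ?S"
        using lu[of i] by (simp add: chord_def field_simps)
      then show "F x \<le> \<delta> + (\<Sum>j\<in>insert i A. B j (x$j))"
        using step[OF xb, of i] insert.hyps by simp
    qed
  qed
  from this[of UNIV] x show ?thesis by simp
qed

section \<open>Piecewise multilinear interpolation on a grid\<close>

definition node :: "('n \<Rightarrow> real) \<Rightarrow> ('n \<Rightarrow> real) \<Rightarrow> ('n \<Rightarrow> nat) \<Rightarrow> real^'n" where
  "node b \<delta> u = (\<chi> i. b i + \<delta> i * real (u i))"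

lemma node_nth [simp]: "node b \<delta> u $ i = b i + \<delta> i * real (u i)"
  by (simp add: node_def)

definition grid_box :: "('n \<Rightarrow> real) \<Rightarrow> ('n \<Rightarrow> real) \<Rightarrow> ('n \<Rightarrow> nat) \<Rightarrow> ('n \<Rightarrow> nat) \<Rightarrow> (real^'n) set" where
  "grid_box b \<delta> s t = cbox (node b \<delta> s) (node b \<delta> t)"

definition succ :: "('n \<Rightarrow> nat) \<Rightarrow> 'n \<Rightarrow> nat" where
  "succ k = (\<lambda>i. Suc (k i))"

lemma succ_apply [simp]: "succ k i = Suc (k i)"
  by (simp add: succ_def)

definition tent :: "real \<Rightarrow> real" where
  "tent t = max 0 (1 - \<bar>t\<bar>)"

text \<open>Tensor products of hat functions make the interpolant on the whole grid a single formula, so that its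
  continuity needs no gluing along faces.\<close>

definition tent_spline ::
    "('n \<Rightarrow> real) \<Rightarrow> ('n \<Rightarrow> real) \<Rightarrow> ('n \<Rightarrow> nat) \<Rightarrow> (('n \<Rightarrow> nat) \<Rightarrow> real) \<Rightarrow> real^'n \<Rightarrow> real" where
  "tent_spline b \<delta> n g x =
     (\<Sum>u\<in>PiE UNIV (\<lambda>i. {..n i}). g u * (\<Prod>i\<in>UNIV. tent ((x$i - b i) / \<delta> i - real (u i))))"

lemma tent_spline_continuous: "(\<And>i. \<delta> i \<noteq> 0) \<Longrightarrow> continuous_on A (tent_spline b \<delta> n g)"
  unfolding tent_spline_def tent_def by (auto intro!: continuous_intros)

lemma tent_diff_nat: "tent (real a - real b) = (if a = b then 1 else 0)"
proof (cases "a = b")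
  case False
  then have "\<bar>real a - real b\<bar> \<ge> 1" by linarith
  then show ?thesis using False by (simp add: tent_def)
qed (simp add: tent_def)

lemma tent_spline_node:
  assumes \<delta>: "\<And>i. \<delta> i > 0" and u: "\<And>i. u i \<le> n i"
  shows "tent_spline b \<delta> n g (node b \<delta> u) = g u"
proof -
  have "(\<Prod>i\<in>UNIV. tent ((node b \<delta> u $ i - b i) / \<delta> i - real (v i))) = (if v = u then 1 else 0)" for v
  proof -
    have "(node b \<delta> u $ i - b i) / \<delta> i = real (u i)" for i
      using \<delta>[of i] by simp
    then have "(\<Prod>i\<in>UNIV. tent ((node b \<delta> u $ i - b i) / \<delta> i - real (v i)))
      = (\<Prod>i\<in>UNIV. if u i = v i then 1 else 0 :: real)" by (simp add: tent_diff_nat)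
    also have "\<dots> = (if v = u then 1 else 0)"
      by (cases "v = u") (auto simp: fun_eq_iff prod_zero_iff, metis)
    finally show ?thesis .
  qed
  then have "tent_spline b \<delta> n g (node b \<delta> u) = (\<Sum>v\<in>PiE UNIV (\<lambda>i. {..n i}). if v = u then g v else 0)"
    unfolding tent_spline_def by (intro sum.cong) auto
  also have "\<dots> = g u"
    using u by (subst sum.delta) (auto intro!: finite_PiE)
  finally show ?thesis .
qed

text \<open>On one cell each hat function is affine: only the two nodes at the ends of an edge contribute, with slopes
  of opposite sign.\<close>

lemma tent_spline_cell:
  assumes \<delta>: "\<And>i. \<delta> i > 0"
  shows "\<exists>p\<in>P1. \<forall>x\<in>grid_box b \<delta> k (succ k). tent_spline b \<delta> n g x = p x"
proof -
  define \<alpha> where "\<alpha> u i = (if u i = k i then real (k i) + 1 + b i / \<delta> i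
      else if u i = Suc (k i) then - (b i / \<delta> i) - real (k i) else 0)" for u i
  define \<beta> where "\<beta> u i = (if u i = k i then - 1 / \<delta> i
      else if u i = Suc (k i) then 1 / \<delta> i else 0)" for u i
  define p where "p = (\<lambda>x. \<Sum>u\<in>PiE UNIV (\<lambda>i. {..n i}). g u * (\<Prod>i\<in>UNIV. \<alpha> u i + \<beta> u i * x $ i))"
  have "p \<in> P1" unfolding p_def by (rule P1_sum_prod) (auto intro!: finite_PiE)
  moreover have "tent_spline b \<delta> n g x = p x" if x: "x \<in> grid_box b \<delta> k (succ k)" for x
  proof -
    have "tent ((x$i - b i) / \<delta> i - real (u i)) = \<alpha> u i + \<beta> u i * x $ i" for u i
    proof -
      define y where "y = (x$i - b i) / \<delta> i"
      have "b i + \<delta> i * real (k i) \<le> x $ i" "x $ i \<le> b i + \<delta> i * (real (k i) + 1)"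
        using x by (auto simp: grid_box_def mem_box_cart add.commute)
      then have y: "real (k i) \<le> y" "y \<le> real (k i) + 1"
        using \<delta>[of i] by (auto simp: y_def field_simps)
      have "\<alpha> u i + \<beta> u i * x $ i = (if u i = k i then real (k i) + 1 - y
          else if u i = Suc (k i) then y - real (k i) else 0)"
        by (simp add: \<alpha>_def \<beta>_def y_def diff_divide_distrib)
      moreover consider "u i = k i" | "u i = Suc (k i)" | "real (u i) \<le> real (k i) - 1"
        | "real (u i) \<ge> real (k i) + 2" by linarith
      then have "tent (y - real (u i)) = (if u i = k i then real (k i) + 1 - y
          else if u i = Suc (k i) then y - real (k i) else 0)"
        using y by cases (auto simp: tent_def abs_if max_def)
      ultimately show ?thesis by (simp add: y_def)
    qed
    then show ?thesis by (simp add: tent_spline_def p_def)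
  qed
  ultimately show ?thesis by blast
qed

lemma box_vertices_cbox:
  fixes l u :: "real^'n"
  assumes "\<And>i. l $ i < u $ i"
  shows "box_vertices (cbox l u) = {v. \<forall>i. v$i = l$i \<or> v$i = u$i}"
proof -
  have "\<forall>i\<in>Basis. l \<bullet> i \<le> u \<bullet> i"
    using assms by (auto simp: Basis_vec_def inner_axis less_imp_le)
  then show ?thesis by (simp add: box_vertices_def)
qed

lemma interp_unique:
  fixes l u :: "real^'n"
  assumes lu: "\<And>i. l $ i < u $ i" and p: "p \<in> P1"
    and v: "\<And>v. (\<And>i. v $ i = l $ i \<or> v $ i = u $ i) \<Longrightarrow> p v = f v"
  shows "interp f (cbox l u) = p"
  unfolding interp_def
proof (rule the_equality)
  show "p \<in> P1 \<and> (\<forall>v\<in>box_vertices (cbox l u). p v = f v)"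
    using p v by (auto simp: box_vertices_cbox[OF lu])
next
  fix q assume "q \<in> P1 \<and> (\<forall>v\<in>box_vertices (cbox l u). q v = f v)"
  then show "q = p" using p v by (intro P1_unique[OF _ p lu]) (auto simp: box_vertices_cbox[OF lu])
qed

text \<open>A grid with a single cell shows existence.\<close>

lemma interp_exists:
  fixes l u :: "real^'n"
  assumes lu: "\<And>i. l $ i < u $ i"
  shows "interp f (cbox l u) \<in> P1"
    and "(\<And>i. v $ i = l $ i \<or> v $ i = u $ i) \<Longrightarrow> interp f (cbox l u) v = f v"
proof -
  let ?\<delta> = "\<lambda>i. u$i - l$i" and ?b = "\<lambda>i. l$i"
  let ?s = "tent_spline ?b ?\<delta> (\<lambda>_. 1) (\<lambda>k. f (node ?b ?\<delta> k))"
  have cell: "grid_box ?b ?\<delta> (\<lambda>_. 0) (succ (\<lambda>_. 0)) = cbox l u"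
    by (simp add: grid_box_def node_def)
  obtain p where p: "p \<in> P1" "\<forall>x\<in>cbox l u. ?s x = p x"
    using tent_spline_cell[of ?\<delta> ?b "\<lambda>_. 0"] lu unfolding cell by fastforce
  have v: "p v = f v" if v: "\<And>i. v $ i = l $ i \<or> v $ i = u $ i" for v
  proof -
    define k where "k i = (if v $ i = l $ i then 0 else 1::nat)" for i
    have nv: "node ?b ?\<delta> k = v" proof -
      have "v $ i = l $ i + (u $ i - l $ i) * real (k i)" for i using v[of i] by (auto simp: k_def)
      then show ?thesis by (simp add: vec_eq_iff)
    qed
    have "v \<in> cbox l u" using v lu by (metis (no_types) mem_box_cart(2) less_imp_le order_refl)
    then have "p v = ?s (node ?b ?\<delta> k)" using p(2) nv by simp
    also have "\<dots> = f v" using lu nv by (subst tent_spline_node) (auto simp: k_def)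
    finally show ?thesis .
  qed
  have "interp f (cbox l u) = p" by (rule interp_unique[OF lu p(1) v])
  then show "interp f (cbox l u) \<in> P1"
    and "(\<And>i. v $ i = l $ i \<or> v $ i = u $ i) \<Longrightarrow> interp f (cbox l u) v = f v"
    using p(1) v by auto
qed

section \<open>Partitions into grid boxes\<close>

text \<open>Boxes with corners on a grid are encoded by the index vectors of their lower and upper corners; such a
  pair stands for the set of unit cells in it.\<close>

definition cells :: "('n \<Rightarrow> nat) \<times> ('n \<Rightarrow> nat) \<Rightarrow> ('n \<Rightarrow> nat) set" where
  "cells B = {k. \<forall>i. fst B i \<le> k i \<and> k i < snd B i}"

text \<open>The index is the integer part of the rescaled coordinate, except on the upper face, where the last cell is
  taken.\<close>

lemma cell_containing_point:
  fixes x :: "real^'n"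
  assumes \<delta>: "\<And>i. \<delta> i > 0" and st: "\<And>i. s i < t i" and x: "x \<in> grid_box b \<delta> s t"
  shows "\<exists>k\<in>cells (s, t). x \<in> grid_box b \<delta> k (succ k)"
proof -
  have "\<exists>k. s i \<le> k \<and> k < t i \<and> b i + \<delta> i * real k \<le> x $ i \<and> x $ i \<le> b i + \<delta> i * real (Suc k)" for i
  proof -
    define y where "y = (x$i - b i) / \<delta> i"
    have xy: "x $ i = b i + \<delta> i * y" using \<delta>[of i] by (simp add: y_def)
    have "b i + \<delta> i * real (s i) \<le> x $ i" "x $ i \<le> b i + \<delta> i * real (t i)"
      using x by (auto simp: grid_box_def mem_box_cart)
    then have y: "real (s i) \<le> y" "y \<le> real (t i)"
      using \<delta>[of i] by (auto simp: y_def field_simps)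
    \<comment> \<open>the minimum matters only for \<open>y = t i\<close>, a point of the upper face\<close>
    define k where "k = min (nat \<lfloor>y\<rfloor>) (t i - 1)"
    have "s i \<le> k" using y st[of i] by (simp add: k_def le_nat_floor) 
    moreover have "k < t i" using st[of i] by (simp add: k_def)
    moreover have "real k \<le> y" using y(1) by (simp add: k_def) linarith
    moreover have "y \<le> real (Suc k)"
    proof (cases "nat \<lfloor>y\<rfloor> \<le> t i - 1")
      case True
      then show ?thesis using y(1) by (simp add: k_def) linarith
    next
      case False
      then have "real (Suc k) = real (t i)" using st[of i] by (simp add: k_def)
      then show ?thesis using y by simp
    qed
    ultimately show ?thesis using \<delta>[of i] unfolding xy by (intro exI[of _ k]) auto
  qed
  then obtain k where "\<And>i. s i \<le> k i \<and> k i < t i \<and> b i + \<delta> i * real (k i) \<le> x $ i \<and> x $ i \<le> b i + \<delta> i * real (Suc (k i))"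
    by metis
  then show ?thesis by (intro bexI[of _ k]) (auto simp: cells_def grid_box_def mem_box_cart)
qed

lemma grid_box_mono:
  assumes "\<And>i. \<delta> i > 0" "\<And>i. s i \<le> s' i" "\<And>i. t' i \<le> t i"
  shows "grid_box b \<delta> s' t' \<subseteq> grid_box b \<delta> s t"
  unfolding grid_box_def using assms
  by (auto simp: mem_box_cart) (meson add_left_mono mult_left_mono less_imp_le of_nat_le_iff order_trans)+

text \<open>If no axis separated the two boxes, the cell at the componentwise maximum of the lower corners would lie in
  both of them.\<close>

lemma interior_grid_boxes_disjoint:
  assumes \<delta>: "\<And>i. \<delta> i > 0" and st: "\<And>i. s i < t i" "\<And>i. s' i < t' i" and disj: "cells (s,t) \<inter> cells (s',t') = {}"
  shows "interior (grid_box b \<delta> s t) \<inter> interior (grid_box b \<delta> s' t') = {}"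
proof -
  have "\<exists>i. t i \<le> s' i \<or> t' i \<le> s i"
  proof (rule ccontr)
    assume "\<not> ?thesis"
    then have "(\<lambda>i. max (s i) (s' i)) \<in> cells (s,t) \<inter> cells (s',t')"
      using st by (auto simp: cells_def not_le)
    then show False using disj by auto
  qed
  then obtain i where i: "t i \<le> s' i \<or> t' i \<le> s i" by auto
  show ?thesis
  proof (rule ccontr)
    assume "\<not> ?thesis"
    then obtain x where "x \<in> box (node b \<delta> s) (node b \<delta> t)" "x \<in> box (node b \<delta> s') (node b \<delta> t')"
      by (auto simp: grid_box_def)
    then have "b i + \<delta> i * real (s i) < b i + \<delta> i * real (t' i)" "b i + \<delta> i * real (s' i) < b i + \<delta> i * real (t i)"
      by (simp_all add: mem_box_cart) (metis less_trans add_strict_left_mono add_less_cancel_left)+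
    then have "s i < t' i" "s' i < t i" using \<delta>[of i] by (simp_all)
    then show False using i by simp
  qed
qed

text \<open>A partition into unions of cells is described by the map \<open>own\<close> that assigns to each cell the box
  containing it.  Covering and disjointness then become the two statements that a cell lies in its own box
  and that all cells of a box have the same one.\<close>

lemma grid_division:
  assumes \<delta>: "\<And>i. \<delta> i > 0" and n: "\<And>i. 0 < n i"
    and own: "\<And>k. k \<in> cells (\<lambda>_. 0, n) \<Longrightarrow> k \<in> cells (own k)"
    and coh: "\<And>k k'. k \<in> cells (\<lambda>_. 0, n) \<Longrightarrow> k' \<in> cells (own k) \<Longrightarrow> k' \<in> cells (\<lambda>_. 0, n) \<and> own k' = own k"
  shows "(\<lambda>B. grid_box b \<delta> (fst B) (snd B)) ` own ` cells (\<lambda>_. 0, n) division_of grid_box b \<delta> (\<lambda>_. 0) n"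
proof (rule division_ofI)
  let ?K = "cells (\<lambda>_. 0, n)" and ?g = "\<lambda>B. grid_box b \<delta> (fst B) (snd B)"
  have "?K = PiE UNIV (\<lambda>i. {..<n i})" by (auto simp: cells_def)
  then have "finite ?K" by (simp add: finite_PiE)
  then show "finite (?g ` own ` ?K)" by blast
  have lt: "fst (own k) i < snd (own k) i" if "k \<in> ?K" for k i
    using own[OF that] le_less_trans unfolding cells_def by blast
  have top: "snd (own k) i \<le> n i" if "k \<in> ?K" for k i
  proof -
    define k' where "k' = (\<lambda>i. snd (own k) i - 1)"
    have "fst (own k) i \<le> k' i \<and> k' i < snd (own k) i" for i
      using lt[OF that, of i] unfolding k'_def by linarith
    then have "k' \<in> cells (own k)" by (simp add: cells_def)
    then have "k' \<in> cells (\<lambda>_. 0, n)" using coh[OF that] by blast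
    then have "k' i < n i" by (simp add: cells_def)
    then show ?thesis by (simp add: k'_def)
  qed
  have sub: "?g (own k) \<subseteq> grid_box b \<delta> (\<lambda>_. 0) n" if "k \<in> ?K" for k
    using top[OF that] \<delta> by (intro grid_box_mono) auto
  show "R \<subseteq> grid_box b \<delta> (\<lambda>_. 0) n" if "R \<in> ?g ` own ` ?K" for R
    using that sub by blast
  show "R \<noteq> {}" if "R \<in> ?g ` own ` ?K" for R
  proof -
    obtain k where k: "k \<in> ?K" "R = ?g (own k)" using \<open>R \<in> _\<close> by auto
    have "node b \<delta> (fst (own k)) \<in> R"
      using lt[OF k(1)] \<delta> by (auto simp: k grid_box_def mem_box_cart less_imp_le)
    then show ?thesis by blast
  qed
  show "\<exists>a c. R = cbox a c" if "R \<in> ?g ` own ` ?K" for R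
    using that unfolding grid_box_def by blast
  show "interior R1 \<inter> interior R2 = {}" if "R1 \<in> ?g ` own ` ?K" "R2 \<in> ?g ` own ` ?K" "R1 \<noteq> R2" for R1 R2
  proof -
    obtain k1 k2 where k: "k1 \<in> ?K" "k2 \<in> ?K" "R1 = ?g (own k1)" "R2 = ?g (own k2)" using \<open>R1 \<in> _\<close> \<open>R2 \<in> _\<close> by auto
    have "cells (own k1) \<inter> cells (own k2) = {}" 
      using coh[OF k(1)] coh[OF k(2)] \<open>R1 \<noteq> R2\<close> unfolding k by (metis disjoint_iff)
    then show ?thesis unfolding k using lt[OF k(1)] lt[OF k(2)]
      by (intro interior_grid_boxes_disjoint[OF \<delta>]) simp_all
  qed
  show "\<Union> (?g ` own ` ?K) = grid_box b \<delta> (\<lambda>_. 0) n"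
  proof
    show "\<Union> (?g ` own ` ?K) \<subseteq> grid_box b \<delta> (\<lambda>_. 0) n"
      using sub by blast
    show "grid_box b \<delta> (\<lambda>_. 0) n \<subseteq> \<Union> (?g ` own ` ?K)"
    proof
      fix x assume "x \<in> grid_box b \<delta> (\<lambda>_. 0) n"
      then obtain k where k: "k \<in> ?K" "x \<in> grid_box b \<delta> k (succ k)"
        using cell_containing_point[of \<delta> "\<lambda>_. 0" n x b] \<delta> n by blast
      have "grid_box b \<delta> k (succ k) \<subseteq> ?g (own k)"
        using own[OF k(1)] \<delta> by (intro grid_box_mono) (auto simp: cells_def Suc_le_eq)
      then show "x \<in> \<Union> (?g ` own ` ?K)" using k by auto
    qed
  qed
qed

section \<open>One-dimensional estimates\<close>

text \<open>Two applications of the mean value theorem left and right of \<open>x\<close> and the monotonicity of the derivative.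
  Derivatives are taken within the interval because \<open>f\<close> is given on the closed cube only.\<close>

lemma chord_above_convex:
  fixes \<phi> \<phi>' \<phi>'' :: "real \<Rightarrow> real"
  assumes lx: "l < u" "l \<le> x" "x \<le> u"
    and d1: "\<And>t. t \<in> {l..u} \<Longrightarrow> (\<phi> has_real_derivative \<phi>' t) (at t within {l..u})"
    and d2: "\<And>t. t \<in> {l..u} \<Longrightarrow> (\<phi>' has_real_derivative \<phi>'' t) (at t within {l..u})"
    and pos: "\<And>t. t \<in> {l..u} \<Longrightarrow> 0 \<le> \<phi>'' t"
  shows "(u - l) * \<phi> x \<le> (u - x) * \<phi> l + (x - l) * \<phi> u"
proof (cases "l < x \<and> x < u")
  case False
  then have "x = l \<or> x = u" using lx by auto
  then show ?thesis by (auto simp: algebra_simps)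
next
  case True
  have c: "continuous_on {l..u} \<phi>" "continuous_on {l..u} \<phi>'"
    using DERIV_continuous_on[OF d1] DERIV_continuous_on[OF d2] by auto
  have D1: "(\<phi> has_real_derivative \<phi>' t) (at t)" and D2: "(\<phi>' has_real_derivative \<phi>'' t) (at t)"
    if "l < t" "t < u" for t
    using d1[of t] d2[of t] that by (simp_all add: at_within_Icc_at)
  obtain \<xi> where \<xi>: "l < \<xi>" "\<xi> < x" "\<phi> x - \<phi> l = (x - l) * \<phi>' \<xi>"
  proof -
    have "continuous_on {l..x} \<phi>" using c True by (auto intro: continuous_on_subset)
    moreover have "(\<phi> has_real_derivative \<phi>' t) (at t)" if "l < t" "t < x" for t
      using D1[of t] that True by simp
    ultimately obtain D z where z: "l < z" "z < x" "DERIV \<phi> z :> D" "\<phi> x - \<phi> l = (x - l) * D"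
      using MVT[of l x \<phi>] True real_differentiable_def by blast
    have "D = \<phi>' z" using z D1[of z] True DERIV_unique by force
    then show thesis using that z by auto
  qed
  obtain \<eta> where \<eta>: "x < \<eta>" "\<eta> < u" "\<phi> u - \<phi> x = (u - x) * \<phi>' \<eta>"
  proof -
    have "continuous_on {x..u} \<phi>" using c True by (auto intro: continuous_on_subset)
    moreover have "(\<phi> has_real_derivative \<phi>' t) (at t)" if "x < t" "t < u" for t
      using D1[of t] that True by simp
    ultimately obtain D z where z: "x < z" "z < u" "DERIV \<phi> z :> D" "\<phi> u - \<phi> x = (u - x) * D"
      using MVT[of x u \<phi>] True real_differentiable_def by blast
    have "D = \<phi>' z" using z D1[of z] True DERIV_unique by force
    then show thesis using that z by auto
  qed
  have "\<phi>' \<xi> \<le> \<phi>' \<eta>"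
  proof (rule DERIV_nonneg_imp_nondecreasing[of \<xi> \<eta> \<phi>'])
    show "\<xi> \<le> \<eta>" using \<xi> \<eta> by simp
    show "\<exists>y. DERIV \<phi>' t :> y \<and> y \<ge> 0" if "\<xi> \<le> t" "t \<le> \<eta>" for t
      using D2[of t] pos[of t] that \<xi> \<eta> by auto
  qed
  then have "(u - x) * (x - l) * \<phi>' \<xi> \<le> (u - x) * (x - l) * \<phi>' \<eta>"
    using True by (intro mult_left_mono) auto
  then have "(u - x) * (\<phi> x - \<phi> l) \<le> (x - l) * (\<phi> u - \<phi> x)"
    by (simp add: \<xi> \<eta> mult_ac)
  then show ?thesis by (simp add: algebra_simps)
qed

text \<open>Subtracting the quadratic with second derivative \<open>lo\<close> reduces this to convexity, and the gap of that
  quadratic is known exactly.\<close>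

lemma chord_gap_lower:
  fixes \<phi> \<phi>' \<phi>'' :: "real \<Rightarrow> real"
  assumes lx: "l < u" "l \<le> x" "x \<le> u"
    and d1: "\<And>t. t \<in> {l..u} \<Longrightarrow> (\<phi> has_real_derivative \<phi>' t) (at t within {l..u})"
    and d2: "\<And>t. t \<in> {l..u} \<Longrightarrow> (\<phi>' has_real_derivative \<phi>'' t) (at t within {l..u})"
    and lo: "\<And>t. t \<in> {l..u} \<Longrightarrow> lo \<le> \<phi>'' t"
  shows "lo * ((x - l) * (u - x) / 2) \<le> ((u - x) * \<phi> l + (x - l) * \<phi> u) / (u - l) - \<phi> x"
proof -
  have "(u - l) * (\<phi> x - lo * x^2 / 2) \<le> (u - x) * (\<phi> l - lo * l^2 / 2) + (x - l) * (\<phi> u - lo * u^2 / 2)"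
  proof (rule chord_above_convex[where \<phi>' = "\<lambda>t. \<phi>' t - lo * t" and \<phi>'' = "\<lambda>t. \<phi>'' t - lo", OF lx])
    fix t assume t: "t \<in> {l..u}"
    show "((\<lambda>x. \<phi> x - lo * x\<^sup>2 / 2) has_real_derivative \<phi>' t - lo * t) (at t within {l..u})"
      by (auto intro!: derivative_eq_intros d1[OF t])
    show "((\<lambda>t. \<phi>' t - lo * t) has_real_derivative \<phi>'' t - lo) (at t within {l..u})"
      by (auto intro!: derivative_eq_intros d2[OF t])
    show "0 \<le> \<phi>'' t - lo" using lo[OF t] by simp
  qed
  moreover have "(u - x) * (lo * l^2 / 2) + (x - l) * (lo * u^2 / 2) - (u - l) * (lo * x^2/2)
      = (u - l) * (lo * ((x - l) * (u - x) / 2))"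
    by (simp add: field_simps power2_eq_square)
  ultimately have "(u - l) * (lo * ((x - l) * (u - x) / 2)) \<le> (u - x) * \<phi> l + (x - l) * \<phi> u - (u - l) * \<phi> x"
    unfolding right_diff_distrib[of "u - l" "\<phi> x"] right_diff_distrib[of "u - x" "\<phi> l"]
      right_diff_distrib[of "x - l" "\<phi> u"] by linarith
  then show ?thesis using lx(1) by (simp add: field_simps)
qed

text \<open>The sign \<open>\<sigma>\<close> makes convex and concave directions one case.\<close>

lemma chord_gap_bounds:
  fixes \<phi> \<phi>' \<phi>'' :: "real \<Rightarrow> real"
  assumes lx: "l < u" "l \<le> x" "x \<le> u"
    and d1: "\<And>t. t \<in> {l..u} \<Longrightarrow> (\<phi> has_real_derivative \<phi>' t) (at t within {l..u})"
    and d2: "\<And>t. t \<in> {l..u} \<Longrightarrow> (\<phi>' has_real_derivative \<phi>'' t) (at t within {l..u})"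
    and b: "\<And>t. t \<in> {l..u} \<Longrightarrow> lo \<le> \<sigma> * \<phi>'' t \<and> \<sigma> * \<phi>'' t \<le> hi"
  defines "gap \<equiv> \<sigma> * (((u - x) * \<phi> l + (x - l) * \<phi> u) / (u - l) - \<phi> x)"
  shows "lo * ((x - l) * (u - x) / 2) \<le> gap" and "gap \<le> hi * ((x - l) * (u - x) / 2)"
proof -
  have "lo * ((x - l) * (u - x) / 2) \<le> ((u - x) * (\<sigma> * \<phi> l) + (x - l) * (\<sigma> * \<phi> u)) / (u - l) - \<sigma> * \<phi> x"
    by (rule chord_gap_lower[OF lx, of "\<lambda>t. \<sigma> * \<phi> t" "\<lambda>t. \<sigma> * \<phi>' t" "\<lambda>t. \<sigma> * \<phi>'' t"])
      (use b d1 d2 in \<open>auto intro!: DERIV_cmult\<close>)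
  moreover have "(- hi) * ((x - l) * (u - x) / 2) \<le> ((u - x) * ((- \<sigma>) * \<phi> l) + (x - l) * ((- \<sigma>) * \<phi> u)) / (u - l) - (- \<sigma>) * \<phi> x"
    by (rule chord_gap_lower[OF lx, of "\<lambda>t. (- \<sigma>) * \<phi> t" "\<lambda>t. (- \<sigma>) * \<phi>' t" "\<lambda>t. (- \<sigma>) * \<phi>'' t"])
      (use b d1 d2 in \<open>auto intro!: DERIV_cmult DERIV_minus\<close>)
  moreover have "((u - x) * (c * \<phi> l) + (x - l) * (c * \<phi> u)) / (u - l) - c * \<phi> x
      = c * (((u - x) * \<phi> l + (x - l) * \<phi> u) / (u - l) - \<phi> x)" for c
    using lx(1) by (simp add: field_simps)
  ultimately have "lo * ((x - l) * (u - x) / 2) \<le> gap" "(- hi) * ((x - l) * (u - x) / 2) \<le> - gap"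
    unfolding gap_def mult_minus_left[of \<sigma> "_ / _ - _", symmetric] by (simp_all only:)
  then show "lo * ((x - l) * (u - x) / 2) \<le> gap" and "gap \<le> hi * ((x - l) * (u - x) / 2)"
    by simp_all
qed

section \<open>The error of multilinear interpolation on a box\<close>

abbreviation unit_cube :: "(real^'n) set" where "unit_cube \<equiv> cbox 0 1"

lemma upd_in_unit_cube: "x \<in> unit_cube \<Longrightarrow> 0 \<le> t \<Longrightarrow> t \<le> 1 \<Longrightarrow> upd x i t \<in> unit_cube"
  by (auto simp: mem_box_cart)

lemma pderiv_within_along_axis:
  assumes h: "\<And>y. y \<in> unit_cube \<Longrightarrow> has_pderiv unit_cube i h y"
    and x: "x \<in> unit_cube" and t: "t \<in> {0..1}"
  shows "((\<lambda>s. h (upd x i s)) has_real_derivative pderiv_within unit_cube i h (upd x i t)) (at t within {0..1})"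
proof -
  let ?y = "upd x i t"
  have e: "?y + s *\<^sub>R axis i 1 = upd x i (t + s)" for s
    by (auto simp: vec_eq_iff axis_def)
  have S: "{s. ?y + s *\<^sub>R axis i 1 \<in> unit_cube} = (\<lambda>r. r - t) ` {0..1}"
  proof -
    have "{s. ?y + s *\<^sub>R axis i 1 \<in> unit_cube} = {s. 0 \<le> t + s \<and> t + s \<le> 1}"
      using x unfolding e by (auto simp: mem_box_cart split: if_splits)
    also have "\<dots> = (\<lambda>r. r - t) ` {0..1}"
      by (auto simp: image_iff intro!: bexI[of _ "t + _"])
    finally show ?thesis .
  qed
  have "?y \<in> unit_cube" using upd_in_unit_cube[OF x] t by simp
  then have "((\<lambda>s. h (upd x i (t + s))) has_vector_derivative pderiv_within unit_cube i h ?y)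
      (at 0 within (\<lambda>r. r - t) ` {0..1})"
    using h[of ?y] unfolding has_pderiv_def pderiv_within_def e[symmetric] S[symmetric]
    by (simp only: vector_derivative_works)
  then have "((\<lambda>s. h (upd x i (t + s))) has_real_derivative pderiv_within unit_cube i h ?y)
      (at (t - t) within (\<lambda>r. r - t) ` {0..1})"
    by (simp add: has_real_derivative_iff_has_vector_derivative)
  then have "((\<lambda>s. h (upd x i (t + s))) \<circ> (\<lambda>r. r - t) has_real_derivative
      pderiv_within unit_cube i h ?y * 1) (at t within {0..1})"
    by (rule DERIV_image_chain) (auto intro!: derivative_eq_intros)
  then show ?thesis by (simp add: o_def)
qed

text \<open>All that is used of \<open>f\<close>.  The functions \<open>a i\<close> are the absolute values of the pure second derivatives and
  \<open>G\<close> is the set of directions of convexity; the last assumption records how far \<open>f\<close> is from its chords.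
  Apart from the next lemma and the final theorem, derivatives do not occur below.\<close>

locale multilinear_approximation =
  fixes \<Omega> f :: "real^'n \<Rightarrow> real" and a :: "'n \<Rightarrow> real^'n \<Rightarrow> real" and G :: "'n set"
  assumes \<Omega>_cont: "continuous_on unit_cube \<Omega>" and \<Omega>_pos: "\<And>x. x \<in> unit_cube \<Longrightarrow> 0 < \<Omega> x"
    and a_cont: "\<And>i. continuous_on unit_cube (a i)" and a_pos: "\<And>i x. x \<in> unit_cube \<Longrightarrow> 0 < a i x"
    and f_cont: "continuous_on unit_cube f"
    and chord_gap: "\<And>x i l u lo hi. \<lbrakk>x \<in> unit_cube; 0 \<le> l; l \<le> x $ i; x $ i \<le> u; u \<le> 1; l < u;
       \<And>t. l \<le> t \<Longrightarrow> t \<le> u \<Longrightarrow> lo \<le> a i (upd x i t) \<and> a i (upd x i t) \<le> hi\<rbrakk> \<Longrightarrow>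
       lo * ((x $ i - l) * (u - x $ i) / 2)
         \<le> (if i \<in> G then 1 else - 1) * (chord f i l u x - f x) \<and>
       (if i \<in> G then 1 else - 1) * (chord f i l u x - f x) \<le> hi * ((x $ i - l) * (u - x $ i) / 2)"

lemma multilinear_approximation_C2k:
  fixes f \<Omega> :: "real^'n \<Rightarrow> real"
  assumes "continuous_on unit_cube \<Omega>" "\<And>x. x \<in> unit_cube \<Longrightarrow> 0 < \<Omega> x" and f: "f \<in> C2k unit_cube idx k"
  shows "multilinear_approximation \<Omega> f
    (\<lambda>i x. \<bar>pderiv_within unit_cube i (pderiv_within unit_cube i f) x\<bar>) {i. idx i \<le> k}"
proof
  define f1 where "f1 = (\<lambda>i. pderiv_within unit_cube i f)"
  define f2 where "f2 = (\<lambda>i. pderiv_within unit_cube i (f1 i))"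
  have C2: "f \<in> C2 unit_cube" and sg: "\<And>i x. x \<in> unit_cube \<Longrightarrow> idx i \<le> k \<Longrightarrow> f2 i x > 0"
     "\<And>i x. x \<in> unit_cube \<Longrightarrow> k < idx i \<Longrightarrow> f2 i x < 0"
    using f by (auto simp: C2k_def f2_def f1_def)
  have f2_eq: "pderiv_within unit_cube i (pderiv_within unit_cube i f) x = f2 i x" for i x
    by (simp add: f2_def f1_def)
  have hp: "\<And>i y. y \<in> unit_cube \<Longrightarrow> has_pderiv unit_cube i f y"
    "\<And>i y. y \<in> unit_cube \<Longrightarrow> has_pderiv unit_cube i (f1 i) y"
    using C2 by (auto simp: C2_def f1_def)
  have f2c: "continuous_on unit_cube (f2 i)" for i using C2 by (auto simp: C2_def f2_def f1_def)
  show "continuous_on unit_cube f" using C2 by (auto simp: C2_def)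
  show "continuous_on unit_cube \<Omega>" "\<And>x. x \<in> unit_cube \<Longrightarrow> 0 < \<Omega> x" by fact+
  show "continuous_on unit_cube (\<lambda>x. \<bar>pderiv_within unit_cube i (pderiv_within unit_cube i f) x\<bar>)" for i
    using f2c[of i] unfolding f2_eq by (intro continuous_intros)
  show "0 < \<bar>pderiv_within unit_cube i (pderiv_within unit_cube i f) x\<bar>" if "x \<in> unit_cube" for i x
    using sg[OF that, of i] unfolding f2_eq by (cases "idx i \<le> k") auto
  fix x :: "real^'n" and i l u lo hi
  assume x: "x \<in> unit_cube" and lu: "0 \<le> l" "l \<le> x $ i" "x $ i \<le> u" "u \<le> 1" "l < u"
    and b: "\<And>t. l \<le> t \<Longrightarrow> t \<le> u \<Longrightarrow> lo \<le> \<bar>pderiv_within unit_cube i (pderiv_within unit_cube i f) (upd x i t)\<bar> \<and>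
       \<bar>pderiv_within unit_cube i (pderiv_within unit_cube i f) (upd x i t)\<bar> \<le> hi"
  let ?\<sigma> = "if i \<in> {i. idx i \<le> k} then 1 else - 1 :: real"
  have sub: "{l..u} \<subseteq> {0..1}" using lu by auto
  have d1: "((\<lambda>s. f (upd x i s)) has_real_derivative f1 i (upd x i t)) (at t within {l..u})"
   and d2: "((\<lambda>s. f1 i (upd x i s)) has_real_derivative f2 i (upd x i t)) (at t within {l..u})"
   if "t \<in> {l..u}" for t
    using that sub hp pderiv_within_along_axis[of i f x t] pderiv_within_along_axis[of i "f1 i" x t] x
    by (auto intro!: DERIV_subset[OF _ sub] simp: f1_def f2_def)
  have bb: "lo \<le> ?\<sigma> * f2 i (upd x i t) \<and> ?\<sigma> * f2 i (upd x i t) \<le> hi" if "t \<in> {l..u}" for t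
  proof -
    have "upd x i t \<in> unit_cube" using upd_in_unit_cube[OF x] that lu by auto
    then have "?\<sigma> * f2 i (upd x i t) = \<bar>f2 i (upd x i t)\<bar>"
      using sg[of "upd x i t" i] by (cases "idx i \<le> k") auto
    then show ?thesis using b[of t] that unfolding f2_eq by auto
  qed
  show "lo * ((x $ i - l) * (u - x $ i) / 2)
         \<le> ?\<sigma> * (chord f i l u x - f x) \<and>
       ?\<sigma> * (chord f i l u x - f x) \<le> hi * ((x $ i - l) * (u - x $ i) / 2)"
    using chord_gap_bounds[OF \<open>l < u\<close> lu(2,3) d1 d2 bb] by (simp add: chord_def)
qed

context multilinear_approximation
begin

text \<open>The interpolant is its own chord along every axis, so the gap of \<open>f - p\<close> is the gap of \<open>f\<close>, and
  \<open>chordwise_bound\<close> applies.  With \<open>\<tau> = 1\<close> the convex directions contribute negatively and the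
  concave ones positively, with \<open>\<tau> = -1\<close> it is the other way round.\<close>

lemma error_le:
  fixes l u :: "real^'n"
  assumes lu: "\<And>i. l $ i < u $ i" and sub: "cbox l u \<subseteq> unit_cube"
    and b: "\<And>i y. y \<in> cbox l u \<Longrightarrow> lo i \<le> a i y \<and> a i y \<le> hi i"
    and p: "p \<in> P1" and \<tau>: "\<tau> = 1 \<or> \<tau> = - 1"
    and vert: "\<And>v. (\<And>i. v $ i = l $ i \<or> v $ i = u $ i) \<Longrightarrow> \<tau> * (f v - p v) \<le> \<delta>"
    and x: "x \<in> cbox l u"
  shows "\<tau> * (f x - p x) \<le> \<delta> +
     (\<Sum>i\<in>UNIV. (if \<tau> = (if i \<in> G then 1 else - 1) then - lo i else hi i) * ((x $ i - l $ i) * (u $ i - x $ i) / 2))"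
proof (rule chordwise_bound[OF lu, where F = "\<lambda>x. \<tau> * (f x - p x)" and
    B = "\<lambda>i t. (if \<tau> = (if i \<in> G then 1 else - 1) then - lo i else hi i) * ((t - l $ i) * (u $ i - t) / 2)"])
  show "x \<in> cbox l u" by fact
  show "\<tau> * (f v - p v) \<le> \<delta>" if "\<And>i. v $ i = l $ i \<or> v $ i = u $ i" for v by (rule vert[OF that])
  fix x :: "real^'n" and i assume x: "x \<in> cbox l u"
  let ?s = "if i \<in> G then 1 else - 1 :: real" and ?q = "(x $ i - l $ i) * (u $ i - x $ i) / 2"
  let ?C = "\<lambda>h. chord h i (l $ i) (u $ i) x"
  have L: "l \<in> unit_cube" "u \<in> unit_cube" using sub lu by (auto simp: subset_iff mem_box_cart less_imp_le)
  have xi: "l $ i \<le> x $ i" "x $ i \<le> u $ i" using x by (auto simp: mem_box_cart)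
  have gap: "lo i * ?q \<le> ?s * (?C f - f x) \<and> ?s * (?C f - f x) \<le> hi i * ?q"
  proof (rule chord_gap)
    show "x \<in> unit_cube" using x sub by auto
    show "0 \<le> l $ i" "u $ i \<le> 1" using L by (auto simp: mem_box_cart)
    show "lo i \<le> a i (upd x i t) \<and> a i (upd x i t) \<le> hi i" if "l $ i \<le> t" "t \<le> u $ i" for t
      using x that by (intro b) (auto simp: mem_box_cart)
  qed (use xi lu in auto)
  have "\<tau> * (f x - ?C f) \<le> (if \<tau> = ?s then - lo i else hi i) * ?q"
  proof -
    have "\<tau> * (f x - ?C f) = (if \<tau> = ?s then - (?s * (?C f - f x)) else ?s * (?C f - f x))"
      using \<tau> by auto
    then show ?thesis using gap by simp
  qed
  moreover have "p x = ?C p"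
    by (rule P1_affine_along_axis[OF p]) (use lu[of i] in auto)
  moreover have "?C (\<lambda>y. \<tau> * (f y - p y)) = \<tau> * (?C f - ?C p)" by (rule chord_linear)
  moreover have "\<tau> * (f x - ?C p) = \<tau> * (f x - ?C f) + \<tau> * (?C f - ?C p)"
    by (simp only: distrib_left[symmetric]) simp
  ultimately show "\<tau> * (f x - p x) \<le> ?C (\<lambda>y. \<tau> * (f y - p y)) +
      (if \<tau> = ?s then - lo i else hi i) * ?q"
    by simp
qed

text \<open>The two signs of the error are controlled by disjoint sets of directions; this is why \<open>S\<close> bounds the two
  sums separately, and not their total.\<close>

lemma error_upper:
  fixes l u :: "real^'n"
  assumes lu: "\<And>i. l $ i < u $ i" and sub: "cbox l u \<subseteq> unit_cube"
    and b: "\<And>i y. y \<in> cbox l u \<Longrightarrow> a i y \<le> hi i"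
    and p: "p \<in> P1"
    and vert: "\<And>v. (\<And>i. v $ i = l $ i \<or> v $ i = u $ i) \<Longrightarrow> \<bar>f v - p v\<bar> \<le> \<delta>"
    and S: "(\<Sum>i\<in>G. hi i * (u $ i - l $ i)^2 / 8) \<le> S" "(\<Sum>i\<in>-G. hi i * (u $ i - l $ i)^2 / 8) \<le> S"
    and x: "x \<in> cbox l u"
  shows "\<bar>f x - p x\<bar> \<le> \<delta> + S"
proof -
  have hi0: "0 \<le> hi i" for i
  proof -
    have "0 < a i x" using a_pos x sub by blast
    then show ?thesis using b[OF x, of i] by simp
  qed
  have q: "(x $ i - l $ i) * (u $ i - x $ i) / 2 \<le> (u $ i - l $ i)^2 / 8" for i
  proof -
    have "4 * ((x $ i - l $ i) * (u $ i - x $ i)) + (2 * x $ i - l $ i - u $ i)^2 = (u $ i - l $ i)^2"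
      by (simp add: power2_eq_square algebra_simps)
    moreover have "(2 * x $ i - l $ i - u $ i)^2 \<ge> 0" by simp
    ultimately show ?thesis by linarith
  qed
  have q2: "hi i * ((x $ i - l $ i) * (u $ i - x $ i) / 2) \<le> hi i * (u $ i - l $ i)^2 / 8" for i
    using mult_left_mono[OF q hi0] by (simp add: mult.assoc)
  have "\<tau> * (f x - p x) \<le> \<delta> + S" if \<tau>: "\<tau> = 1 \<or> \<tau> = - 1" for \<tau> :: real
  proof -
    let ?A = "if \<tau> = 1 then - G else G"
    have "\<tau> * (f x - p x) \<le> \<delta> + (\<Sum>i\<in>UNIV. (if \<tau> = (if i \<in> G then 1 else - 1) then - 0 else hi i) * ((x $ i - l $ i) * (u $ i - x $ i) / 2))"
    proof (rule error_le[OF lu sub _ p \<tau> _ x])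
      show "0 \<le> a i y \<and> a i y \<le> hi i" if "y \<in> cbox l u" for i y
        using b[OF that] a_pos[of y i] that sub by (auto simp: less_imp_le)
      show "\<tau> * (f v - p v) \<le> \<delta>" if "\<And>i. v $ i = l $ i \<or> v $ i = u $ i" for v
        using vert[OF that] \<tau> by auto
    qed
    also have "(\<Sum>i\<in>UNIV. (if \<tau> = (if i \<in> G then 1 else - 1) then - 0 else hi i) * ((x $ i - l $ i) * (u $ i - x $ i) / 2))
        = (\<Sum>i\<in>?A. hi i * ((x $ i - l $ i) * (u $ i - x $ i) / 2))"
      using \<tau> by (intro sum.mono_neutral_cong_right) auto
    also have "\<dots> \<le> (\<Sum>i\<in>?A. hi i * (u $ i - l $ i)^2 / 8)"
      by (intro sum_mono q2)
    also have "\<dots> \<le> S" using S by auto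
    finally show ?thesis by simp
  qed
  from this[of 1] this[of "-1"] show ?thesis by auto
qed

lemma bounded_a: "\<exists>A>0. \<forall>i. \<forall>x\<in>unit_cube. a i x \<le> A"
proof -
  have "\<forall>i. \<exists>A. \<forall>x\<in>unit_cube. a i x \<le> A"
    using continuous_attains_sup[OF compact_cbox _ a_cont] by (metis (full_types) empty_iff)
  then obtain A where A: "\<And>i x. x \<in> unit_cube \<Longrightarrow> a i x \<le> A i" by metis
  have "a i x \<le> max 1 (Max (range A))" if "x \<in> unit_cube" for i x
  proof -
    have "A i \<le> Max (range A)" by simp
    then show ?thesis using A[OF that, of i] by linarith
  qed
  then show ?thesis by (intro exI[of _ "max 1 (Max (range A))"]) auto
qed

text \<open>Evaluation at the midpoint in the directions of \<open>A\<close> and at the lower end in the others, where the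
  contributions of the other directions, which have the wrong sign, vanish.\<close>

lemma error_lower:
  fixes l u :: "real^'n"
  assumes lu: "\<And>i. l $ i < u $ i" and sub: "cbox l u \<subseteq> unit_cube"
    and b: "\<And>i y. y \<in> cbox l u \<Longrightarrow> lo i \<le> a i y"
    and p: "p \<in> P1"
    and vert: "\<And>v. (\<And>i. v $ i = l $ i \<or> v $ i = u $ i) \<Longrightarrow> p v = f v"
    and A: "A = G \<or> A = - G"
  shows "\<exists>x\<in>cbox l u. (\<Sum>i\<in>A. lo i * (u $ i - l $ i)^2 / 8) \<le> \<bar>f x - p x\<bar>"
proof -
  obtain hi where hi: "\<And>i x. x \<in> unit_cube \<Longrightarrow> a i x \<le> hi" using bounded_a by auto
  define \<tau> :: real where "\<tau> = (if A = G then 1 else - 1)"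
  have \<tau>: "\<tau> = 1 \<or> \<tau> = - 1" by (auto simp: \<tau>_def)
  have AG: "i \<in> A \<longleftrightarrow> \<tau> = (if i \<in> G then 1 else - 1)" for i
    using A by (auto simp: \<tau>_def)
  \<comment> \<open>midpoint of a face: the directions outside \<open>A\<close> contribute nothing here\<close>
  define x :: "real^'n" where "x = (\<chi> i. if i \<in> A then (l $ i + u $ i) / 2 else l $ i)"
  have x: "x \<in> cbox l u" using lu by (auto simp: x_def mem_box_cart less_imp_le field_simps)
  have "\<tau> * (f x - p x) \<le> 0 + (\<Sum>i\<in>UNIV. (if \<tau> = (if i \<in> G then 1 else - 1) then - lo i else hi) * ((x $ i - l $ i) * (u $ i - x $ i) / 2))"
    by (rule error_le[OF lu sub _ p \<tau> _ x]) (use b hi sub vert in auto)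
  also have "\<dots> = (\<Sum>i\<in>A. - (lo i * (u $ i - l $ i)^2 / 8))"
    unfolding AG[symmetric] add_0
    by (rule sum.mono_neutral_cong_right) (auto simp: x_def power2_eq_square field_simps)
  finally have "(\<Sum>i\<in>A. lo i * (u $ i - l $ i)^2 / 8) \<le> - \<tau> * (f x - p x)"
    by (simp add: sum_negf)
  also have "\<dots> \<le> \<bar>f x - p x\<bar>" using \<tau> by auto
  finally show ?thesis using x by blast
qed

end

section \<open>The lower bound for partitions\<close>

lemma positive_continuous_lower_bound:
  fixes h :: "real^'n \<Rightarrow> real"
  assumes "continuous_on unit_cube h" "\<And>x. x \<in> unit_cube \<Longrightarrow> 0 < h x"
  shows "\<exists>c>0. \<forall>x\<in>unit_cube. c \<le> h x"
proof -
  have ne: "(unit_cube :: (real^'n) set) \<noteq> {}" by (auto simp: interval_ne_empty_cart)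
  obtain x where "x \<in> unit_cube" "\<forall>y\<in>unit_cube. h x \<le> h y"
    using continuous_attains_inf[OF compact_cbox ne assms(1)] by blast
  then show ?thesis using assms(2) by blast
qed

text \<open>Uniform continuity in multiplicative form.  Relative errors are convenient because they pass through
  products, roots and quotients.\<close>

lemma positive_continuous_nearly_constant:
  fixes h :: "real^'n \<Rightarrow> real"
  assumes h: "continuous_on unit_cube h" "\<And>x. x \<in> unit_cube \<Longrightarrow> 0 < h x" and \<theta>: "1 < \<theta>"
  shows "\<exists>\<rho>>0. \<forall>y\<in>unit_cube. \<forall>z\<in>unit_cube. (\<forall>i. \<bar>y $ i - z $ i\<bar> \<le> \<rho>) \<longrightarrow> h y \<le> \<theta> * h z"
proof -
  obtain c where c: "c > 0" "\<And>x. x \<in> unit_cube \<Longrightarrow> c \<le> h x"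
    using positive_continuous_lower_bound[OF h] by blast
  have "uniformly_continuous_on unit_cube h"
    using compact_uniformly_continuous[OF h(1) compact_cbox] .
  moreover have "0 < (\<theta> - 1) * c" using \<theta> c by simp
  ultimately obtain \<delta> where \<delta>: "\<delta> > 0"
     "\<And>y z. y \<in> unit_cube \<Longrightarrow> z \<in> unit_cube \<Longrightarrow> dist z y < \<delta> \<Longrightarrow> dist (h z) (h y) < (\<theta> - 1) * c"
    unfolding uniformly_continuous_on_def by meson
  define \<rho> where "\<rho> = \<delta> / (2 * CARD('n))"
  have "h y \<le> \<theta> * h z" if yz: "y \<in> unit_cube" "z \<in> unit_cube" "\<forall>i. \<bar>y $ i - z $ i\<bar> \<le> \<rho>" for y z
  proof -
    have "dist y z \<le> (\<Sum>i\<in>UNIV. \<bar>(y - z) $ i\<bar>)"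
      unfolding dist_norm by (rule norm_le_l1_cart)
    also have "\<dots> \<le> (\<Sum>i\<in>(UNIV::'n set). \<rho>)" using yz by (intro sum_mono) auto
    also have "\<dots> = \<delta> / 2" by (simp add: \<rho>_def)
    also have "\<dots> < \<delta>" using \<delta> by simp
    finally have "h y - h z < (\<theta> - 1) * c" using \<delta>(2)[OF yz(2,1)] by (simp add: dist_real_def)
    also have "\<dots> \<le> (\<theta> - 1) * h z" using c(2)[OF yz(2)] \<theta> by (intro mult_left_mono) auto
    finally show ?thesis by (simp add: algebra_simps)
  qed
  then show ?thesis using \<delta>(1) by (intro exI[of _ \<rho>]) (auto simp: \<rho>_def)
qed

lemma division_box_cases:
  fixes R :: "(real^'n) set"
  assumes "P division_of S" "R \<in> P" "interior R \<noteq> {}"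
  obtains l u where "R = cbox l u" "\<And>i. l $ i < u $ i" "R \<subseteq> S"
proof -
  obtain l u where lu: "R = cbox l u" using assms(1,2) by blast
  then have "\<And>i. l $ i < u $ i" using assms(3) by (simp add: interval_ne_empty_cart)
  then show thesis using that lu assms by blast
qed

context multilinear_approximation
begin

definition flat_on :: "real \<Rightarrow> (real^'n) set \<Rightarrow> bool" where
  "flat_on \<theta> S \<longleftrightarrow> (\<forall>y\<in>S. \<forall>z\<in>S. (\<forall>i. a i y \<le> \<theta> * a i z) \<and> \<Omega> y \<le> \<theta> * \<Omega> z)"

lemma flat_on_small_sets:
  assumes "1 < \<theta>"
  shows "\<exists>\<rho>>0. \<forall>S\<subseteq>unit_cube. (\<forall>y\<in>S. \<forall>z\<in>S. \<forall>i. \<bar>y $ i - z $ i\<bar> \<le> \<rho>) \<longrightarrow> flat_on \<theta> S"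
proof -
  have "\<forall>i. \<exists>\<rho>>0. \<forall>y\<in>unit_cube. \<forall>z\<in>unit_cube. (\<forall>i. \<bar>y $ i - z $ i\<bar> \<le> \<rho>) \<longrightarrow> a i y \<le> \<theta> * a i z"
    using positive_continuous_nearly_constant[OF a_cont a_pos assms] by simp
  then obtain r where r: "\<And>i. r i > 0"
    "\<And>i y z. y \<in> unit_cube \<Longrightarrow> z \<in> unit_cube \<Longrightarrow> (\<forall>j. \<bar>y $ j - z $ j\<bar> \<le> r i) \<Longrightarrow> a i y \<le> \<theta> * a i z"
    by metis
  obtain r' where r': "r' > 0"
    "\<And>y z. y \<in> unit_cube \<Longrightarrow> z \<in> unit_cube \<Longrightarrow> (\<forall>j. \<bar>y $ j - z $ j\<bar> \<le> r') \<Longrightarrow> \<Omega> y \<le> \<theta> * \<Omega> z"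
    using positive_continuous_nearly_constant[OF \<Omega>_cont \<Omega>_pos assms] by metis
  define \<rho> where "\<rho> = min r' (Min (range r))"
  have \<rho>0: "\<rho> > 0" using r r' by (simp add: \<rho>_def)
  have le: "\<rho> \<le> r'" "\<rho> \<le> r i" for i by (auto simp: \<rho>_def min.coboundedI2)
  have "flat_on \<theta> S" if S: "S \<subseteq> unit_cube" "\<And>y z i. y \<in> S \<Longrightarrow> z \<in> S \<Longrightarrow> \<bar>y $ i - z $ i\<bar> \<le> \<rho>" for S
    unfolding flat_on_def
  proof (intro ballI conjI allI)
    fix y z i assume yz: "y \<in> S" "z \<in> S"
    have c: "y \<in> unit_cube" "z \<in> unit_cube" using yz S by auto
    show "a i y \<le> \<theta> * a i z" using r(2)[OF c] S(2)[OF yz] le(2)[of i] order_trans by blast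
    show "\<Omega> y \<le> \<theta> * \<Omega> z" using r'(2)[OF c] S(2)[OF yz] le(1) order_trans by blast
  qed
  with \<rho>0 show ?thesis by (intro exI[of _ \<rho>]) simp
qed

lemma a_bounded_below: "\<exists>\<alpha>>0. \<forall>i. \<forall>x\<in>unit_cube. \<alpha> \<le> a i x"
proof -
  have "\<forall>i. \<exists>c>0. \<forall>x\<in>unit_cube. c \<le> a i x"
    using positive_continuous_lower_bound[OF a_cont a_pos] by blast
  then obtain c where c: "\<And>i. c i > 0" "\<And>i x. x \<in> unit_cube \<Longrightarrow> c i \<le> a i x" by metis
  have "Min (range c) \<le> a i x" if "x \<in> unit_cube" for i x
  proof -
    have "Min (range c) \<le> c i" by simp
    then show ?thesis using c(2)[OF that, of i] by linarith
  qed
  moreover have "0 < Min (range c)" using c(1) by simp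
  ultimately show ?thesis by blast
qed

text \<open>The number of directions with the same sign as direction \<open>i\<close>.  The optimal box has \<open>\<kappa> i * a i * h\<^sub>i\<^sup>2\<close> the same
  for all \<open>i\<close>, so that both sums in the error estimate are equal.\<close>

definition \<kappa> :: "'n \<Rightarrow> real" where
  "\<kappa> i = (if i \<in> G then real (card G) else real (card (- G)))"

text \<open>This is \<open>\<gamma>\<^bsub>k,d\<^esub>\<^bsup>d/2\<^esup>\<close> in all cases, including \<open>k = 0\<close> and \<open>k = d\<close>; see \<open>prod_\<kappa>_powr\<close> below.\<close>

definition \<Gamma> :: real where
  "\<Gamma> = sqrt (\<Prod>i\<in>UNIV. \<kappa> i / 8)"

definition density :: "real^'n \<Rightarrow> real" where
  "density x = sqrt ((\<Prod>i\<in>UNIV. a i x) * \<Omega> x ^ CARD('n))"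

lemma \<kappa>_ge_1: "1 \<le> \<kappa> i"
proof -
  have "card G > 0" if "i \<in> G" using that by (simp add: card_gt_0_iff) blast
  moreover have "card (- G) > 0" if "i \<notin> G" using that by (simp add: card_gt_0_iff) blast
  ultimately show ?thesis by (auto simp: \<kappa>_def Suc_le_eq)
qed

lemma \<Gamma>_pos: "0 < \<Gamma>"
proof -
  have "0 < \<kappa> i / 8" for i using \<kappa>_ge_1[of i] by simp
  then show ?thesis unfolding \<Gamma>_def by (simp add: prod_pos)
qed

lemma density_pos: "x \<in> unit_cube \<Longrightarrow> 0 < density x"
  unfolding density_def using a_pos \<Omega>_pos by (simp add: prod_pos)

lemma density_cont: "continuous_on unit_cube density"
  unfolding density_def using a_cont \<Omega>_cont by (intro continuous_intros) auto

lemma \<Gamma>_density_square: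
  assumes "y \<in> unit_cube"
  shows "(\<Gamma> * density y)\<^sup>2 = (\<Prod>i\<in>UNIV. \<kappa> i / 8) * ((\<Prod>i\<in>UNIV. a i y) * \<Omega> y ^ CARD('n))"
proof -
  have "0 \<le> (\<Prod>i\<in>UNIV. \<kappa> i / 8)"
    using \<kappa>_ge_1 by (intro prod_nonneg) (auto intro: order_trans[OF zero_le_one])
  moreover have "0 \<le> (\<Prod>i\<in>UNIV. a i y) * \<Omega> y ^ CARD('n)"
    using a_pos[OF assms] \<Omega>_pos[OF assms] by (intro mult_nonneg_nonneg prod_nonneg) (auto simp: less_imp_le)
  ultimately show ?thesis by (simp only: \<Gamma>_def density_def power_mult_distrib real_sqrt_pow2)
qed

text \<open>The arithmetic-geometric mean inequality for the two groups of directions at once, by multiplying the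
  inequalities \<open>t \<le> exp (t - 1)\<close> for \<open>t = \<kappa> i * y i / e\<close>: these numbers sum to at most \<open>card G + card (- G)\<close>,
  the number of factors.\<close>

lemma prod_\<kappa>_le:
  assumes y: "\<And>i. 0 \<le> y i" and e: "0 < e" and s: "sum y G \<le> e" "sum y (- G) \<le> e"
  shows "(\<Prod>i\<in>UNIV. \<kappa> i * y i) \<le> e ^ CARD('n)"
proof -
  have "(\<Prod>i\<in>UNIV. \<kappa> i * y i / e) \<le> (\<Prod>i\<in>UNIV. exp (\<kappa> i * y i / e - 1))"
  proof (rule prod_mono)
    fix i
    have "0 \<le> \<kappa> i * y i / e" using y e \<kappa>_ge_1[of i] by auto
    moreover have "\<kappa> i * y i / e \<le> exp (\<kappa> i * y i / e - 1)"
      using exp_ge_add_one_self[of "\<kappa> i * y i / e - 1"] by simp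
    ultimately show "0 \<le> \<kappa> i * y i / e \<and> \<kappa> i * y i / e \<le> exp (\<kappa> i * y i / e - 1)" by simp
  qed
  also have "\<dots> = exp ((\<Sum>i\<in>UNIV. \<kappa> i * y i) / e - CARD('n))"
    by (simp add: exp_sum[symmetric] sum_subtractf sum_divide_distrib)
  also have "\<dots> \<le> exp 0"
  proof -
    have "(\<Sum>i\<in>UNIV. \<kappa> i * y i) = (\<Sum>i\<in>G. \<kappa> i * y i) + (\<Sum>i\<in>-G. \<kappa> i * y i)"
      by (subst sum.union_disjoint[symmetric]) (auto intro!: sum.cong)
    also have "(\<Sum>i\<in>G. \<kappa> i * y i) = real (card G) * sum y G"
      by (simp add: \<kappa>_def sum_distrib_left)
    also have "(\<Sum>i\<in>-G. \<kappa> i * y i) = real (card (- G)) * sum y (- G)"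
      by (simp add: \<kappa>_def sum_distrib_left)
    also have "real (card G) * sum y G + real (card (- G)) * sum y (- G) \<le> real (card G) * e + real (card (- G)) * e"
      using s by (intro add_mono mult_left_mono) auto
    also have "\<dots> = CARD('n) * e"
    proof -
      have "card G + card (- G) = CARD('n)"
        using card_Un_disjoint[of G "- G"] by simp
      then show ?thesis by (metis distrib_right of_nat_add)
    qed
    finally show ?thesis using e by (simp add: field_simps)
  qed
  finally have "(\<Prod>i\<in>UNIV. \<kappa> i * y i) / e ^ CARD('n) \<le> 1"
    by (simp add: prod_dividef)
  then show ?thesis using e by (simp add: field_simps)
qed

text \<open>The error of the box bounds the two sums \<open>\<Sum> a i * h\<^sub>i\<^sup>2 / 8\<close> from above, and \<open>prod_\<kappa>_le\<close> turns this into a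
  bound for the product of the sides.  One factor \<open>\<theta>\<close> accounts for the variation of the \<open>a i\<close>, another one
  for that of the weight.\<close>

lemma box_volume_bound:
  fixes l u :: "real^'n"
  assumes lu: "\<And>i. l $ i < u $ i" and sub: "cbox l u \<subseteq> unit_cube" and \<theta>: "1 \<le> \<theta>"
    and flat: "flat_on \<theta> (cbox l u)" and E: "0 < E"
    and err: "\<And>x. x \<in> cbox l u \<Longrightarrow> \<bar>f x - interp f (cbox l u) x\<bar> * \<Omega> x \<le> E"
    and y: "y \<in> cbox l u"
  shows "\<Gamma> * density y * measure lborel (cbox l u) \<le> \<theta> ^ CARD('n) * sqrt (E ^ CARD('n))"
proof -
  define h where "h i = u $ i - l $ i" for i
  define e where "e = \<theta>^2 * E / \<Omega> y"
  have \<Omega>y: "0 < \<Omega> y" using \<Omega>_pos y sub by auto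
  have e0: "0 < e" using \<theta> E \<Omega>y by (simp add: e_def)
  have ay: "0 < a i y" for i using a_pos y sub by auto
  have sums: "(\<Sum>i\<in>A. a i y * h i ^ 2 / 8) \<le> e" if A: "A = G \<or> A = - G" for A
  proof -
    have "a i y / \<theta> \<le> a i z" if "z \<in> cbox l u" for i z
      using flat y that \<theta> by (auto simp: flat_on_def field_simps)
    then obtain x where x: "x \<in> cbox l u"
      "(\<Sum>i\<in>A. a i y / \<theta> * (u $ i - l $ i)^2 / 8) \<le> \<bar>f x - interp f (cbox l u) x\<bar>"
      using error_lower[OF lu sub, of "\<lambda>i. a i y / \<theta>" "interp f (cbox l u)" A] interp_exists[OF lu] A by blast
    have "\<Omega> y \<le> \<theta> * \<Omega> x" using flat y x(1) by (auto simp: flat_on_def)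
    then have "\<bar>f x - interp f (cbox l u) x\<bar> * \<Omega> y \<le> \<bar>f x - interp f (cbox l u) x\<bar> * (\<theta> * \<Omega> x)"
      by (intro mult_left_mono) auto
    also have "\<dots> \<le> \<theta> * E" using err[OF x(1)] \<theta> by (simp add: mult.left_commute)
    finally have "\<bar>f x - interp f (cbox l u) x\<bar> \<le> \<theta> * E / \<Omega> y" using \<Omega>y by (simp add: field_simps)
    then have "(\<Sum>i\<in>A. a i y * h i^2 / 8) / \<theta> \<le> \<theta> * E / \<Omega> y"
      using x(2) by (simp add: sum_divide_distrib h_def mult_ac)
    then have "(\<Sum>i\<in>A. a i y * h i^2 / 8) \<le> \<theta> * E / \<Omega> y * \<theta>"
      using \<theta> by (simp add: pos_divide_le_eq)
    then show ?thesis by (simp add: e_def power2_eq_square mult_ac)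
  qed
  have "(\<Prod>i\<in>UNIV. \<kappa> i * (a i y * h i ^ 2 / 8)) \<le> e ^ CARD('n)"
    by (rule prod_\<kappa>_le) (use e0 sums in \<open>auto simp: less_imp_le[OF ay]\<close>)
  also have "(\<Prod>i\<in>UNIV. \<kappa> i * (a i y * h i ^ 2 / 8)) = (\<Prod>i\<in>UNIV. \<kappa> i / 8) * (\<Prod>i\<in>UNIV. a i y) * (\<Prod>i\<in>UNIV. h i) ^ 2"
    by (simp add: prod.distrib prod_dividef prod_power_distrib)
  also have "(\<Prod>i\<in>UNIV. h i) = measure lborel (cbox l u)"
    using lu by (subst content_cbox_cart) (auto simp: h_def interval_ne_empty_cart less_imp_le)
  finally have "(\<Prod>i\<in>UNIV. \<kappa> i / 8) * ((\<Prod>i\<in>UNIV. a i y) * \<Omega> y ^ CARD('n)) * (measure lborel (cbox l u))\<^sup>2 \<le> e ^ CARD('n) * \<Omega> y ^ CARD('n)"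
    using mult_right_mono[of _ "e ^ CARD('n)" "\<Omega> y ^ CARD('n)"] \<Omega>y by (simp only: mult_ac) simp
  also have "\<dots> = (\<theta>\<^sup>2 * E) ^ CARD('n)"
    using \<Omega>y by (simp add: e_def power_mult_distrib[symmetric])
  also have "\<dots> = (\<theta> ^ CARD('n))\<^sup>2 * E ^ CARD('n)"
    by (simp add: power_mult_distrib power_mult[symmetric] mult.commute)
  also have "\<dots> = (\<theta> ^ CARD('n) * sqrt (E ^ CARD('n)))\<^sup>2"
    using E by (simp add: power_mult_distrib)
  finally have "(\<Gamma> * density y * measure lborel (cbox l u))\<^sup>2 \<le> (\<theta> ^ CARD('n) * sqrt (E ^ CARD('n)))\<^sup>2"
    using \<Gamma>_density_square[of y] y sub by (simp add: power_mult_distrib[of "\<Gamma> * density y"] subset_iff)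
  then show ?thesis by (rule power2_le_imp_le) (use \<theta> E in auto)
qed

text \<open>Each direction belongs to one of the two sums in \<open>error_lower\<close>, so its term alone is at most a constant
  times the error.\<close>

lemma box_sides_small:
  assumes \<rho>: "0 < \<rho>"
  shows "\<exists>E0>0. \<forall>l u. (\<forall>i. l $ i < u $ i) \<longrightarrow> cbox l u \<subseteq> unit_cube \<longrightarrow>
     (\<forall>x\<in>cbox l u. \<bar>f x - interp f (cbox l u) x\<bar> * \<Omega> x \<le> E0) \<longrightarrow> (\<forall>i. u $ i - l $ i \<le> \<rho>)"
proof -
  obtain \<alpha> where \<alpha>: "\<alpha> > 0" "\<And>i x. x \<in> unit_cube \<Longrightarrow> \<alpha> \<le> a i x" using a_bounded_below by blast
  obtain \<omega> where \<omega>: "\<omega> > 0" "\<And>x. x \<in> unit_cube \<Longrightarrow> \<omega> \<le> \<Omega> x"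
    using positive_continuous_lower_bound[OF \<Omega>_cont \<Omega>_pos] by blast
  define E0 where "E0 = \<rho>^2 * \<alpha> * \<omega> / 8"
  have "u $ j - l $ j \<le> \<rho>" if lu: "\<forall>i. l $ i < u $ i" and sub: "cbox l u \<subseteq> unit_cube"
    and err: "\<forall>x\<in>cbox l u. \<bar>f x - interp f (cbox l u) x\<bar> * \<Omega> x \<le> E0" for l u :: "real^'n" and j
  proof -
    define A where "A = (if j \<in> G then G else - G)"
    have A: "A = G \<or> A = - G" "j \<in> A" by (auto simp: A_def)
    have "\<alpha> \<le> a i z" if "z \<in> cbox l u" for i z
      using \<alpha>(2)[of z i] that sub by blast
    then obtain x where x: "x \<in> cbox l u"
      "(\<Sum>i\<in>A. \<alpha> * (u $ i - l $ i)^2 / 8) \<le> \<bar>f x - interp f (cbox l u) x\<bar>"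
      using error_lower[of l u "\<lambda>i. \<alpha>" "interp f (cbox l u)" A] interp_exists[of l u] A lu sub by blast
    have "\<alpha> * (u $ j - l $ j)^2 / 8 \<le> (\<Sum>i\<in>A. \<alpha> * (u $ i - l $ i)^2 / 8)"
      using A \<alpha>(1) by (intro member_le_sum) auto
    with x have "\<alpha> * (u $ j - l $ j)^2 / 8 \<le> \<bar>f x - interp f (cbox l u) x\<bar>" by simp
    then have "\<alpha> * (u $ j - l $ j)^2 / 8 * \<omega> \<le> \<bar>f x - interp f (cbox l u) x\<bar> * \<Omega> x"
      using \<omega> x sub by (intro mult_mono) auto
    also have "\<dots> \<le> E0" using err x by auto
    finally have "(u $ j - l $ j)^2 \<le> \<rho>^2" using \<alpha>(1) \<omega>(1) by (simp add: E0_def field_simps)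
    then show ?thesis by (rule power2_le_imp_le) (use \<rho> in simp)
  qed
  moreover have "0 < E0" using \<alpha>(1) \<omega>(1) \<rho> by (simp add: E0_def)
  ultimately show ?thesis by blast
qed

definition J :: real where
  "J = \<Gamma> * integral unit_cube density"

lemma density_integrable: "cbox l u \<subseteq> unit_cube \<Longrightarrow> density integrable_on cbox l u"
  by (rule integrable_continuous) (rule continuous_on_subset[OF density_cont])

lemma J_pos: "0 < J"
proof -
  obtain c where c: "c > 0" "\<And>x. x \<in> unit_cube \<Longrightarrow> c \<le> density x"
    using positive_continuous_lower_bound[OF density_cont density_pos] by blast
  have "measure lborel (unit_cube :: (real^'n) set) = 1"
    by (subst content_cbox_cart) (auto simp: interval_ne_empty_cart)
  then have "c = integral unit_cube (\<lambda>_::real^'n. c)" by simp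
  also have "\<dots> \<le> integral unit_cube density"
    by (rule integral_le) (use c density_integrable in \<open>auto intro!: integrable_const\<close>)
  finally show ?thesis using c \<Gamma>_pos by (simp add: J_def)
qed

text \<open>Since the bound of \<open>box_volume_bound\<close> holds at every point of the box, it bounds the integral of the
  density over the box; all boxes have the same right-hand side.\<close>

lemma partition_lower_bound:
  assumes \<theta>: "1 < \<theta>"
  shows "\<exists>E0>0. \<forall>P E. P division_of unit_cube \<longrightarrow> (\<forall>R\<in>P. interior R \<noteq> {}) \<longrightarrow> 0 < E \<longrightarrow> E \<le> E0 \<longrightarrow>
     (\<forall>R\<in>P. \<forall>x\<in>R. \<bar>f x - interp f R x\<bar> * \<Omega> x \<le> E) \<longrightarrow> J \<le> \<theta> ^ CARD('n) * real (card P) * sqrt (E ^ CARD('n))"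
proof -
  obtain \<rho> where \<rho>: "\<rho> > 0" "\<And>S. S \<subseteq> unit_cube \<Longrightarrow> (\<forall>y\<in>S. \<forall>z\<in>S. \<forall>i. \<bar>y $ i - z $ i\<bar> \<le> \<rho>) \<Longrightarrow> flat_on \<theta> S"
    using flat_on_small_sets[OF \<theta>] by metis
  obtain E0 where E0: "E0 > 0" "\<And>l u. (\<forall>i. l $ i < u $ i) \<Longrightarrow> cbox l u \<subseteq> unit_cube \<Longrightarrow>
     (\<forall>x\<in>cbox l u. \<bar>f x - interp f (cbox l u) x\<bar> * \<Omega> x \<le> E0) \<Longrightarrow> (\<forall>i. u $ i - l $ i \<le> \<rho>)"
    using box_sides_small[OF \<rho>(1)] by metis
  have "J \<le> \<theta> ^ CARD('n) * real (card P) * sqrt (E ^ CARD('n))"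
    if P: "P division_of unit_cube" and int: "\<forall>R\<in>P. interior R \<noteq> {}" and E: "0 < E" "E \<le> E0"
      and err: "\<forall>R\<in>P. \<forall>x\<in>R. \<bar>f x - interp f R x\<bar> * \<Omega> x \<le> E" for P E
  proof -
    define M where "M = \<theta> ^ CARD('n) * sqrt (E ^ CARD('n))"
    have box: "\<Gamma> * integral R density \<le> M" if R: "R \<in> P" for R
    proof -
      obtain l u where lu: "R = cbox l u" "\<And>i. l $ i < u $ i" "R \<subseteq> unit_cube"
        using division_box_cases[OF P R] int R by metis
      have "\<forall>i. u $ i - l $ i \<le> \<rho>"
        by (rule E0(2)) (use lu err R E in force)+
      then have "\<bar>y $ i - z $ i\<bar> \<le> \<rho>" if "y \<in> R" "z \<in> R" for y z i
        using that lu(1) by (force simp: mem_box_cart abs_le_iff dest!: spec[of _ i])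
      then have flat: "flat_on \<theta> R" using \<rho>(2) lu(3) by blast
      have cont: "0 < measure lborel R" using lu(1,2) by (simp add: content_cbox_cart interval_ne_empty_cart less_imp_le prod_pos)
      have "\<Gamma> * density y * measure lborel R \<le> M" if "y \<in> R" for y
        unfolding lu(1) M_def
        by (rule box_volume_bound) (use lu \<theta> flat E err R that in auto)
      then have "density y \<le> M / (\<Gamma> * measure lborel R)" if "y \<in> R" for y
        using that \<Gamma>_pos cont by (simp add: field_simps)
      then have "integral R density \<le> integral R (\<lambda>_. M / (\<Gamma> * measure lborel R))"
        unfolding lu(1) using lu density_integrable by (intro integral_le) (auto intro!: integrable_const)
      also have "\<dots> = measure lborel R * (M / (\<Gamma> * measure lborel R))" unfolding lu(1) by simp
      also have "\<dots> = M / \<Gamma>" using cont by simp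
      finally show ?thesis using \<Gamma>_pos by (simp add: field_simps)
    qed
    have "integral unit_cube density = (\<Sum>R\<in>P. integral R density)"
      by (rule integral_combine_division_topdown[OF _ P]) (use density_integrable in auto)
    then have "J = (\<Sum>R\<in>P. \<Gamma> * integral R density)" by (simp add: J_def sum_distrib_left)
    also have "\<dots> \<le> (\<Sum>R\<in>P. M)" by (intro sum_mono box)
    finally show ?thesis by (simp add: M_def mult_ac)
  qed
  then show ?thesis using E0(1) by blast
qed

text \<open>The limit in the theorem, \<open>J\<^bsup>2/d\<^esup>\<close>.\<close>

definition L :: real where
  "L = root CARD('n) (J^2)"

lemma L_pos: "0 < L" and L_power: "L ^ CARD('n) = J^2"
  using J_pos by (auto simp: L_def)

lemma partition_lower_bound_L:
  assumes "1 < \<theta>"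
  shows "\<exists>E0>0. \<forall>P E. P division_of unit_cube \<longrightarrow> (\<forall>R\<in>P. interior R \<noteq> {}) \<longrightarrow> 0 < E \<longrightarrow> E \<le> E0 \<longrightarrow>
     (\<forall>R\<in>P. \<forall>x\<in>R. \<bar>f x - interp f R x\<bar> * \<Omega> x \<le> E) \<longrightarrow> L \<le> \<theta>^2 * (root CARD('n) (real (card P)))^2 * E"
proof -
  have "L \<le> \<theta>^2 * (root CARD('n) (real N))^2 * E"
    if "J \<le> \<theta> ^ CARD('n) * real N * sqrt (E ^ CARD('n))" "0 < E" for N E
  proof -
    have "L ^ CARD('n) \<le> (\<theta> ^ CARD('n) * real N * sqrt (E ^ CARD('n)))^2"
      unfolding L_power using that J_pos by (intro power_mono) auto
    also have "\<dots> = (\<theta> ^ CARD('n))^2 * (root CARD('n) (real N) ^ CARD('n))^2 * E ^ CARD('n)"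
      using \<open>0 < E\<close> by (simp add: power_mult_distrib)
    also have "\<dots> = (\<theta>^2 * (root CARD('n) (real N))^2 * E) ^ CARD('n)"
      by (simp only: power_mult_distrib power_mult[symmetric] mult.commute)
    finally show ?thesis
      using \<open>0 < E\<close> L_pos by (subst (asm) power_mono_iff) auto
  qed
  then show ?thesis using partition_lower_bound[OF assms] by blast
qed

end

section \<open>From box errors to the optimal error\<close>

text \<open>No other box of the partition can reach an interior point: it is the closure of its interior, which would
  meet the interior of \<open>R\<close>.\<close>

lemma spline_eq_interp_interior:
  fixes D :: "(real^'n) set"
  assumes P: "box_partition D N P" and R: "R \<in> P" and x: "x \<in> interior R"
  shows "spline f P x = interp f R x"
proof -
  have div: "P division_of D" and int: "\<And>R. R \<in> P \<Longrightarrow> interior R \<noteq> {}" using P by (auto simp: box_partition_def)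
  have uniq: "R' = R" if R': "R' \<in> P" "x \<in> R'" for R'
  proof (rule ccontr)
    assume "R' \<noteq> R"
    then have dis: "interior R \<inter> interior R' = {}" using division_ofD(5)[OF div R R'(1)] by auto
    obtain l u where lu: "R' = cbox l u" "\<And>i. l $ i < u $ i" using division_box_cases[OF div R'(1) int[OF R'(1)]] by metis
    have "closure (interior R') = R'"
      using int[OF R'(1)] unfolding lu(1) by (simp add: interior_cbox closure_box)
    then have "x \<in> closure (interior R')" using R' by simp
    then have "interior R \<inter> interior R' \<noteq> {}"
      using x open_interior[of R] by (metis IntI closure_iff_nhds_not_empty disjoint_iff interior_maximal subset_refl inf.commute)
    then show False using dis by simp
  qed
  have xR: "x \<in> R" using x interior_subset by blast
  have "closed R'" if "R' \<in> P" for R' using division_ofD(4)[OF div that] by auto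
  then have "\<not> x \<in> (\<Union>R\<in>P. frontier R)"
    using uniq x by (metis UN_E closure_closed frontier_def DiffD1 DiffD2)
  moreover have "(THE R. R \<in> P \<and> x \<in> interior R) = R"
    using R x uniq interior_subset by (intro the_equality) blast+
  ultimately show ?thesis by (simp add: spline_def)
qed

text \<open>On the boundaries of the boxes the spline is an average, and an average of values close to \<open>f x\<close> is as close
  to it.\<close>

lemma spline_error_le:
  fixes D :: "(real^'n) set"
  assumes P: "box_partition D N P" and x: "x \<in> D" and c: "0 \<le> c"
    and err: "\<And>R. R \<in> P \<Longrightarrow> x \<in> R \<Longrightarrow> \<bar>f x - interp f R x\<bar> * c \<le> E"
  shows "\<bar>f x - spline f P x\<bar> * c \<le> E"
proof (cases "x \<in> (\<Union>R\<in>P. frontier R)")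
  case False
  have div: "P division_of D" using P by (auto simp: box_partition_def)
  obtain R where R: "R \<in> P" "x \<in> R" using division_ofD(6)[OF div] x by blast
  have "closed R" using division_ofD(4)[OF div R(1)] by auto
  then have "x \<in> interior R" using False R by (auto simp: frontier_def)
  then show ?thesis using spline_eq_interp_interior[OF P R(1), of x f] err[OF R] by simp
next
  case True
  have div: "P division_of D" using P by (auto simp: box_partition_def)
  define F where "F = {R \<in> P. x \<in> frontier R}"
  have fin: "finite F" using division_ofD(1)[OF div] by (simp add: F_def)
  have ne: "F \<noteq> {}" using True by (auto simp: F_def)
  then have cF: "0 < real (card F)" using fin by (simp add: card_gt_0_iff)
  have e: "\<bar>f x - interp f R x\<bar> * c \<le> E" if "R \<in> F" for R
  proof -
    have "closed R" using division_ofD(4)[OF div] that by (auto simp: F_def)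
    then show ?thesis using err[of R] that frontier_subset_closed by (auto simp: F_def)
  qed
  have "f x - spline f P x = (\<Sum>R\<in>F. f x - interp f R x) / real (card F)"
    using True cF by (simp add: spline_def F_def[symmetric] sum_subtractf diff_divide_distrib)
  then have "\<bar>f x - spline f P x\<bar> * c = \<bar>\<Sum>R\<in>F. f x - interp f R x\<bar> * c / real (card F)"
    using cF by (simp add: abs_divide)
  also have "\<dots> \<le> (\<Sum>R\<in>F. \<bar>f x - interp f R x\<bar>) * c / real (card F)"
    using c cF by (intro divide_right_mono mult_right_mono sum_abs) auto
  also have "\<dots> \<le> (\<Sum>R\<in>F. E) / real (card F)"
    unfolding sum_distrib_right by (intro divide_right_mono sum_mono e) auto
  also have "\<dots> = E" using cF by simp
  finally show ?thesis .
qed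

context multilinear_approximation
begin

lemma bounded_\<Omega>: "\<exists>B>0. \<forall>x\<in>unit_cube. \<Omega> x \<le> B"
proof -
  have ne: "(unit_cube :: (real^'n) set) \<noteq> {}" by (auto simp: interval_ne_empty_cart)
  obtain x where "x \<in> unit_cube" "\<forall>y\<in>unit_cube. \<Omega> y \<le> \<Omega> x"
    using continuous_attains_sup[OF compact_cbox ne \<Omega>_cont] by blast
  then show ?thesis using \<Omega>_pos by blast
qed

text \<open>The supremum in \<^const>\<open>wnorm\<close> is meaningful only for bounded functions; this uniform bound provides that
  for all splines.\<close>

lemma interp_error_bounded:
  "\<exists>B>0. \<forall>l u. (\<forall>i. l $ i < u $ i) \<longrightarrow> cbox l u \<subseteq> unit_cube \<longrightarrow>
     (\<forall>x\<in>cbox l u. \<bar>f x - interp f (cbox l u) x\<bar> * \<Omega> x \<le> B)"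
proof -
  obtain A where A: "A > 0" "\<And>i x. x \<in> unit_cube \<Longrightarrow> a i x \<le> A" using bounded_a by auto
  obtain B where B: "B > 0" "\<And>x. x \<in> unit_cube \<Longrightarrow> \<Omega> x \<le> B" using bounded_\<Omega> by auto
  define S where "S = (\<Sum>i\<in>(UNIV :: 'n set). A / 8)"
  have "\<bar>f x - interp f (cbox l u) x\<bar> * \<Omega> x \<le> S * B" if lu: "\<forall>i. l $ i < u $ i" and sub: "cbox l u \<subseteq> unit_cube"
    and x: "x \<in> cbox l u" for l u x
  proof -
    have "l \<in> unit_cube" "u \<in> unit_cube" using sub lu by (auto simp: subset_iff mem_box_cart less_imp_le)
    then have h: "(u $ i - l $ i)^2 \<le> 1" for i
      using lu by (intro power_le_one) (auto simp: mem_box_cart less_imp_le diff_le_eq add_increasing2)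
    have "(\<Sum>i\<in>X. A * (u $ i - l $ i)^2 / 8) \<le> S" for X
    proof -
      have "(\<Sum>i\<in>X. A * (u $ i - l $ i)^2 / 8) \<le> (\<Sum>i\<in>X. A / 8)"
        using h A by (intro sum_mono) (simp add: mult_left_le)
      also have "\<dots> \<le> S" unfolding S_def using A by (intro sum_mono2) auto
      finally show ?thesis .
    qed
    then have "\<bar>f x - interp f (cbox l u) x\<bar> \<le> 0 + S"
      using lu sub A(2) x interp_exists[of l u] by (intro error_upper[where hi = "\<lambda>_. A" and l = l and u = u]) auto
    then show ?thesis using B sub x \<Omega>_pos[of x] by (intro mult_mono) (auto simp: less_imp_le)
  qed
  moreover have "S > 0" using A by (simp add: S_def)
  ultimately show ?thesis using B by (intro exI[of _ "S * B"]) auto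
qed

lemma wnorm_le:
  assumes "\<And>x. x \<in> unit_cube \<Longrightarrow> \<bar>g x\<bar> * \<Omega> x \<le> E"
  shows "wnorm unit_cube \<Omega> g \<le> E"
  unfolding wnorm_def by (rule cSUP_least) (use assms in \<open>auto simp: interval_ne_empty_cart\<close>)

text \<open>The supremum of an unbounded function would not be an upper bound; hence the hypothesis.\<close>

lemma le_wnorm:
  assumes "\<And>x. x \<in> unit_cube \<Longrightarrow> \<bar>g x\<bar> * \<Omega> x \<le> E" "x \<in> unit_cube"
  shows "\<bar>g x\<bar> * \<Omega> x \<le> wnorm unit_cube \<Omega> g"
  unfolding wnorm_def by (rule cSUP_upper) (use assms in \<open>auto intro!: bdd_aboveI2\<close>)

text \<open>The spline is the interpolant in the interior of \<open>R\<close>; the faces follow by continuity.\<close>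

lemma interp_error_le_wnorm:
  assumes P: "box_partition unit_cube N P" and R: "R \<in> P" and x: "x \<in> R"
  shows "\<bar>f x - interp f R x\<bar> * \<Omega> x \<le> wnorm unit_cube \<Omega> (\<lambda>x. f x - spline f P x)" (is "_ \<le> ?W")
proof -
  have div: "P division_of unit_cube" and int: "\<And>R. R \<in> P \<Longrightarrow> interior R \<noteq> {}" using P by (auto simp: box_partition_def)
  obtain B where B: "\<And>l u x. (\<forall>i. l $ i < u $ i) \<Longrightarrow> cbox l u \<subseteq> unit_cube \<Longrightarrow>
     x\<in>cbox l u \<Longrightarrow> \<bar>f x - interp f (cbox l u) x\<bar> * \<Omega> x \<le> B" using interp_error_bounded by metis
  have bdd: "\<bar>f x - spline f P x\<bar> * \<Omega> x \<le> B" if "x \<in> unit_cube" for x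
  proof (rule spline_error_le[OF P that])
    show "0 \<le> \<Omega> x" using \<Omega>_pos[OF that] by simp
    fix R assume "R \<in> P" "x \<in> R"
    then show "\<bar>f x - interp f R x\<bar> * \<Omega> x \<le> B"
      using B division_box_cases[OF div _ int] by metis
  qed
  obtain l u where lu: "R = cbox l u" "\<And>i. l $ i < u $ i" "R \<subseteq> unit_cube"
    using division_box_cases[OF div R int[OF R]] by metis
  have cl: "closure (interior R) = R"
    using int[OF R] unfolding lu(1) by (simp add: interior_cbox closure_box)
  have p: "interp f R \<in> P1" using interp_exists[OF lu(2)] lu(1) by simp
  show ?thesis
  proof (rule continuous_le_on_closure[where S = "interior R"])
    show "continuous_on (closure (interior R)) (\<lambda>x. \<bar>f x - interp f R x\<bar> * \<Omega> x)"
      unfolding cl using lu(3) f_cont \<Omega>_cont P1_continuous[OF p]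
      by (intro continuous_intros) (auto intro: continuous_on_subset)
    show "x \<in> closure (interior R)" using cl x by simp
    fix z assume z: "z \<in> interior R"
    then have "z \<in> unit_cube" using lu(3) interior_subset by blast
    then have "\<bar>f z - spline f P z\<bar> * \<Omega> z \<le> ?W"
      by (intro le_wnorm) (rule bdd)
    then show "\<bar>f z - interp f R z\<bar> * \<Omega> z \<le> ?W"
      unfolding spline_eq_interp_interior[OF P R z, of f] .
  qed
qed

lemma wnorm_spline_nonneg:
  assumes P: "box_partition unit_cube N P"
  shows "0 \<le> wnorm unit_cube \<Omega> (\<lambda>x. f x - spline f P x)"
proof -
  have div: "P division_of unit_cube" using P by (simp add: box_partition_def)
  have "0 \<in> (unit_cube :: (real^'n) set)" by (simp add: mem_box_cart)
  then obtain R where R: "R \<in> P" "0 \<in> R" using division_ofD(6)[OF div] by blast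
  have "0 \<le> \<bar>f 0 - interp f R 0\<bar> * \<Omega> 0" using \<Omega>_pos[of 0] by (simp add: mem_box_cart)
  then show ?thesis using interp_error_le_wnorm[OF P R] by simp
qed

end

text \<open>Admissibility concerns the whole sequence, hence every box partition into \<open>N\<close> boxes competes in the
  definition of the optimal error, as soon as one admissible sequence exists.\<close>

lemma admissible_update:
  fixes D :: "(real^'n) set"
  assumes S: "admissible D S" and N: "N \<ge> 1" and P: "box_partition D N P"
  shows "admissible D (S(N := P))"
proof -
  let ?h = "\<lambda>S N. real N powr (1 / real CARD('n)) * Max (diameter ` S N)"
  have "bdd_above (?h S ` {1..})" using S by (simp add: admissible_def)
  then have "bdd_above (insert (?h (S(N := P)) N) (?h S ` {1..}))" by simp
  then have "bdd_above (?h (S(N := P)) ` {1..})"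
    by (rule bdd_above_mono) auto
  then show ?thesis using S P by (auto simp: admissible_def)
qed

context multilinear_approximation
begin

lemma opt_error_le:
  fixes S :: "nat \<Rightarrow> (real^'n) set set"
  assumes "admissible unit_cube S" "N \<ge> 1" "box_partition unit_cube N P"
    and "\<And>R x. R \<in> P \<Longrightarrow> x \<in> R \<Longrightarrow> \<bar>f x - interp f R x\<bar> * \<Omega> x \<le> E"
  shows "opt_error unit_cube \<Omega> f N \<le> E"
proof -
  have "opt_error unit_cube \<Omega> f N \<le> wnorm unit_cube \<Omega> (\<lambda>x. f x - spline f P x)"
    unfolding opt_error_def
  proof (rule cINF_lower)
    show "P \<in> {S N |S. admissible unit_cube S}"
      using admissible_update[OF assms(1-3)] by (metis (mono_tags, lifting) CollectI fun_upd_same)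
    show "bdd_below ((\<lambda>P. wnorm unit_cube \<Omega> (\<lambda>x. f x - spline f P x)) ` {S N |S. admissible unit_cube S})"
      using wnorm_spline_nonneg assms(2) by (intro bdd_belowI2[of _ 0]) (auto simp: admissible_def)
  qed
  also have "\<dots> \<le> E"
  proof (rule wnorm_le)
    fix x :: "real^'n" assume "x \<in> unit_cube"
    then show "\<bar>f x - spline f P x\<bar> * \<Omega> x \<le> E"
      using assms(4) \<Omega>_pos[of x] by (intro spline_error_le[OF assms(3)]) auto
  qed
  finally show ?thesis .
qed

lemma root_nat_at_top: "filterlim (\<lambda>N. root CARD('n) (real N)) at_top sequentially"
proof -
  have "eventually (\<lambda>N. Z \<le> root CARD('n) (real N)) sequentially" for Z
    using eventually_ge_at_top[of "nat \<lceil>\<bar>Z\<bar> ^ CARD('n)\<rceil>"]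
  proof eventually_elim
    case (elim N)
    then have "\<bar>Z\<bar> ^ CARD('n) \<le> real N" by linarith
    then have "root CARD('n) (\<bar>Z\<bar> ^ CARD('n)) \<le> root CARD('n) (real N)" by simp
    then show ?case by (simp add: real_root_power_cancel)
  qed
  then show ?thesis by (simp add: filterlim_at_top)
qed

lemma eventually_le_root_square: "eventually (\<lambda>N. c \<le> (root CARD('n) (real N))^2) sequentially"
proof -
  have "filterlim (\<lambda>N. (root CARD('n) (real N))^2) at_top sequentially"
    by (rule filterlim_pow_at_top[OF _ root_nat_at_top]) simp
  then show ?thesis by (simp add: filterlim_at_top)
qed

text \<open>If some partition had an error below \<open>e = L / (\<theta>\<^sup>2 N\<^bsup>2/d\<^esup>)\<close>, the lower bound, applied with a positive number
  \<open>E\<close> strictly between the two, would give \<open>e \<le> E\<close>.  For large \<open>N\<close> the number \<open>e\<close> is small enough for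
  the lower bound to be applicable.\<close>

lemma opt_error_lower:
  fixes S :: "nat \<Rightarrow> (real^'n) set set"
  assumes \<theta>: "1 < \<theta>" and S: "admissible unit_cube S"
  shows "eventually (\<lambda>N. L \<le> \<theta>^2 * (root CARD('n) (real N))^2 * opt_error unit_cube \<Omega> f N) sequentially"
proof -
  obtain E0 where E0: "E0 > 0" "\<And>P E. P division_of unit_cube \<Longrightarrow> (\<forall>R\<in>P. interior R \<noteq> {}) \<Longrightarrow> 0 < E \<Longrightarrow> E \<le> E0 \<Longrightarrow>
     (\<forall>R\<in>P. \<forall>x\<in>R. \<bar>f x - interp f R x\<bar> * \<Omega> x \<le> E) \<Longrightarrow> L \<le> \<theta>^2 * (root CARD('n) (real (card P)))^2 * E"
    using partition_lower_bound_L[OF \<theta>] by metis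
  have "eventually (\<lambda>N. L / (\<theta>^2 * E0) \<le> (root CARD('n) (real N))^2 \<and> N \<ge> 1) sequentially"
    by (intro eventually_conj eventually_le_root_square eventually_ge_at_top)
  then show ?thesis
  proof eventually_elim
    case (elim N)
    define c where "c = \<theta>^2 * (root CARD('n) (real N))^2"
    define e where "e = L / c"
    have c0: "c > 0" using elim \<theta> by (simp add: c_def)
    have e0: "0 < e" using L_pos c0 by (simp add: e_def)
    have eE: "e \<le> E0" using elim c0 E0 \<theta> by (simp add: e_def c_def field_simps)
    have "e \<le> opt_error unit_cube \<Omega> f N"
      unfolding opt_error_def
    proof (rule cINF_greatest)
      have "S N \<in> {S N |S. admissible unit_cube S}" using S by (intro CollectI exI[of _ S]) simp
      then show "{S N |S. admissible (unit_cube :: (real^'n) set) S} \<noteq> {}" by blast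
      fix P :: "(real^'n) set set" assume "P \<in> {S N |S. admissible unit_cube S}"
      then obtain S' where "admissible unit_cube S'" "P = S' N" by blast
      then have P: "box_partition unit_cube N P" using elim by (simp add: admissible_def)
      let ?W = "wnorm unit_cube \<Omega> (\<lambda>x. f x - spline f P x)"
      show "e \<le> ?W"
      proof (rule ccontr)
        assume "\<not> e \<le> ?W"
        then have "?W < e" by simp
        \<comment> \<open>the lower bound is stated for positive \<open>E\<close>, whereas the error itself could vanish\<close>
        from dense[OF this] obtain E where E: "?W < E" "E < e" by blast
        have "L \<le> \<theta>^2 * (root CARD('n) (real (card P)))^2 * E"
        proof (rule E0(2))
          show "P division_of unit_cube" "\<forall>R\<in>P. interior R \<noteq> {}" using P by (auto simp: box_partition_def)
          show "0 < E" using E wnorm_spline_nonneg[OF P] by simp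
          show "E \<le> E0" using E eE by simp
          show "\<forall>R\<in>P. \<forall>x\<in>R. \<bar>f x - interp f R x\<bar> * \<Omega> x \<le> E"
            using interp_error_le_wnorm[OF P] E(1) by fastforce
        qed
        also have "\<dots> = c * E" using P by (simp add: c_def box_partition_def)
        also have "\<dots> < c * e" using E c0 by simp
        also have "\<dots> = L" using c0 by (simp add: e_def)
        finally show False by simp
      qed
    qed
    then have "L \<le> c * opt_error unit_cube \<Omega> f N" using c0 by (simp add: e_def field_simps)
    then show ?case by (simp add: c_def)
  qed
qed

end

section \<open>Blocks of cells inside a grid\<close>

text \<open>The unit cube is divided into \<open>m\<^sup>d\<close> cubes of \<open>w\<^sup>d\<close> cells each.  In cube \<open>j\<close> the cells are collected into
  blocks of \<open>r j i\<close> cells along axis \<open>i\<close>, starting one cell away from the lower faces of the cube.  Thus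
  blocks of different cubes have no common point, and the cell at the origin is in no block.\<close>

locale core_grid =
  fixes m w :: nat and r :: "('n::finite \<Rightarrow> nat) \<Rightarrow> 'n \<Rightarrow> nat"
  assumes m: "0 < m" and w: "0 < w" and r: "\<And>j i. 0 < r j i"
begin

definition M :: nat where "M = m * w"

definition K :: "('n \<Rightarrow> nat) set" where "K = cells (\<lambda>_. 0, \<lambda>_. M)"

definition cubes :: "('n \<Rightarrow> nat) set" where "cubes = PiE UNIV (\<lambda>_. {..<m})"

definition q :: "('n \<Rightarrow> nat) \<Rightarrow> 'n \<Rightarrow> nat" where
  "q j i = (w - 1) div r j i"

text \<open>Since the blocks start with offset one, this is the cube of a cell of a block, and also the cube of the
  vertices of a block: vertices on the upper faces of a cube still belong to it.\<close>

definition cube :: "('n \<Rightarrow> nat) \<Rightarrow> 'n \<Rightarrow> nat" where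
  "cube k = (\<lambda>i. (k i - 1) div w)"

definition block_index :: "('n \<Rightarrow> nat) \<Rightarrow> 'n \<Rightarrow> nat" where
  "block_index k = (\<lambda>i. (k i - 1) mod w div r (cube k) i)"

text \<open>The cells that belong to some block.\<close>

definition core :: "('n \<Rightarrow> nat) \<Rightarrow> bool" where
  "core k \<longleftrightarrow> (\<forall>i. 1 \<le> k i \<and> (k i - 1) mod w < r (cube k) i * q (cube k) i)"

definition corner :: "('n \<Rightarrow> nat) \<Rightarrow> ('n \<Rightarrow> nat) \<Rightarrow> 'n \<Rightarrow> nat" where
  "corner j t = (\<lambda>i. w * j i + 1 + r j i * t i)"

definition block :: "('n \<Rightarrow> nat) \<Rightarrow> ('n \<Rightarrow> nat) \<Rightarrow> ('n \<Rightarrow> nat) \<times> ('n \<Rightarrow> nat)" where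
  "block j t = (corner j t, corner j (succ t))"

definition own :: "('n \<Rightarrow> nat) \<Rightarrow> ('n \<Rightarrow> nat) \<times> ('n \<Rightarrow> nat)" where
  "own k = (if core k then block (cube k) (block_index k) else (k, succ k))"

lemma M_pos: "0 < M" using m w by (simp add: M_def)

lemma rq_less: "r j i * q j i < w"
  using w by (metis One_nat_def Suc_pred less_Suc_eq_le mult.commute q_def times_div_less_eq_dividend)

text \<open>What the division of \<open>w - 1\<close> by \<open>r j i\<close> leaves over, together with the offset of one cell.\<close>

lemma gap_le: "w - r j i * q j i \<le> r j i"
proof -
  have "(w - 1) mod r j i < r j i" by (rule mod_less_divisor[OF r])
  moreover have "r j i * q j i + (w - 1) mod r j i = w - 1" unfolding q_def by (rule mult_div_mod_eq)
  ultimately show ?thesis by linarith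
qed

lemma finite_K: "finite K"
proof -
  have "K = PiE UNIV (\<lambda>_. {..<M})" by (auto simp: K_def cells_def)
  then show ?thesis by (simp add: finite_PiE)
qed

lemma finite_cubes: "finite cubes"
  by (simp add: cubes_def finite_PiE)

lemma cube_in_cubes:
  assumes "k \<in> K"
  shows "cube k \<in> cubes"
proof -
  have "(k i - 1) div w < m" for i
  proof (rule less_mult_imp_div_less)
    show "k i - 1 < m * w" using assms by (simp add: K_def cells_def M_def less_imp_diff_less)
  qed
  then show ?thesis unfolding cubes_def cube_def by auto
qed

lemma core_block_index:
  assumes "core k"
  shows "block_index k i < q (cube k) i"
  unfolding block_index_def
proof (rule less_mult_imp_div_less)
  show "(k i - 1) mod w < q (cube k) i * r (cube k) i"
    using assms by (simp add: core_def mult.commute)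
qed

lemma core_block: "core k \<Longrightarrow> k \<in> cells (block (cube k) (block_index k))"
proof -
  assume c: "core k"
  have "corner (cube k) (block_index k) i \<le> k i \<and> k i < corner (cube k) (succ (block_index k)) i" for i
  proof -
    define s where "s = (k i - 1) mod w"
    define R where "R = r (cube k) i"
    have "k i - 1 = w * cube k i + s" by (simp add: cube_def s_def)
    then have "k i = w * cube k i + 1 + s" using c unfolding core_def by (metis Suc_eq_plus1 add.commute add.left_commute le_add_diff_inverse2)
    moreover have "R * (s div R) \<le> s" by simp
    moreover have "s < R * (s div R) + R"
      using r[of "cube k" i] by (metis R_def add.commute mult.commute dividend_less_div_times)
    moreover have "block_index k i = s div R" by (simp add: block_index_def s_def R_def)
    ultimately show ?thesis by (simp add: corner_def R_def)
  qed
  then show ?thesis by (simp add: cells_def block_def)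
qed

text \<open>A node determines the cube of any block to which it belongs, so that \<open>nodal_value\<close> below is unambiguous.\<close>

lemma cube_of_block_vertex:
  assumes t: "\<And>i. t i < q j i" and v: "\<And>i. corner j t i \<le> v i" "\<And>i. v i \<le> corner j (succ t) i"
  shows "cube v = j"
proof -
  have *: "\<exists>s. v i - 1 = w * j i + s \<and> s \<le> r j i * q j i" for i
  proof (intro exI conjI)
    show "v i - 1 = w * j i + (v i - 1 - w * j i)" using v(1)[of i] by (simp add: corner_def)
    have "r j i * Suc (t i) \<le> r j i * q j i" using t[of i] by (intro mult_le_mono2) simp
    then show "v i - 1 - w * j i \<le> r j i * q j i" using v(2)[of i] by (simp add: corner_def)
  qed
  have "(v i - 1) div w = j i" for i
  proof -
    obtain s where s: "v i - 1 = w * j i + s" "s \<le> r j i * q j i" using * by blast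
    then have "s < w" using rq_less[of j i] by simp
    then show ?thesis using s w by simp
  qed
  then show ?thesis by (auto simp: cube_def)
qed

lemma block_cells:
  assumes t: "\<And>i. t i < q j i" and k: "k \<in> cells (block j t)"
  shows "core k" and "cube k = j" and "block_index k = t"
proof -
  have *: "\<exists>s. k i - 1 = w * j i + r j i * t i + s \<and> s < r j i \<and> 1 \<le> k i" for i
  proof (intro exI conjI)
    have *: "corner j t i \<le> k i" "k i < corner j (succ t) i" using k by (auto simp: cells_def block_def)
    show "k i - 1 = w * j i + r j i * t i + (k i - 1 - w * j i - r j i * t i)"
     "k i - 1 - w * j i - r j i * t i < r j i" "1 \<le> k i" using * r[of j i] by (auto simp: corner_def)
  qed
  have **: "(k i - 1) div w = j i \<and> (k i - 1) mod w < r j i * q j i \<and> (k i - 1) mod w div r j i = t i \<and> 1 \<le> k i" for i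
  proof -
    obtain s where s: "k i - 1 = w * j i + (r j i * t i + s)" "s < r j i" "1 \<le> k i" using *[of i] by auto
    have "r j i * Suc (t i) \<le> r j i * q j i" using t[of i] by (intro mult_le_mono2) simp
    then have a: "r j i * t i + s < r j i * q j i" using s by simp
    then have b: "r j i * t i + s < w" using rq_less[of j i] by simp
    show ?thesis using s a b w by simp
  qed
  show "cube k = j" using ** by (auto simp: cube_def)
  then show "core k" "block_index k = t" using ** by (auto simp: core_def block_index_def)
qed

lemma block_below_M:
  assumes t: "\<And>i. t i < q j i" and j: "j \<in> cubes"
  shows "corner j (succ t) i \<le> M"
proof -
  have "r j i * Suc (t i) \<le> r j i * q j i" using t[of i] by (intro mult_le_mono2) simp
  then have "corner j (succ t) i \<le> w * j i + w" using rq_less[of j i] by (simp add: corner_def)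
  also have "\<dots> = w * Suc (j i)" by simp
  also have "\<dots> \<le> w * m" using j by (intro mult_le_mono2) (auto simp: cubes_def Suc_le_eq)
  finally show ?thesis by (simp add: M_def mult.commute)
qed

lemma own_mem: "k \<in> cells (own k)"
  using core_block by (auto simp: own_def) (simp add: cells_def)

lemma own_coherent:
  assumes k: "k \<in> K" and k': "k' \<in> cells (own k)"
  shows "k' \<in> K \<and> own k' = own k"
proof (cases "core k")
  case True
  note t = core_block_index[OF True]
  have k'b: "k' \<in> cells (block (cube k) (block_index k))" using k' True by (simp add: own_def)
  note b = block_cells[OF t k'b]
  have "k' \<in> K"
    using k'b block_below_M[OF t cube_in_cubes[OF k]] less_le_trans
    by (fastforce simp: K_def cells_def block_def)
  then show ?thesis using b True by (simp add: own_def)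
next
  case False
  then have "k' = k" using k' by (auto simp: own_def cells_def fun_eq_iff less_Suc_eq_le intro: antisym)
  then show ?thesis using k by simp
qed

lemma card_blocks_le: "card (own ` {k \<in> K. core k}) \<le> (\<Sum>j\<in>cubes. \<Prod>i\<in>UNIV. q j i)"
proof -
  let ?S = "SIGMA j:cubes. PiE UNIV (\<lambda>i. {..<q j i})"
  have "own ` {k \<in> K. core k} \<subseteq> (\<lambda>(j,t). block j t) ` ?S"
  proof
    fix B assume "B \<in> own ` {k \<in> K. core k}"
    then obtain k where k: "k \<in> K" "core k" "B = own k" by blast
    then have "(cube k, block_index k) \<in> ?S" using cube_in_cubes core_block_index by auto
    moreover have "B = (\<lambda>(j,t). block j t) (cube k, block_index k)" using k by (simp add: own_def)
    ultimately show "B \<in> (\<lambda>(j,t). block j t) ` ?S" by blast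
  qed
  moreover have fin: "finite ?S" using finite_cubes by (auto intro!: finite_PiE)
  ultimately have "card (own ` {k \<in> K. core k}) \<le> card ((\<lambda>(j,t). block j t) ` ?S)"
    by (intro card_mono) auto
  also have "\<dots> \<le> card ?S" using fin by (rule card_image_le)
  also have "\<dots> = (\<Sum>j\<in>cubes. card (PiE UNIV (\<lambda>i. {..<q j i})))"
    using finite_cubes by (intro card_SigmaI) (auto intro!: finite_PiE)
  also have "\<dots> = (\<Sum>j\<in>cubes. \<Prod>i\<in>UNIV. q j i)" by (simp add: card_PiE)
  finally show ?thesis .
qed

text \<open>A cell outside the blocks has, along some axis \<open>i\<close>, one of at most \<open>r j i\<close> positions, which leaves
  \<open>w\<^bsup>d-1\<^esup>\<close> possibilities for the other axes.  The cube of such a cell is found by division without the offset.\<close>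

lemma card_noncore_le:
  "card {k \<in> K. \<not> core k} \<le> (\<Sum>j\<in>cubes. \<Sum>i\<in>UNIV. r j i * w ^ (CARD('n) - 1))"
proof -
  define bad where "bad j i = insert (w * j i) {w * j i + 1 + r j i * q j i..<w * j i + w}" for j i
  define X where "X j i = PiE UNIV (\<lambda>l. if l = i then bad j i else {w * j l..<w * j l + w})" for j i
  have sub: "{k \<in> K. \<not> core k} \<subseteq> (\<Union>j\<in>cubes. \<Union>i\<in>UNIV. X j i)"
  proof
    fix k assume "k \<in> {k \<in> K. \<not> core k}"
    then have k: "k \<in> K" "\<not> core k" by auto
    define j where "j = (\<lambda>i. k i div w)"
    have ki: "k i = w * j i + k i mod w" for i by (simp add: j_def)
    have jc: "j \<in> cubes"
      using k(1) by (auto simp: K_def cells_def cubes_def j_def M_def intro!: less_mult_imp_div_less)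
    have "\<exists>i. k i mod w = 0 \<or> r j i * q j i < k i mod w"
    proof (rule ccontr)
      assume "\<not> ?thesis"
      then have n: "0 < k i mod w" "k i mod w \<le> r j i * q j i" for i by (auto simp: not_less)
      have e: "k i - 1 = w * j i + (k i mod w - 1)" for i using ki[of i] n(1)[of i] by simp
      have l: "k i mod w - 1 < w" for i using w by (meson less_imp_diff_less mod_less_divisor)
      have "(k i - 1) div w = j i \<and> (k i - 1) mod w = k i mod w - 1" for i
        unfolding e[of i] using l[of i] w by simp
      then have "cube k = j" "\<And>i. (k i - 1) mod w = k i mod w - 1" by (auto simp: cube_def)
      moreover have "1 \<le> k i" for i using n(1)[of i] by (cases "k i") auto
      ultimately have "core k" using n unfolding core_def
        by (metis One_nat_def Suc_pred less_eq_Suc_le)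
      then show False using k by simp
    qed
    then obtain i where i: "k i mod w = 0 \<or> r j i * q j i < k i mod w" ..
    have lw: "k l mod w < w" for l using w by simp
    have "k i \<in> bad j i" using i ki[of i] lw[of i] by (auto simp: bad_def)
    moreover have "k l \<in> {w * j l..<w * j l + w}" for l using ki[of l] lw[of l] by simp
    ultimately have "k \<in> X j i" by (auto simp: X_def)
    then show "k \<in> (\<Union>j\<in>cubes. \<Union>i\<in>UNIV. X j i)" using jc by blast
  qed
  have X: "finite (X j i)" "card (X j i) \<le> r j i * w ^ (CARD('n) - 1)" for j i
  proof -
    show "finite (X j i)" unfolding X_def by (intro finite_PiE) (auto simp: bad_def)
    have "card (bad j i) \<le> Suc (w - 1 - r j i * q j i)"
      unfolding bad_def by (rule order_trans[OF card_insert_le_m1]) auto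
    also have "\<dots> = w - r j i * q j i" using rq_less[of j i] by simp
    also have "\<dots> \<le> r j i" by (rule gap_le)
    finally have b: "card (bad j i) \<le> r j i" .
    have "card (X j i) = (\<Prod>l\<in>UNIV. if l = i then card (bad j i) else w)"
      unfolding X_def by (subst card_PiE) (auto intro!: prod.cong)
    also have "\<dots> = card (bad j i) * (\<Prod>l\<in>UNIV - {i}. w)"
      by (subst prod.remove[of UNIV i]) (auto intro!: prod.cong)
    also have "\<dots> \<le> r j i * w ^ (CARD('n) - 1)" using b by (simp add: card_Diff_singleton)
    finally show "card (X j i) \<le> r j i * w ^ (CARD('n) - 1)" .
  qed
  have "card {k \<in> K. \<not> core k} \<le> card (\<Union>j\<in>cubes. \<Union>i\<in>UNIV. X j i)"
    using finite_cubes X(1) by (intro card_mono sub) auto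
  also have "\<dots> \<le> (\<Sum>j\<in>cubes. card (\<Union>i\<in>UNIV. X j i))" by (rule card_UN_le[OF finite_cubes])
  also have "\<dots> \<le> (\<Sum>j\<in>cubes. \<Sum>i\<in>UNIV. card (X j i))" by (intro sum_mono card_UN_le) simp
  also have "\<dots> \<le> (\<Sum>j\<in>cubes. \<Sum>i\<in>UNIV. r j i * w ^ (CARD('n) - 1))" by (intro sum_mono X(2))
  finally show ?thesis .
qed

abbreviation pt :: "('n \<Rightarrow> nat) \<Rightarrow> real^'n" where
  "pt \<equiv> node (\<lambda>_. 0) (\<lambda>_. 1 / real M)"

abbreviation rbox :: "('n \<Rightarrow> nat) \<times> ('n \<Rightarrow> nat) \<Rightarrow> (real^'n) set" where
  "rbox B \<equiv> grid_box (\<lambda>_. 0) (\<lambda>_. 1 / real M) (fst B) (snd B)"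

lemma rbox_K: "rbox (\<lambda>_. 0, \<lambda>_. M) = unit_cube"
proof -
  have "pt (\<lambda>_. 0) = 0" "pt (\<lambda>_. M) = 1" using M_pos by (auto simp: vec_eq_iff)
  then show ?thesis by (simp add: grid_box_def)
qed

lemma own_division: "rbox ` own ` K division_of unit_cube"
proof -
  have "rbox ` own ` K division_of rbox (\<lambda>_. 0, \<lambda>_. M)"
    unfolding K_def fst_conv snd_conv
  proof (rule grid_division)
    fix k k' assume "k \<in> cells (\<lambda>_. 0, \<lambda>_. M)" "k' \<in> cells (own k)"
    then show "k' \<in> cells (\<lambda>_. 0, \<lambda>_. M) \<and> own k' = own k"
      using own_coherent[of k k'] unfolding K_def by blast
  qed (use M_pos own_mem in auto)
  then show ?thesis by (simp only: rbox_K)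
qed

text \<open>The interpolant of \<open>f\<close> on the grid formed by the blocks of cube \<open>j\<close>.  Having one function for all blocks
  of a cube makes the values on common faces consistent.\<close>

definition coarse_spline :: "(real^'n \<Rightarrow> real) \<Rightarrow> ('n \<Rightarrow> nat) \<Rightarrow> real^'n \<Rightarrow> real" where
  "coarse_spline f j = tent_spline (\<lambda>i. real (w * j i + 1) / M) (\<lambda>i. real (r j i) / M) (q j) (\<lambda>t. f (pt (corner j t)))"

definition touches_core :: "('n \<Rightarrow> nat) \<Rightarrow> bool" where
  "touches_core v \<longleftrightarrow> (\<exists>k. core k \<and> (\<forall>i. k i \<le> v i \<and> v i \<le> Suc (k i)))"

text \<open>The value \<open>z\<close> at the origin is a free parameter; it will be chosen different from \<open>f 0\<close>.\<close>

definition nodal_value :: "(real^'n \<Rightarrow> real) \<Rightarrow> real \<Rightarrow> ('n \<Rightarrow> nat) \<Rightarrow> real" where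
  "nodal_value f z v = (if v = (\<lambda>_. 0) then z
     else if touches_core v then coarse_spline f (cube v) (pt v) else f (pt v))"

definition quasi_spline :: "(real^'n \<Rightarrow> real) \<Rightarrow> real \<Rightarrow> real^'n \<Rightarrow> real" where
  "quasi_spline f z = tent_spline (\<lambda>_. 0) (\<lambda>_. 1 / real M) (\<lambda>_. M) (nodal_value f z)"

lemma quasi_spline_continuous: "continuous_on A (quasi_spline f z)"
  unfolding quasi_spline_def using M_pos by (intro tent_spline_continuous) auto

lemma pt_succ_less: "pt k $ i < pt (succ k) $ i"
  using M_pos by (simp add: divide_strict_right_mono)

lemma pt_less: "s i < t i \<Longrightarrow> pt s $ i < pt t $ i"
  using M_pos by (simp add: divide_strict_right_mono)

lemma vertex_is_node:
  assumes "\<And>i. v $ i = pt k $ i \<or> v $ i = pt k' $ i"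
  shows "\<exists>u. v = pt u \<and> (\<forall>i. u i = k i \<or> u i = k' i)"
proof -
  have "\<forall>i. \<exists>u. v $ i = real u / M \<and> (u = k i \<or> u = k' i)"
    using assms by auto
  then obtain u where "\<And>i. v $ i = real (u i) / M \<and> (u i = k i \<or> u i = k' i)" by metis
  then show ?thesis by (intro exI[of _ u]) (auto simp: vec_eq_iff)
qed

lemma quasi_spline_node:
  assumes "\<And>i. u i \<le> M"
  shows "quasi_spline f z (pt u) = nodal_value f z u"
  unfolding quasi_spline_def using assms M_pos by (intro tent_spline_node) auto

lemma quasi_spline_cell:
  assumes "k \<in> K"
  shows "\<exists>p\<in>P1. (\<forall>x\<in>rbox (k, succ k). quasi_spline f z x = p x) \<and>
     (\<forall>u. (\<forall>i. u i = k i \<or> u i = Suc (k i)) \<longrightarrow> p (pt u) = nodal_value f z u)"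
proof -
  obtain p where p: "p \<in> P1" "\<forall>x\<in>rbox (k, succ k). quasi_spline f z x = p x"
    using tent_spline_cell[of "\<lambda>_. 1 / real M" "\<lambda>_. 0" k "\<lambda>_. M" "nodal_value f z"] M_pos
    unfolding quasi_spline_def by auto
  have "p (pt u) = nodal_value f z u" if u: "\<And>i. u i = k i \<or> u i = Suc (k i)" for u
  proof -
    have "pt u \<in> rbox (k, succ k)"
    proof -
      have "k i \<le> u i \<and> u i \<le> succ k i" for i using u[of i] by auto
      then have "real (k i) \<le> real (u i) \<and> real (u i) \<le> real (succ k i)" for i by (simp only: of_nat_le_iff)
      then show ?thesis by (simp add: grid_box_def mem_box_cart divide_right_mono del: succ_apply)
    qed
    then have "p (pt u) = quasi_spline f z (pt u)" using p by simp
    also have "\<dots> = nodal_value f z u"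
    proof (rule quasi_spline_node)
      fix i
      have "k i < M" using assms by (simp add: K_def cells_def)
      then show "u i \<le> M" using u[of i] by linarith
    qed
    finally show ?thesis .
  qed
  then show ?thesis using p by blast
qed

text \<open>A block is one cell of the coarse grid of its cube.\<close>

lemma coarse_spline_on_block:
  assumes t: "\<And>i. t i < q j i" and x: "x \<in> rbox (block j t)"
  shows "coarse_spline f j x = interp f (rbox (block j t)) x"
proof -
  let ?b = "\<lambda>i. real (w * j i + 1) / M" and ?\<delta> = "\<lambda>i. real (r j i) / M"
  have \<delta>: "0 < ?\<delta> i" for i using r M_pos by simp
  have n: "node ?b ?\<delta> u = pt (corner j u)" for u
    by (auto simp: vec_eq_iff corner_def add_divide_distrib)
  have cell: "grid_box ?b ?\<delta> t (succ t) = rbox (block j t)"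
    unfolding grid_box_def block_def fst_conv snd_conv n ..
  obtain p where p: "p \<in> P1" "\<forall>x\<in>rbox (block j t). coarse_spline f j x = p x"
    using tent_spline_cell[of ?\<delta> ?b t "q j", OF \<delta>] unfolding cell coarse_spline_def by blast
  have lt: "pt (corner j t) $ i < pt (corner j (succ t)) $ i" for i
    by (rule pt_less) (use r in \<open>simp add: corner_def\<close>)
  have "interp f (rbox (block j t)) = p"
    unfolding block_def grid_box_def fst_conv snd_conv
  proof (rule interp_unique[OF lt p(1)])
    fix v assume v: "\<And>i. v $ i = pt (corner j t) $ i \<or> v $ i = pt (corner j (succ t)) $ i"
    define u where "u i = (if v $ i = pt (corner j t) $ i then t i else Suc (t i))" for i
    have vu: "v = pt (corner j u)"
    proof (subst vec_eq_iff, rule allI)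
      fix i
      have "corner j u i = (if v $ i = pt (corner j t) $ i then corner j t i else corner j (succ t) i)"
        by (simp only: corner_def u_def succ_apply split: if_split) simp
      then show "v $ i = pt (corner j u) $ i" using v[of i] by (metis node_nth)
    qed
    have "v \<in> rbox (block j t)"
      unfolding block_def grid_box_def fst_conv snd_conv mem_box_cart
      using v lt by (metis less_imp_le order_refl)
    then have "p v = coarse_spline f j v" using p by simp
    also have "\<dots> = f (pt (corner j u))"
      unfolding coarse_spline_def vu n[symmetric]
      by (rule tent_spline_node) (use \<delta> t in \<open>auto simp: u_def Suc_le_eq less_imp_le\<close>)
    finally show "p v = f v" using vu by simp
  qed
  then show ?thesis using p x by simp
qed

lemma rbox_mono: "(\<And>i. fst B i \<le> fst B' i) \<Longrightarrow> (\<And>i. snd B' i \<le> snd B i) \<Longrightarrow> rbox B' \<subseteq> rbox B"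
  by (rule grid_box_mono) (use M_pos in auto)

lemma touches_core_cases:
  assumes "touches_core u"
  obtains k where "core k" "cube u = cube k" "\<And>i. k i \<le> u i \<and> u i \<le> Suc (k i)"
    "pt u \<in> rbox (block (cube k) (block_index k))" "u \<noteq> (\<lambda>_. 0)"
proof -
  obtain k where k: "core k" "\<And>i. k i \<le> u i \<and> u i \<le> Suc (k i)" using assms by (auto simp: touches_core_def)
  note t = core_block_index[OF k(1)]
  have kb: "corner (cube k) (block_index k) i \<le> k i" "k i < corner (cube k) (succ (block_index k)) i" for i
    using core_block[OF k(1)] by (auto simp: cells_def block_def)
  have ub: "corner (cube k) (block_index k) i \<le> u i" "u i \<le> corner (cube k) (succ (block_index k)) i" for i
    using k(2)[of i] kb[of i] by linarith+
  have "cube u = cube k" by (rule cube_of_block_vertex[OF t ub])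
  moreover have "pt u \<in> rbox (block (cube k) (block_index k))"
    using ub M_pos by (auto simp: grid_box_def block_def mem_box_cart divide_right_mono)
  moreover have "u \<noteq> (\<lambda>_. 0)" using ub(1)[of undefined] by (auto simp: corner_def)
  ultimately show thesis using that k by blast
qed

text \<open>A fine cell of the block has all its vertices in the block, where the nodal values are those of the
  multilinear function \<open>interp f (rbox (own k))\<close>; by uniqueness the spline coincides with it on the cell.\<close>

lemma quasi_spline_on_block:
  assumes k: "k \<in> K" "core k" and x: "x \<in> rbox (own k)"
  shows "quasi_spline f z x = interp f (rbox (own k)) x"
proof -
  let ?j = "cube k" and ?t = "block_index k"
  note t = core_block_index[OF k(2)]
  have own: "own k = block ?j ?t" using k by (simp add: own_def)
  have lt: "corner ?j ?t i < corner ?j (succ ?t) i" for i using r by (simp add: corner_def)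
  have P: "interp f (rbox (own k)) \<in> P1"
    unfolding own block_def grid_box_def fst_conv snd_conv by (rule interp_exists(1)) (rule pt_less, rule lt)
  obtain k' where k': "k' \<in> cells (own k)" "x \<in> rbox (k', succ k')"
    using cell_containing_point[of "\<lambda>_. 1 / real M" "corner ?j ?t" "corner ?j (succ ?t)" x "\<lambda>_. 0"] x lt M_pos
    by (auto simp: own block_def)
  have k'K: "k' \<in> K" using own_coherent[OF k(1) k'(1)] by simp
  have k'c: "core k'" "cube k' = ?j" using block_cells[OF t k'(1)[unfolded own]] by auto
  have bnd: "corner ?j ?t i \<le> k' i" "Suc (k' i) \<le> corner ?j (succ ?t) i" for i
    using k'(1) by (auto simp: own block_def cells_def Suc_le_eq)
  obtain p where p: "p \<in> P1" "\<forall>x\<in>rbox (k', succ k'). quasi_spline f z x = p x"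
     "\<And>u. (\<forall>i. u i = k' i \<or> u i = Suc (k' i)) \<Longrightarrow> p (pt u) = nodal_value f z u"
    using quasi_spline_cell[OF k'K] by metis
  have "p = interp f (rbox (own k))"
  proof (rule P1_unique[OF p(1) P pt_succ_less[of k']])
    fix v assume "\<And>i. v $ i = pt k' $ i \<or> v $ i = pt (succ k') $ i"
    from vertex_is_node[OF this] obtain u where u: "v = pt u" "\<And>i. u i = k' i \<or> u i = Suc (k' i)"
      by auto
    have uk: "k' i \<le> u i \<and> u i \<le> Suc (k' i)" for i using u(2)[of i] by auto
    have tc: "touches_core u" using k'c(1) uk by (auto simp: touches_core_def)
    have ub: "corner ?j ?t i \<le> u i" "u i \<le> corner ?j (succ ?t) i" for i
      using uk[of i] bnd[of i] by linarith+
    have "p v = nodal_value f z u" using p(3) u by simp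
    also have "\<dots> = coarse_spline f ?j (pt u)"
      using tc ub(1)[of undefined] cube_of_block_vertex[OF t ub] by (auto simp: nodal_value_def corner_def)
    also have "\<dots> = interp f (rbox (own k)) (pt u)"
      unfolding own by (rule coarse_spline_on_block[OF t])
        (use ub M_pos in \<open>auto simp: grid_box_def block_def mem_box_cart divide_right_mono\<close>)
    finally show "p v = interp f (rbox (own k)) v" using u by simp
  qed
  then show ?thesis using p(2) k'(2) by simp
qed

end

section \<open>Refining a partition to a prescribed number of boxes\<close>

lemma unit_cell_division:
  fixes b \<delta> :: "'n::finite \<Rightarrow> real"
  assumes \<delta>: "\<And>i. 0 < \<delta> i" and n: "\<And>i. 0 < n i"
  shows "(\<lambda>k. grid_box b \<delta> k (succ k)) ` cells (\<lambda>_. 0, n) division_of grid_box b \<delta> (\<lambda>_. 0) n"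
    and "inj (\<lambda>k. grid_box b \<delta> k (succ k))"
    and "interior (grid_box b \<delta> k (succ k)) \<noteq> {}"
proof -
  have "(\<lambda>B. grid_box b \<delta> (fst B) (snd B)) ` (\<lambda>k. (k, succ k)) ` cells (\<lambda>_. 0, n) division_of grid_box b \<delta> (\<lambda>_. 0) n"
  proof (rule grid_division[OF \<delta> n])
    fix k k' assume k: "k \<in> cells (\<lambda>_. 0, n)" "k' \<in> cells (k, succ k)"
    have "k' = k" using k(2) by (auto simp: cells_def fun_eq_iff less_Suc_eq_le intro: antisym)
    then show "k' \<in> cells (\<lambda>_. 0, n) \<and> (k', succ k') = (k, succ k)" using k by simp
  qed (simp add: cells_def)
  then show "(\<lambda>k. grid_box b \<delta> k (succ k)) ` cells (\<lambda>_. 0, n) division_of grid_box b \<delta> (\<lambda>_. 0) n"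
    by (simp add: image_image)
  have lt: "node b \<delta> k $ i < node b \<delta> (succ k) $ i" for k i using \<delta>[of i] by simp
  show "interior (grid_box b \<delta> k (succ k)) \<noteq> {}"
    unfolding grid_box_def using lt by (simp add: interval_ne_empty_cart del: node_nth)
  show "inj (\<lambda>k. grid_box b \<delta> k (succ k))"
  proof (rule injI)
    fix k k' assume "grid_box b \<delta> k (succ k) = grid_box b \<delta> k' (succ k')"
    moreover have "cbox (node b \<delta> k) (node b \<delta> (succ k)) \<noteq> {}"
      using lt by (simp add: interval_ne_empty_cart less_imp_le del: node_nth)
    ultimately have "node b \<delta> k = node b \<delta> k'"
      unfolding grid_box_def by (simp add: eq_cbox)
    then have "\<delta> i * real (k i) = \<delta> i * real (k' i)" for i by (metis add_left_cancel node_nth)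
    then show "k = k'" using \<delta> by (auto simp: fun_eq_iff) (metis less_irrefl)
  qed
qed

text \<open>Slabs orthogonal to one axis.\<close>

lemma box_slices:
  fixes l u :: "real^'n"
  assumes lu: "\<And>i. l $ i < u $ i" and p: "0 < p"
  shows "\<exists>S. S division_of cbox l u \<and> (\<forall>R\<in>S. interior R \<noteq> {}) \<and> card S = p"
proof -
  fix i0 :: 'n
  define n where "n = (\<lambda>i. if i = i0 then p else 1)"
  define \<delta> where "\<delta> i = (u $ i - l $ i) / real (n i)" for i
  have n0: "0 < n i" for i using p by (simp add: n_def)
  have \<delta>0: "0 < \<delta> i" for i using lu n0 by (simp add: \<delta>_def)
  let ?c = "\<lambda>k. grid_box (\<lambda>i. l $ i) \<delta> k (succ k)"
  have box: "grid_box (\<lambda>i. l $ i) \<delta> (\<lambda>_. 0) n = cbox l u"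
  proof -
    have "node (\<lambda>i. l $ i) \<delta> (\<lambda>_. 0) = l" by (simp add: vec_eq_iff)
    moreover have "node (\<lambda>i. l $ i) \<delta> n = u"
    proof (subst vec_eq_iff, rule allI)
      fix i show "node (\<lambda>i. l $ i) \<delta> n $ i = u $ i" using n0[of i] by (simp add: \<delta>_def)
    qed
    ultimately show ?thesis by (simp add: grid_box_def)
  qed
  have "cells (\<lambda>_. 0, n) = PiE UNIV (\<lambda>i. {..<n i})" by (auto simp: cells_def)
  then have "card (cells (\<lambda>_. 0, n)) = (\<Prod>i\<in>UNIV. n i)" by (simp add: card_PiE)
  also have "\<dots> = p" by (simp add: n_def)
  finally have "card (?c ` cells (\<lambda>_. 0, n)) = p"
    using unit_cell_division(2)[where \<delta> = \<delta> and n = n and b = "\<lambda>i. l $ i", OF \<delta>0 n0]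
    by (metis card_image inj_on_subset subset_UNIV)
  then show ?thesis
    using unit_cell_division(1,3)[where \<delta> = \<delta> and n = n and b = "\<lambda>i. l $ i", OF \<delta>0 n0] unfolding box
    by (intro exI[of _ "?c ` cells (\<lambda>_. 0, n)"]) auto
qed

lemma division_replace:
  fixes P :: "(real^'n) set set"
  assumes P: "P division_of D" "\<forall>R\<in>P. interior R \<noteq> {}" and R: "R \<in> P"
    and S: "S division_of R" "\<forall>R\<in>S. interior R \<noteq> {}"
  shows "(P - {R}) \<union> S division_of D" and "card ((P - {R}) \<union> S) = card P - 1 + card S"
proof -
  have fin: "finite P" "finite S" using P S by auto
  have SR: "B \<subseteq> R" if "B \<in> S" for B using division_ofD(2)[OF S(1) that] .
  have dis: "interior B \<inter> interior B' = {}" if "B \<in> S" "B' \<in> P" "B' \<noteq> R" for B B'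
  proof -
    have "interior R \<inter> interior B' = {}" using division_ofD(5)[OF P(1) R that(2)] that by auto
    then show ?thesis using interior_mono[OF SR[OF that(1)]] by blast
  qed
  show "(P - {R}) \<union> S division_of D"
  proof (rule division_ofI)
    show "finite ((P - {R}) \<union> S)" using fin by simp
    show "B \<subseteq> D" if "B \<in> P - {R} \<union> S" for B
      using that SR division_ofD(2)[OF P(1)] R by blast
    show "B \<noteq> {}" if "B \<in> P - {R} \<union> S" for B
      using that division_ofD(3)[OF P(1)] division_ofD(3)[OF S(1)] by blast
    show "\<exists>a b. B = cbox a b" if "B \<in> P - {R} \<union> S" for B
      using that division_ofD(4)[OF P(1)] division_ofD(4)[OF S(1)] by blast
    show "interior B \<inter> interior B' = {}" if "B \<in> P - {R} \<union> S" "B' \<in> P - {R} \<union> S" "B \<noteq> B'" for B B'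
    proof (cases "B \<in> S"; cases "B' \<in> S")
      assume "B \<in> S" "B' \<in> S"
      then show ?thesis by (rule division_ofD(5)[OF S(1) _ _ that(3)])
    next
      assume "B \<in> S" "B' \<notin> S"
      then show ?thesis using dis[of B B'] that by blast
    next
      assume "B \<notin> S" "B' \<in> S"
      then show ?thesis using dis[of B' B] that by blast
    next
      assume "B \<notin> S" "B' \<notin> S"
      then show ?thesis using that by (intro division_ofD(5)[OF P(1) _ _ that(3)]) auto
    qed
    have "\<Union> S = R" "\<Union> P = D" using P(1) S(1) by auto
    then show "\<Union> (P - {R} \<union> S) = D" using R by blast
  qed
  have "(P - {R}) \<inter> S = {}"
  proof (rule ccontr)
    assume "\<not> ?thesis"
    then obtain B where "B \<in> P" "B \<noteq> R" "B \<in> S" by blast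
    then show False using dis[of B B] S(2) by auto
  qed
  then show "card ((P - {R}) \<union> S) = card P - 1 + card S"
    using fin R by (subst card_Un_disjoint) auto
qed

lemma diameter_cbox_le:
  fixes l u :: "real^'n" and h :: real
  assumes "\<And>i. u $ i - l $ i \<le> h" "\<And>i. l $ i \<le> u $ i"
  shows "diameter (cbox l u) \<le> CARD('n) * h"
proof -
  have "0 \<le> h" using assms[of undefined] by linarith
  moreover have "dist x y \<le> CARD('n) * h" if "x \<in> cbox l u" "y \<in> cbox l u" for x y
  proof -
    have "dist x y \<le> (\<Sum>i\<in>UNIV. \<bar>(x - y) $ i\<bar>)"
      unfolding dist_norm by (rule norm_le_l1_cart)
    also have "\<dots> \<le> (\<Sum>i\<in>(UNIV::'n set). h)"
    proof (rule sum_mono)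
      fix i
      show "\<bar>(x - y) $ i\<bar> \<le> h" using that assms(1)[of i] by (simp add: mem_box_cart abs_le_iff) (smt (verit))
    qed
    finally show ?thesis by simp
  qed
  ultimately show ?thesis by (intro diameter_le) (auto simp: dist_norm)
qed

lemma card_box_vertices_le:
  fixes l u :: "real^'n"
  assumes "\<And>i. l $ i < u $ i"
  shows "finite (box_vertices (cbox l u))" and "card (box_vertices (cbox l u)) \<le> 2 ^ CARD('n)"
proof -
  let ?v = "\<lambda>A. (\<chi> i. if i \<in> A then u $ i else l $ i) :: real^'n"
  have sub: "box_vertices (cbox l u) \<subseteq> ?v ` Pow UNIV"
  proof
    fix v assume "v \<in> box_vertices (cbox l u)"
    then have "v $ i = l $ i \<or> v $ i = u $ i" for i using box_vertices_cbox[OF assms] by auto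
    then have "v = ?v {i. v $ i = u $ i}" by (auto simp: vec_eq_iff)
    then show "v \<in> ?v ` Pow UNIV" by blast
  qed
  then show "finite (box_vertices (cbox l u))" by (rule finite_subset) simp
  have "card (box_vertices (cbox l u)) \<le> card (?v ` Pow UNIV)" by (rule card_mono[OF _ sub]) simp
  also have "\<dots> \<le> card (Pow (UNIV :: 'n set))" by (rule card_image_le) simp
  finally show "card (box_vertices (cbox l u)) \<le> 2 ^ CARD('n)" by (simp add: card_Pow)
qed

section \<open>Error estimates on a grid adapted to the function\<close>

text \<open>The block sizes are tied to the target error \<open>E\<close>: the assumption \<open>side\<close> makes each term in the error sums
  on a block at most \<open>E / \<kappa> i\<close> in the weighted sense, and \<open>fine\<close> makes the interpolation error
  on a single cell negligible.  All estimates refer to the values at the lower corner of the cube.\<close>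

locale grid_approximation = multilinear_approximation \<Omega> f a G + core_grid m w r
  for \<Omega> f :: "real^'n \<Rightarrow> real" and a G m w and r :: "('n \<Rightarrow> nat) \<Rightarrow> 'n \<Rightarrow> nat" +
  fixes \<theta> E :: real
  assumes \<theta>: "1 \<le> \<theta>" and E: "0 < E"
    and flat: "\<And>j. j \<in> cubes \<Longrightarrow> flat_on \<theta> (rbox (\<lambda>i. w * j i, \<lambda>i. w * Suc (j i)))"
    and side: "\<And>j i. j \<in> cubes \<Longrightarrow>
       \<theta>\<^sup>2 * \<kappa> i * \<Omega> (pt (\<lambda>i. w * j i)) * a i (pt (\<lambda>i. w * j i)) * (real (r j i) / M)\<^sup>2 \<le> 8 * E"
    and fine: "\<And>x. x \<in> unit_cube \<Longrightarrow> \<Omega> x * (\<Sum>i\<in>(UNIV::'n set). (SUP y\<in>unit_cube. a i y) * (1 / M)\<^sup>2 / 8) \<le> (\<theta> - 1) * E"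
begin

abbreviation cube_box :: "('n \<Rightarrow> nat) \<Rightarrow> (real^'n) set" where
  "cube_box j \<equiv> rbox (\<lambda>i. w * j i, \<lambda>i. w * Suc (j i))"

text \<open>With this value at the origin the weighted error there is exactly \<open>E\<close>.\<close>

abbreviation z :: real where "z \<equiv> f 0 - E / \<Omega> 0"

lemma cube_box_subset: "j \<in> cubes \<Longrightarrow> cube_box j \<subseteq> unit_cube"
proof -
  assume j: "j \<in> cubes"
  have "w * Suc (j i) \<le> M" for i
    using j unfolding M_def mult.commute[of m] by (intro mult_le_mono2) (auto simp: cubes_def Suc_le_eq)
  then show ?thesis unfolding rbox_K[symmetric] by (intro rbox_mono) auto
qed

text \<open>Each of the two error sums has as many terms as \<open>\<kappa> i\<close> for its directions, so after weighting it is at most \<open>E\<close>.  The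
  statement covers all boxes that are at most as large as a block, and thus also the single cells and the
  slabs cut from one of them.\<close>

lemma error_in_cube:
  assumes j: "j \<in> cubes" and lu: "\<And>i. l $ i < u $ i" and sub: "cbox l u \<subseteq> cube_box j"
    and h: "\<And>i. u $ i - l $ i \<le> real (r j i) / M" and x: "x \<in> cbox l u"
  shows "\<bar>f x - interp f (cbox l u) x\<bar> * \<Omega> x \<le> E"
proof -
  define y :: "real^'n" where "y = pt (\<lambda>i. w * j i)"
  have yj: "y \<in> cube_box j" unfolding y_def using M_pos by (auto simp: grid_box_def mem_box_cart divide_right_mono)
  note cs = cube_box_subset[OF j]
  have pos: "0 < \<Omega> y" "0 < a i y" for i using yj cs \<Omega>_pos a_pos by blast+
  have term_le: "\<theta> * a i y * (u $ i - l $ i)^2 / 8 \<le> E / (\<theta> * \<Omega> y) / \<kappa> i" for i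
  proof -
    have "(u $ i - l $ i)^2 \<le> (real (r j i) / M)^2"
      using h[of i] lu[of i] by (intro power_mono) auto
    then have "\<theta>\<^sup>2 * \<kappa> i * \<Omega> y * a i y * (u $ i - l $ i)^2 \<le> \<theta>\<^sup>2 * \<kappa> i * \<Omega> y * a i y * (real (r j i) / M)^2"
      using pos \<kappa>_ge_1[of i] by (intro mult_left_mono) (auto simp: less_imp_le)
    also have "\<dots> \<le> 8 * E" using side[OF j, of i] by (simp add: y_def)
    finally show ?thesis using pos \<kappa>_ge_1[of i] \<theta> by (simp add: field_simps power2_eq_square)
  qed
  have sums: "(\<Sum>i\<in>A. \<theta> * a i y * (u $ i - l $ i)^2 / 8) \<le> E / (\<theta> * \<Omega> y)" if A: "A = G \<or> A = - G" for A
  proof -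
    have "(\<Sum>i\<in>A. \<theta> * a i y * (u $ i - l $ i)^2 / 8) \<le> (\<Sum>i\<in>A. E / (\<theta> * \<Omega> y) / real (card A))"
    proof (rule sum_mono)
      fix i assume "i \<in> A"
      then have "\<kappa> i = real (card A)" using A by (auto simp: \<kappa>_def)
      then show "\<theta> * a i y * (u $ i - l $ i)^2 / 8 \<le> E / (\<theta> * \<Omega> y) / real (card A)"
        using term_le[of i] by simp
    qed
    also have "\<dots> \<le> E / (\<theta> * \<Omega> y)" using pos E \<theta> by (cases "card A = 0") auto
    finally show ?thesis .
  qed
  have "\<bar>f x - interp f (cbox l u) x\<bar> \<le> 0 + E / (\<theta> * \<Omega> y)"
  proof (rule error_upper[OF lu, where hi = "\<lambda>i. \<theta> * a i y"])
    show "cbox l u \<subseteq> unit_cube" using sub cs by blast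
    show "a i z \<le> \<theta> * a i y" if "z \<in> cbox l u" for i z
      using flat[OF j] that sub yj unfolding flat_on_def by blast
    show "interp f (cbox l u) \<in> P1" by (rule interp_exists[OF lu])
    show "\<bar>f v - interp f (cbox l u) v\<bar> \<le> 0" if "\<And>i. v $ i = l $ i \<or> v $ i = u $ i" for v
      using interp_exists(2)[OF lu that] by simp
  qed (use sums x in auto)
  moreover have "\<Omega> x \<le> \<theta> * \<Omega> y" using flat[OF j] x sub yj unfolding flat_on_def by blast
  moreover have "0 < \<Omega> x" using x sub cs \<Omega>_pos by blast
  ultimately have "\<bar>f x - interp f (cbox l u) x\<bar> * \<Omega> x \<le> E / (\<theta> * \<Omega> y) * (\<theta> * \<Omega> y)"
    by (intro mult_mono) auto
  also have "\<dots> = E" using pos \<theta> by simp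
  finally show ?thesis .
qed

lemma own_in_cube:
  assumes k: "k \<in> K"
  shows "\<exists>j\<in>cubes. rbox (own k) \<subseteq> cube_box j \<and> (\<forall>i. real (snd (own k) i - fst (own k) i) \<le> r j i)"
  and "fst (own k) i < snd (own k) i"
proof -
  show "fst (own k) i < snd (own k) i" for i
    using own_mem[of k] le_less_trans unfolding cells_def by blast
  show "\<exists>j\<in>cubes. rbox (own k) \<subseteq> cube_box j \<and> (\<forall>i. real (snd (own k) i - fst (own k) i) \<le> r j i)"
  proof (cases "core k")
    case True
    note t = core_block_index[OF True]
    have o: "own k = block (cube k) (block_index k)" using True by (simp add: own_def)
    have up: "corner (cube k) (succ (block_index k)) i \<le> w * Suc (cube k i)" for i
    proof -
      have "r (cube k) i * Suc (block_index k i) \<le> r (cube k) i * q (cube k) i"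
        using t[of i] by (intro mult_le_mono2) simp
      then show ?thesis using rq_less[of "cube k" i] by (simp add: corner_def)
    qed
    have "rbox (own k) \<subseteq> cube_box (cube k)"
      unfolding o by (intro rbox_mono) (use up in \<open>simp_all add: block_def\<close>, simp add: corner_def)
    moreover have "real (snd (own k) i - fst (own k) i) \<le> r (cube k) i" for i
      by (simp add: o block_def corner_def)
    ultimately show ?thesis using cube_in_cubes[OF k] by blast
  next
    case False
    then have o: "own k = (k, succ k)" by (simp add: own_def)
    define j where "j = (\<lambda>i. k i div w)"
    have jc: "j \<in> cubes"
      using k unfolding cubes_def j_def K_def cells_def M_def by (auto intro!: less_mult_imp_div_less)
    have "w * j i \<le> k i" "Suc (k i) \<le> w * Suc (j i)" for i
    proof -
      show "w * j i \<le> k i" by (simp add: j_def)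
      have "k i < w * Suc (j i)" using w by (simp add: j_def) (metis add.commute dividend_less_times_div)
      then show "Suc (k i) \<le> w * Suc (j i)" by simp
    qed
    then have "rbox (own k) \<subseteq> cube_box j" unfolding o by (intro rbox_mono) auto
    moreover have "real (snd (own k) i - fst (own k) i) \<le> r j i" for i
      using r[of j i] by (simp add: o)
    ultimately show ?thesis using jc by blast
  qed
qed

lemma own_error:
  assumes k: "k \<in> K" and lu: "\<And>i. l $ i < u $ i" and sub: "cbox l u \<subseteq> rbox (own k)"
  shows "x \<in> cbox l u \<Longrightarrow> \<bar>f x - interp f (cbox l u) x\<bar> * \<Omega> x \<le> E"
    and "\<exists>j\<in>cubes. \<forall>i. u $ i - l $ i \<le> real (r j i) / M"
proof -
  obtain j where j: "j \<in> cubes" "rbox (own k) \<subseteq> cube_box j" "\<And>i. real (snd (own k) i - fst (own k) i) \<le> r j i"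
    using own_in_cube(1)[OF k] by blast
  have h: "u $ i - l $ i \<le> real (r j i) / M" for i
  proof -
    have lt: "fst (own k) i \<le> snd (own k) i" using own_in_cube(2)[OF k, of i] by simp
    have "l \<in> rbox (own k)" "u \<in> rbox (own k)" using sub lu by (auto simp: subset_iff mem_box_cart less_imp_le)
    then have "real (fst (own k) i) / M \<le> l $ i" "u $ i \<le> real (snd (own k) i) / M"
      by (auto simp: grid_box_def mem_box_cart)
    then have "u $ i - l $ i \<le> (real (snd (own k) i) - real (fst (own k) i)) / M" by (simp add: diff_divide_distrib)
    also have "\<dots> \<le> real (r j i) / M" using j(3)[of i] lt by (intro divide_right_mono) (auto simp: of_nat_diff)
    finally show ?thesis .
  qed
  show "\<exists>j\<in>cubes. \<forall>i. u $ i - l $ i \<le> real (r j i) / M" using j(1) h by blast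
  assume "x \<in> cbox l u"
  then show "\<bar>f x - interp f (cbox l u) x\<bar> * \<Omega> x \<le> E"
    using error_in_cube[OF j(1) lu _ h] sub j(2) by blast
qed

lemma own_box:
  assumes k: "k \<in> K"
  shows "rbox (own k) = cbox (pt (fst (own k))) (pt (snd (own k)))"
    and "pt (fst (own k)) $ i < pt (snd (own k)) $ i"
  using own_in_cube(2)[OF k] pt_less by (auto simp only: grid_box_def)

lemma own_error_self:
  assumes k: "k \<in> K" and x: "x \<in> rbox (own k)"
  shows "\<bar>f x - interp f (rbox (own k)) x\<bar> * \<Omega> x \<le> E"
  using own_error(1)[OF k own_box(2)[OF k] eq_refl[OF own_box(1)[OF k, symmetric]]] x
  unfolding own_box(1)[OF k] by blast

lemma core_in_K:
  assumes "core k" "\<And>i. k i \<le> M"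
  shows "k \<in> K"
proof -
  \<comment> \<open>the last layer of cells of the cube leaves remainder \<open>w - 1\<close>, which no block reaches\<close>
  have "k i \<noteq> M" for i
  proof
    assume "k i = M"
    then have "(k i - 1) mod w = w - 1"
    proof -
      obtain m' where "m = Suc m'" using m by (cases m) auto
      then have "M = w * m' + w" unfolding M_def by simp
      then have "k i - 1 = w * m' + (w - 1)" using \<open>k i = M\<close> w by linarith
      then have "(k i - 1) mod w = (w - 1) mod w" by (simp only: mod_mult_self4)
      then show ?thesis using w by simp
    qed
    moreover have "(k i - 1) mod w < r (cube k) i * q (cube k) i" using assms(1) by (simp add: core_def)
    ultimately show False using rq_less[of "cube k" i] by simp
  qed
  then show ?thesis using assms(2) by (auto simp: K_def cells_def less_le)
qed

text \<open>A node of a block inherits the error of the interpolant on that block.\<close>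

lemma nodal_error:
  assumes u: "\<And>i. u i \<le> M"
  shows "\<bar>f (pt u) - nodal_value f z u\<bar> * \<Omega> (pt u) \<le> E"
proof -
  have "0 = pt (\<lambda>_. 0)" by (simp add: vec_eq_iff)
  then have pt0: "pt (\<lambda>_. 0) = 0" by simp
  have "0 < \<Omega> 0" using \<Omega>_pos[of 0] by (simp add: mem_box_cart)
  moreover have ?thesis if "u \<noteq> (\<lambda>_. 0)" "touches_core u"
    using that(2)
  proof (rule touches_core_cases)
    fix k assume k: "core k" "cube u = cube k" "\<And>i. k i \<le> u i \<and> u i \<le> Suc (k i)"
      "pt u \<in> rbox (block (cube k) (block_index k))"
    have kK: "k \<in> K" by (rule core_in_K[OF k(1)]) (use k(3) u order_trans in blast)
    have o: "own k = block (cube k) (block_index k)" using k by (simp add: own_def)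
    have "nodal_value f z u = interp f (rbox (own k)) (pt u)"
      using that k(2) coarse_spline_on_block[OF core_block_index[OF k(1)] k(4)] by (simp add: nodal_value_def o)
    then show ?thesis using own_error_self[OF kK, of "pt u"] k(4) by (simp add: o)
  qed
  ultimately show ?thesis using E by (auto simp: nodal_value_def pt0)
qed

lemma cell_containing:
  assumes "x \<in> unit_cube"
  obtains k where "k \<in> K" "x \<in> rbox (k, succ k)" "rbox (k, succ k) \<subseteq> rbox (own k)"
proof -
  have "x \<in> grid_box (\<lambda>_. 0) (\<lambda>_. 1 / real M) (\<lambda>_. 0) (\<lambda>_. M)" using assms rbox_K by simp
  from cell_containing_point[OF _ _ this] obtain k where k: "k \<in> K" "x \<in> rbox (k, succ k)"
    using M_pos by (auto simp: K_def)
  moreover have "rbox (k, succ k) \<subseteq> rbox (own k)"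
    using own_mem[of k] by (intro rbox_mono) (auto simp: cells_def Suc_le_eq)
  ultimately show thesis using that by blast
qed

text \<open>On a single cell the error is that of interpolation, which is small by \<open>fine\<close>, plus the deviation of the
  nodal values, whose weights differ from the weight at \<open>x\<close> by a factor \<open>\<theta>\<close> only.\<close>

lemma quasi_spline_error:
  assumes x: "x \<in> unit_cube"
  shows "\<bar>f x - quasi_spline f z x\<bar> * \<Omega> x \<le> (2 * \<theta> - 1) * E"
proof -
  obtain k where k: "k \<in> K" "x \<in> rbox (k, succ k)" "rbox (k, succ k) \<subseteq> rbox (own k)"
    using cell_containing[OF x] .
  show ?thesis
  proof (cases "core k")
    case True
    have "quasi_spline f z x = interp f (rbox (own k)) x"
      using quasi_spline_on_block[OF k(1) True] k by blast
    then have "\<bar>f x - quasi_spline f z x\<bar> * \<Omega> x \<le> E"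
      using own_error_self[OF k(1), of x] k by auto
    also have "E \<le> (2 * \<theta> - 1) * E" using E \<theta> by simp
    finally show ?thesis .
  next
    case False
    then have o: "own k = (k, succ k)" by (simp add: own_def)
    obtain j where j: "j \<in> cubes" "rbox (own k) \<subseteq> cube_box j" using own_in_cube(1)[OF k(1)] by blast
    have sub: "rbox (k, succ k) \<subseteq> unit_cube" using j cube_box_subset o by auto
    obtain p where p: "p \<in> P1" "\<forall>x\<in>rbox (k, succ k). quasi_spline f z x = p x"
      "\<And>u. (\<forall>i. u i = k i \<or> u i = Suc (k i)) \<Longrightarrow> p (pt u) = nodal_value f z u"
      using quasi_spline_cell[OF k(1)] by metis
    have \<Omega>x: "0 < \<Omega> x" using \<Omega>_pos x by simp
    define S where "S = (\<Sum>i\<in>(UNIV::'n set). (SUP y\<in>unit_cube. a i y) * (1 / M)\<^sup>2 / 8)"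
    have hi: "a i y \<le> (SUP y\<in>unit_cube. a i y)" if "y \<in> unit_cube" for i y
    proof -
      obtain A where "\<forall>i. \<forall>x\<in>unit_cube. a i x \<le> A" using bounded_a by blast
      then show ?thesis using that by (intro cSUP_upper bdd_aboveI2[of _ _ A]) auto
    qed
    have hi0: "0 \<le> (SUP y\<in>unit_cube. a i y)" for i
      using hi[OF x, of i] a_pos[OF x, of i] by simp
    have "\<bar>f x - p x\<bar> \<le> \<theta> * E / \<Omega> x + S"
    proof (rule error_upper[of "pt k" "pt (succ k)" "\<lambda>i. SUP y\<in>unit_cube. a i y"])
      show "pt k $ i < pt (succ k) $ i" for i by (rule pt_succ_less)
      show "cbox (pt k) (pt (succ k)) \<subseteq> unit_cube" using sub by (simp add: grid_box_def)
      show "a i y \<le> (SUP y\<in>unit_cube. a i y)" if "y \<in> cbox (pt k) (pt (succ k))" for i y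
        using that sub by (intro hi) (auto simp: grid_box_def)
      show "p \<in> P1" by fact
      show "x \<in> cbox (pt k) (pt (succ k))" using k(2) by (simp add: grid_box_def)
      have Sle: "(\<Sum>i\<in>A. (SUP y\<in>unit_cube. a i y) * (pt (succ k) $ i - pt k $ i)\<^sup>2 / 8) \<le> S" for A
      proof -
        have "(\<Sum>i\<in>A. (SUP y\<in>unit_cube. a i y) * (pt (succ k) $ i - pt k $ i)\<^sup>2 / 8)
          = (\<Sum>i\<in>A. (SUP y\<in>unit_cube. a i y) * (1 / M)\<^sup>2 / 8)"
          by (simp add: add_divide_distrib)
        also have "\<dots> \<le> S" unfolding S_def using hi0 by (intro sum_mono2) auto
        finally show ?thesis .
      qed
      show "(\<Sum>i\<in>G. (SUP y\<in>unit_cube. a i y) * (pt (succ k) $ i - pt k $ i)\<^sup>2 / 8) \<le> S"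
        "(\<Sum>i\<in>-G. (SUP y\<in>unit_cube. a i y) * (pt (succ k) $ i - pt k $ i)\<^sup>2 / 8) \<le> S" by (rule Sle)+
      fix v assume v: "\<And>i. v $ i = pt k $ i \<or> v $ i = pt (succ k) $ i"
      from vertex_is_node[OF this] obtain u where u: "v = pt u" "\<And>i. u i = k i \<or> u i = Suc (k i)" by auto
      have kM: "k i < M" for i using k(1) by (simp add: K_def cells_def)
      have uM: "u i \<le> M" for i using u(2)[of i] kM[of i] by linarith
      have "v \<in> rbox (k, succ k)"
        unfolding grid_box_def fst_conv snd_conv mem_box_cart
        using v pt_succ_less[of k] by (metis less_imp_le order_refl)
      then have vj: "v \<in> cube_box j" "x \<in> cube_box j" using j k(2) o by auto
      then have "\<Omega> x \<le> \<theta> * \<Omega> v" using flat[OF j(1)] unfolding flat_on_def by blast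
      then have "\<bar>f v - p v\<bar> * \<Omega> x \<le> \<bar>f v - p v\<bar> * (\<theta> * \<Omega> v)" by (intro mult_left_mono) auto
      also have "\<dots> = \<theta> * (\<bar>f v - p v\<bar> * \<Omega> v)" by simp
      also have "\<dots> \<le> \<theta> * E"
        using nodal_error[OF uM] p(3)[of u] u \<theta> by (intro mult_left_mono) auto
      finally show "\<bar>f v - p v\<bar> \<le> \<theta> * E / \<Omega> x" using \<Omega>x by (simp add: field_simps)
    qed
    then have "\<bar>f x - p x\<bar> * \<Omega> x \<le> (\<theta> * E / \<Omega> x + S) * \<Omega> x" using \<Omega>x by (intro mult_right_mono) auto
    also have "\<dots> = \<theta> * E + \<Omega> x * S" using \<Omega>x by (simp add: field_simps)
    also have "\<dots> \<le> \<theta> * E + (\<theta> - 1) * E" using fine[OF x] by (simp add: S_def)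
    also have "\<dots> = (2 * \<theta> - 1) * E" by (simp add: algebra_simps)
    finally show ?thesis using p(2) k(2) by simp
  qed
qed

lemma quasi_spline_error_origin: "\<bar>f 0 - quasi_spline f z 0\<bar> * \<Omega> 0 = E"
proof -
  have pt0: "pt (\<lambda>_. 0) = 0" by (simp add: vec_eq_iff)
  have "0 < \<Omega> 0" using \<Omega>_pos[of 0] by (simp add: mem_box_cart)
  moreover have "quasi_spline f z (pt (\<lambda>_. 0)) = z" by (subst quasi_spline_node) (auto simp: nodal_value_def)
  ultimately show ?thesis using E by (simp add: pt0)
qed

definition base :: "(real^'n) set set" where "base = rbox ` own ` K"

lemma base_interior: "R \<in> base \<Longrightarrow> interior R \<noteq> {}"
proof -
  assume "R \<in> base"
  then obtain k where k: "k \<in> K" "R = rbox (own k)" by (auto simp: base_def)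
  show ?thesis unfolding k(2) own_box(1)[OF k(1)] using own_box(2)[OF k(1)]
    by (simp add: interval_ne_empty_cart del: node_nth)
qed

lemma card_base_le:
  "card base \<le> (\<Sum>j\<in>cubes. \<Prod>i\<in>UNIV. q j i) + (\<Sum>j\<in>cubes. \<Sum>i\<in>UNIV. r j i * w ^ (CARD('n) - 1))"
proof -
  have "base = rbox ` own ` {k \<in> K. core k} \<union> rbox ` own ` {k \<in> K. \<not> core k}"
    unfolding base_def image_Un[symmetric] by (intro arg_cong[of _ _ "\<lambda>A. rbox ` own ` A"]) auto
  then have "card base \<le> card (rbox ` own ` {k \<in> K. core k}) + card (rbox ` own ` {k \<in> K. \<not> core k})"
    by (simp add: card_Un_le)
  also have "card (rbox ` own ` {k \<in> K. core k}) \<le> card (own ` {k \<in> K. core k})"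
    using finite_K by (intro card_image_le) simp
  also have "card (rbox ` own ` {k \<in> K. \<not> core k}) \<le> card {k \<in> K. \<not> core k}"
    unfolding image_image using finite_K by (intro card_image_le) simp
  finally show ?thesis using card_blocks_le card_noncore_le by linarith
qed

lemma base_division: "base division_of unit_cube"
  unfolding base_def by (rule own_division)

lemma base_error:
  "R \<in> base \<Longrightarrow> x \<in> R \<Longrightarrow> \<bar>f x - interp f R x\<bar> * \<Omega> x \<le> E"
  unfolding base_def using own_error_self by auto

text \<open>The slabs that adjust the number of boxes are cut from the cell at the origin.  Wrong values occur only at
  vertices of single cells and of slabs, because on the blocks the spline is the interpolant; there are
  \<open>2\<^sup>d\<close> vertices per box.\<close>

lemma refined_partition:
  assumes N: "card base \<le> N"
  shows "\<exists>P. box_partition unit_cube N P \<and>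
    (\<forall>R\<in>P. \<forall>x\<in>R. \<bar>f x - interp f R x\<bar> * \<Omega> x \<le> E) \<and>
    (\<forall>R\<in>P. \<exists>l u. R = cbox l u \<and> (\<forall>i. l $ i < u $ i) \<and> (\<exists>j\<in>cubes. \<forall>i. u $ i - l $ i \<le> real (r j i) / M)) \<and>
    (\<forall>R\<in>P. \<exists>p\<in>P1. \<forall>x\<in>R. quasi_spline f z x = p x) \<and>
    card {v \<in> partition_vertices P. quasi_spline f z v \<noteq> f v}
      \<le> 2 ^ CARD('n) * ((\<Sum>j\<in>cubes. \<Sum>i\<in>UNIV. r j i * w ^ (CARD('n) - 1)) + (N - card base + 1))"
proof -
  define o0 :: "'n \<Rightarrow> nat" where "o0 = (\<lambda>_. 0)"
  have o0K: "o0 \<in> K" using M_pos by (simp add: o0_def K_def cells_def)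
  have o0c: "\<not> core o0" by (simp add: core_def o0_def)
  have own0: "own o0 = (o0, succ o0)" using o0c by (simp add: own_def)
  define R0 where "R0 = rbox (own o0)"
  have R0: "R0 \<in> base" using o0K by (auto simp: R0_def base_def)
  obtain S where S: "S division_of R0" "\<forall>R\<in>S. interior R \<noteq> {}" "card S = N - card base + 1"
    using box_slices[OF own_box(2)[OF o0K], of "N - card base + 1"] unfolding R0_def own_box(1)[OF o0K] by auto
  define P where "P = (base - {R0}) \<union> S"
  have base1: "0 < card base" using R0 base_division by (auto simp: card_gt_0_iff)
  have P: "P division_of unit_cube" "card P = N"
    using division_replace[OF base_division _ R0 S(1,2)] base_interior S(3) N base1 by (auto simp: P_def)
  have own: "\<exists>k\<in>K. R \<subseteq> rbox (own k) \<and> (R = rbox (own k) \<or> \<not> core k)" if "R \<in> P" for R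
  proof (cases "R \<in> S")
    case True
    then have "R \<subseteq> R0" using division_ofD(2)[OF S(1)] by blast
    then show ?thesis using o0K o0c unfolding R0_def by blast
  next
    case False
    then have "R \<in> base" using that by (auto simp: P_def)
    then show ?thesis by (auto simp: base_def)
  qed
  have int: "\<forall>R\<in>P. interior R \<noteq> {}" using S(2) base_interior by (auto simp: P_def)
  have box: "\<exists>l u k. R = cbox l u \<and> (\<forall>i. l $ i < u $ i) \<and> k \<in> K \<and> cbox l u \<subseteq> rbox (own k)" if "R \<in> P" for R
    using division_box_cases[OF P(1) that] int own[OF that] that by metis
  have err: "\<bar>f x - interp f R x\<bar> * \<Omega> x \<le> E" if "R \<in> P" "x \<in> R" for R x
    using box[OF that(1)] own_error(1) that(2) by blast
  have sides: "\<exists>l u. R = cbox l u \<and> (\<forall>i. l $ i < u $ i) \<and> (\<exists>j\<in>cubes. \<forall>i. u $ i - l $ i \<le> real (r j i) / M)"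
    if "R \<in> P" for R
    using box[OF that] own_error(2) by metis
  have pieces: "\<exists>p\<in>P1. \<forall>x\<in>R. quasi_spline f z x = p x" if R: "R \<in> P" for R
  proof -
    obtain k where k: "k \<in> K" "R \<subseteq> rbox (own k)" using own[OF R] by blast
    show ?thesis
    proof (cases "core k")
      case True
      then show ?thesis using quasi_spline_on_block[OF k(1) True] k interp_exists(1)[OF own_box(2)[OF k(1)]]
        unfolding own_box(1)[OF k(1), symmetric] by blast
    next
      case False
      then have "own k = (k, succ k)" by (simp add: own_def)
      then show ?thesis using quasi_spline_cell[OF k(1), of f z] k(2) by (metis subsetD)
    qed
  qed
  \<comment> \<open>the boxes that are not blocks; only these can have a vertex at which the spline differs from \<open>f\<close>\<close>
  define F where "F = rbox ` own ` {k \<in> K. \<not> core k} \<union> S"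
  have finF: "finite F" using finite_K S(1) by (auto simp: F_def)
  have "{v \<in> partition_vertices P. quasi_spline f z v \<noteq> f v} \<subseteq> (\<Union>R\<in>F \<inter> P. box_vertices R)"
  proof
    fix v assume v: "v \<in> {v \<in> partition_vertices P. quasi_spline f z v \<noteq> f v}"
    then obtain R where R: "R \<in> P" "v \<in> box_vertices R" by (auto simp: partition_vertices_def)
    have "R \<in> F"
    proof (rule ccontr)
      assume nF: "R \<notin> F"
      then have "R \<in> base" using R by (auto simp: P_def F_def)
      then obtain k where k: "k \<in> K" "R = rbox (own k)" unfolding base_def by blast
      moreover have "core k" using nF k unfolding F_def by blast
      ultimately have k: "k \<in> K" "core k" "R = rbox (own k)" by auto
      have vv: "v $ i = pt (fst (own k)) $ i \<or> v $ i = pt (snd (own k)) $ i" for i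
        using R(2) unfolding k(3) own_box(1)[OF k(1)] box_vertices_cbox[OF own_box(2)[OF k(1)]] by blast
      have "v \<in> rbox (own k)"
        unfolding own_box(1)[OF k(1)] mem_box_cart using vv own_box(2)[OF k(1)] by (metis less_imp_le order_refl)
      then have "quasi_spline f z v = interp f (rbox (own k)) v"
        using quasi_spline_on_block[OF k(1,2)] by blast
      also have "\<dots> = f v" unfolding own_box(1)[OF k(1)] by (rule interp_exists(2)[OF own_box(2)[OF k(1)] vv])
      finally show False using v by simp
    qed
    then show "v \<in> (\<Union>R\<in>F \<inter> P. box_vertices R)" using R by blast
  qed
  moreover have bv: "finite (box_vertices R)" "card (box_vertices R) \<le> 2 ^ CARD('n)" if "R \<in> F \<inter> P" for R
    using sides[of R] that card_box_vertices_le by auto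
  ultimately have "card {v \<in> partition_vertices P. quasi_spline f z v \<noteq> f v} \<le> card (\<Union>R\<in>F \<inter> P. box_vertices R)"
    using finF by (intro card_mono) auto
  also have "\<dots> \<le> (\<Sum>R\<in>F \<inter> P. card (box_vertices R))" using finF by (intro card_UN_le) simp
  also have "\<dots> \<le> (\<Sum>R\<in>F \<inter> P. 2 ^ CARD('n))" by (intro sum_mono bv)
  also have "\<dots> = 2 ^ CARD('n) * card (F \<inter> P)" by simp
  also have "card (F \<inter> P) \<le> card F" using finF by (intro card_mono) auto
  also have "card F \<le> card (rbox ` own ` {k \<in> K. \<not> core k}) + card S"
    unfolding F_def by (rule card_Un_le)
  also have "card (rbox ` own ` {k \<in> K. \<not> core k}) \<le> card {k \<in> K. \<not> core k}"
    unfolding image_image using finite_K by (intro card_image_le) simp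
  also have "\<dots> \<le> (\<Sum>j\<in>cubes. \<Sum>i\<in>UNIV. r j i * w ^ (CARD('n) - 1))" by (rule card_noncore_le)
  finally have "card {v \<in> partition_vertices P. quasi_spline f z v \<noteq> f v}
      \<le> 2 ^ CARD('n) * ((\<Sum>j\<in>cubes. \<Sum>i\<in>UNIV. r j i * w ^ (CARD('n) - 1)) + (N - card base + 1))"
    by (simp add: S(3))
  then show ?thesis using P int err sides pieces
    by (intro exI[of _ P]) (simp add: box_partition_def)
qed

end

section \<open>Choice of the grid\<close>

context multilinear_approximation
begin

definition mesh_cubes :: "nat \<Rightarrow> ('n \<Rightarrow> nat) set" where
  "mesh_cubes m = PiE UNIV (\<lambda>_. {..<m})"

definition mesh_box :: "nat \<Rightarrow> ('n \<Rightarrow> nat) \<Rightarrow> (real^'n) set" where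
  "mesh_box m j = grid_box (\<lambda>_. 0) (\<lambda>_. 1 / real m) j (succ j)"

definition mesh_corner :: "nat \<Rightarrow> ('n \<Rightarrow> nat) \<Rightarrow> real^'n" where
  "mesh_corner m j = node (\<lambda>_. 0) (\<lambda>_. 1 / real m) j"

text \<open>The ideal side lengths of the boxes near \<open>mesh_corner m j\<close>, multiplied by \<open>N\<^bsup>1/d\<^esup>\<close>, for the target error
  \<open>E = \<theta>\<^sup>8 L / N\<^bsup>2/d\<^esup>\<close>.  The exponent 8 pays for all losses of the construction: for the boxes counted by
  \<open>block_count_le\<close> it contributes \<open>\<theta>\<^bsup>-4d\<^esup>\<close>, of which \<open>\<theta>\<^sup>d\<close> is lost by the factor \<open>\<theta>\<^sup>2\<close> in this definition,
  \<open>\<theta>\<^sup>d\<close> by the variation of the density, and \<open>\<theta>\<^sup>d\<close> by rounding the sides; a factor \<open>\<theta>\<^bsup>-d\<^esup>\<close> remains as room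
  for the single cells.\<close>

definition width :: "real \<Rightarrow> nat \<Rightarrow> ('n \<Rightarrow> nat) \<Rightarrow> 'n \<Rightarrow> real" where
  "width \<theta> m j i = sqrt (8 * (\<theta> ^ 8 * L) / (\<theta>\<^sup>2 * \<kappa> i * \<Omega> (mesh_corner m j) * a i (mesh_corner m j)))"

lemma finite_mesh_cubes: "finite (mesh_cubes m)"
  by (simp add: mesh_cubes_def finite_PiE)

lemma mesh_division:
  assumes "0 < m"
  shows "mesh_box m ` mesh_cubes m division_of unit_cube" and "inj (mesh_box m)"
proof -
  have b: "grid_box (\<lambda>_. 0) (\<lambda>_. 1 / real m) (\<lambda>_. 0) (\<lambda>_. m) = (unit_cube :: (real^'n) set)"
  proof -
    have "node (\<lambda>_. 0) (\<lambda>_. 1 / real m) (\<lambda>_. 0) = (0 :: real^'n)" "node (\<lambda>_. 0) (\<lambda>_. 1 / real m) (\<lambda>_. m) = (1 :: real^'n)"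
      using assms by (auto simp: vec_eq_iff)
    then show ?thesis by (simp add: grid_box_def)
  qed
  have c: "cells (\<lambda>_. 0, \<lambda>_. m) = mesh_cubes m" by (auto simp: cells_def mesh_cubes_def)
  show "mesh_box m ` mesh_cubes m division_of unit_cube"
    using unit_cell_division(1)[where \<delta> = "\<lambda>_. 1 / real m" and n = "\<lambda>_. m" and b = "\<lambda>_::'n. 0"] assms
    unfolding b c mesh_box_def by simp
  show "inj (mesh_box m)"
    using unit_cell_division(2)[where \<delta> = "\<lambda>_. 1 / real m" and n = "\<lambda>_. m" and b = "\<lambda>_::'n. 0"] assms
    unfolding mesh_box_def by simp
qed

lemma mesh_box_facts:
  assumes m: "0 < m" and j: "j \<in> mesh_cubes m"
  shows "mesh_corner m j \<in> mesh_box m j" "mesh_box m j \<subseteq> unit_cube" "measure lborel (mesh_box m j) = 1 / real m ^ CARD('n)"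
    "\<And>y z i. y \<in> mesh_box m j \<Longrightarrow> z \<in> mesh_box m j \<Longrightarrow> \<bar>y $ i - z $ i\<bar> \<le> 1 / real m"
proof -
  show "mesh_corner m j \<in> mesh_box m j"
    using m by (auto simp: mesh_corner_def mesh_box_def grid_box_def mem_box_cart divide_right_mono)
  show "mesh_box m j \<subseteq> unit_cube" using division_ofD(2)[OF mesh_division(1)[OF m]] j by blast
  show "measure lborel (mesh_box m j) = 1 / real m ^ CARD('n)"
    unfolding mesh_box_def grid_box_def
    by (subst content_cbox_cart) (use m in \<open>auto simp: interval_ne_empty_cart divide_right_mono add_divide_distrib power_one_over\<close>)
  fix y z i assume "y \<in> mesh_box m j" "z \<in> mesh_box m j"
  then have "real (j i) / m \<le> y $ i" "y $ i \<le> real (j i) / m + 1 / m" "real (j i) / m \<le> z $ i" "z $ i \<le> real (j i) / m + 1 / m"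
    by (auto simp: mesh_box_def grid_box_def mem_box_cart add_divide_distrib add.commute)
  then show "\<bar>y $ i - z $ i\<bar> \<le> 1 / real m" by (simp add: abs_le_iff)
qed

lemma width_pos:
  assumes "0 < m" "j \<in> mesh_cubes m" "1 \<le> \<theta>"
  shows "0 < width \<theta> m j i"
proof -
  have "mesh_corner m j \<in> unit_cube" using mesh_box_facts[OF assms(1,2)] by blast
  then show ?thesis using \<Omega>_pos a_pos \<kappa>_ge_1[of i] L_pos assms(3)
    unfolding width_def by (auto intro!: divide_pos_pos mult_pos_pos simp: order.strict_trans2[OF zero_less_one])
qed

text \<open>The volume of the ideal box is inversely proportional to the density.\<close>

lemma prod_width:
  assumes m: "0 < m" and j: "j \<in> mesh_cubes m" and \<theta>: "1 \<le> \<theta>"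
  shows "1 / (\<Prod>i\<in>UNIV. width \<theta> m j i) = \<Gamma> * density (mesh_corner m j) / (\<theta> ^ (3 * CARD('n)) * J)"
proof -
  define y where "y = mesh_corner m j"
  have yc: "y \<in> unit_cube" using mesh_box_facts[OF m j] by (auto simp: y_def)
  have \<Omega>y: "0 < \<Omega> y" and ay: "0 < a i y" for i using \<Omega>_pos a_pos yc by auto
  have p: "0 < (\<Prod>i\<in>UNIV. width \<theta> m j i)" using width_pos[OF m j \<theta>] by (simp add: prod_pos)
  have "((1 / (\<Prod>i\<in>UNIV. width \<theta> m j i)))\<^sup>2 = (\<Prod>i\<in>UNIV. 1 / (width \<theta> m j i)\<^sup>2)"
    by (simp add: prod_dividef prod_power_distrib power_divide)
  also have "\<dots> = (\<Prod>i\<in>UNIV. (\<kappa> i / 8) * a i y * (\<Omega> y / (\<theta> ^ 6 * L)))"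
  proof (rule prod.cong[OF refl])
    fix i
    have "(width \<theta> m j i)\<^sup>2 = 8 * (\<theta> ^ 8 * L) / (\<theta>\<^sup>2 * \<kappa> i * \<Omega> y * a i y)"
      unfolding width_def y_def[symmetric]
      using \<Omega>y ay[of i] \<kappa>_ge_1[of i] L_pos \<theta> by (intro real_sqrt_pow2) (auto intro!: divide_nonneg_nonneg mult_nonneg_nonneg simp: less_imp_le)
    also have "\<theta> ^ 8 = \<theta>\<^sup>2 * \<theta> ^ 6" by (simp flip: power_add)
    also have "8 * (\<theta>\<^sup>2 * \<theta> ^ 6 * L) / (\<theta>\<^sup>2 * \<kappa> i * \<Omega> y * a i y) = 8 * (\<theta> ^ 6 * L) / (\<kappa> i * \<Omega> y * a i y)"
      using \<theta> mult_divide_mult_cancel_left[of "\<theta>\<^sup>2" "8 * (\<theta> ^ 6 * L)" "\<kappa> i * \<Omega> y * a i y"]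
      by (simp only: mult_ac) simp
    finally show "1 / (width \<theta> m j i)\<^sup>2 = \<kappa> i / 8 * a i y * (\<Omega> y / (\<theta> ^ 6 * L))"
      by (simp add: mult_ac)
  qed
  also have "\<dots> = (\<Prod>i\<in>UNIV. \<kappa> i / 8) * (\<Prod>i\<in>UNIV. a i y) * (\<Omega> y / (\<theta> ^ 6 * L)) ^ CARD('n)"
    by (simp only: prod.distrib prod_constant)
  also have "\<dots> = (\<Prod>i\<in>UNIV. \<kappa> i / 8) * ((\<Prod>i\<in>UNIV. a i y) * \<Omega> y ^ CARD('n)) / ((\<theta> ^ 6) ^ CARD('n) * L ^ CARD('n))"
    by (simp add: power_divide power_mult_distrib)
  also have "(\<theta> ^ 6) ^ CARD('n) = (\<theta> ^ (3 * CARD('n)))\<^sup>2" by (simp flip: power_mult add: mult.commute)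
  also have "(\<Prod>i\<in>UNIV. \<kappa> i / 8) * ((\<Prod>i\<in>UNIV. a i y) * \<Omega> y ^ CARD('n)) = (\<Gamma> * density y)\<^sup>2"
    by (rule \<Gamma>_density_square[OF yc, symmetric])
  also have "(\<Gamma> * density y)\<^sup>2 / ((\<theta> ^ (3 * CARD('n)))\<^sup>2 * L ^ CARD('n)) = (\<Gamma> * density y / (\<theta> ^ (3 * CARD('n)) * J))\<^sup>2"
    by (simp add: L_power power_divide power_mult_distrib)
  finally show ?thesis
    unfolding y_def[symmetric]
    by (rule power2_eq_imp_eq) (use p \<Gamma>_pos J_pos density_pos[OF yc] \<theta> in \<open>auto intro!: divide_nonneg_nonneg mult_nonneg_nonneg simp: less_imp_le\<close>)
qed

text \<open>The density at the corner of a cube is at most \<open>\<theta>\<^sup>d\<close> times the density elsewhere in it, so the sum over the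
  cubes is dominated by the integral.\<close>

lemma widths_sum:
  assumes m: "0 < m" and \<theta>: "1 \<le> \<theta>" and flat: "\<And>j. j \<in> mesh_cubes m \<Longrightarrow> flat_on \<theta> (mesh_box m j)"
  shows "(\<Sum>j\<in>mesh_cubes m. 1 / (real m ^ CARD('n) * (\<Prod>i\<in>UNIV. width \<theta> m j i))) \<le> 1 / \<theta> ^ (2 * CARD('n))"
proof -
  have "1 / (real m ^ CARD('n) * (\<Prod>i\<in>UNIV. width \<theta> m j i))
     \<le> \<Gamma> / (\<theta> ^ (2 * CARD('n)) * J) * integral (mesh_box m j) density" if j: "j \<in> mesh_cubes m" for j
  proof -
    note mf = mesh_box_facts[OF m j]
    have le: "density (mesh_corner m j) / \<theta> ^ CARD('n) \<le> density x" if x: "x \<in> mesh_box m j" for x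
    proof -
      let ?y = "mesh_corner m j"
      have f: "a i ?y \<le> \<theta> * a i x" "\<Omega> ?y \<le> \<theta> * \<Omega> x" for i using flat[OF j] x mf(1) unfolding flat_on_def by blast+
      have pos: "0 < a i ?y" "0 < \<Omega> ?y" "0 < a i x" "0 < \<Omega> x" for i using mf x a_pos \<Omega>_pos by blast+
      have "(\<Prod>i\<in>UNIV. a i ?y) * \<Omega> ?y ^ CARD('n) \<le> (\<Prod>i\<in>UNIV. \<theta> * a i x) * (\<theta> * \<Omega> x) ^ CARD('n)"
        using f pos \<theta> by (intro mult_mono prod_mono power_mono) (auto simp: less_imp_le prod_nonneg)
      also have "\<dots> = (\<theta> ^ CARD('n))\<^sup>2 * ((\<Prod>i\<in>UNIV. a i x) * \<Omega> x ^ CARD('n))"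
        by (simp add: prod.distrib power_mult_distrib power2_eq_square)
      finally have "density ?y \<le> sqrt ((\<theta> ^ CARD('n))\<^sup>2 * ((\<Prod>i\<in>UNIV. a i x) * \<Omega> x ^ CARD('n)))"
        unfolding density_def by (rule real_sqrt_le_mono)
      also have "\<dots> = \<theta> ^ CARD('n) * density x" using \<theta> by (simp add: density_def real_sqrt_mult)
      finally show ?thesis using \<theta> by (simp add: divide_le_eq mult.commute)
    qed
    have mb: "\<exists>l u. mesh_box m j = cbox l u" by (auto simp: mesh_box_def grid_box_def)
    then have "integral (mesh_box m j) (\<lambda>_. density (mesh_corner m j) / \<theta> ^ CARD('n)) \<le> integral (mesh_box m j) density"
      using le density_integrable mf(2) by (intro integral_le) (auto intro!: integrable_const)
    moreover have "integral (mesh_box m j) (\<lambda>_. density (mesh_corner m j) / \<theta> ^ CARD('n))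
       = 1 / real m ^ CARD('n) * (density (mesh_corner m j) / \<theta> ^ CARD('n))"
      using mb mf(3) by auto
    ultimately have "1 / real m ^ CARD('n) * (density (mesh_corner m j) / \<theta> ^ CARD('n)) \<le> integral (mesh_box m j) density"
      by simp
    then have "\<Gamma> / (\<theta> ^ (2 * CARD('n)) * J) * (1 / real m ^ CARD('n) * (density (mesh_corner m j) / \<theta> ^ CARD('n)))
      \<le> \<Gamma> / (\<theta> ^ (2 * CARD('n)) * J) * integral (mesh_box m j) density"
      using \<Gamma>_pos J_pos \<theta> by (intro mult_left_mono) auto
    moreover have "\<Gamma> / (\<theta> ^ (2 * CARD('n)) * J) * (1 / real m ^ CARD('n) * (density (mesh_corner m j) / \<theta> ^ CARD('n)))
      = 1 / real m ^ CARD('n) * (1 / (\<Prod>i\<in>UNIV. width \<theta> m j i))"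
    proof -
      have "\<theta> ^ (3 * CARD('n)) = \<theta> ^ (2 * CARD('n)) * \<theta> ^ CARD('n)" by (simp flip: power_add)
      then show ?thesis unfolding prod_width[OF m j \<theta>] by simp
    qed
    ultimately show ?thesis by simp
  qed
  then have "(\<Sum>j\<in>mesh_cubes m. 1 / (real m ^ CARD('n) * (\<Prod>i\<in>UNIV. width \<theta> m j i)))
     \<le> (\<Sum>j\<in>mesh_cubes m. \<Gamma> / (\<theta> ^ (2 * CARD('n)) * J) * integral (mesh_box m j) density)"
    by (rule sum_mono)
  also have "\<dots> = \<Gamma> / (\<theta> ^ (2 * CARD('n)) * J) * (\<Sum>j\<in>mesh_cubes m. integral (mesh_box m j) density)"
    by (simp add: sum_distrib_left)
  also have "(\<Sum>j\<in>mesh_cubes m. integral (mesh_box m j) density) = (\<Sum>R\<in>mesh_box m ` mesh_cubes m. integral R density)"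
    by (subst sum.reindex) (auto intro: inj_on_subset[OF mesh_division(2)[OF m]])
  also have "\<dots> = integral unit_cube density"
    using density_integrable by (intro integral_combine_division_topdown[OF _ mesh_division(1)[OF m], symmetric]) auto
  also have "\<Gamma> / (\<theta> ^ (2 * CARD('n)) * J) * integral unit_cube density = 1 / \<theta> ^ (2 * CARD('n))"
  proof -
    have "integral unit_cube density = J / \<Gamma>" using \<Gamma>_pos by (simp add: J_def)
    then show ?thesis using J_pos \<Gamma>_pos by simp
  qed
  finally show ?thesis .
qed

text \<open>The interpolation error on a cube with sides \<open>h\<close> is at most \<open>fine_error * h\<^sup>2\<close>.\<close>

definition fine_error :: real where
  "fine_error = (\<Sum>i\<in>(UNIV::'n set). (SUP y\<in>unit_cube. a i y) / 8)"

text \<open>First \<open>m\<close> is chosen so that the data hardly vary on a cube, then \<open>kn\<close> so that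
  rounding the sides to multiples of the mesh costs at most a factor
  \<open>\<theta>\<close> and the error on a single cell is negligible.  Neither depends on \<open>N\<close>.\<close>

lemma parameters_exist:
  assumes \<theta>: "1 < \<theta>"
  shows "\<exists>m kn. 0 < m \<and> 0 < kn \<and> (\<forall>j\<in>mesh_cubes m. flat_on \<theta> (mesh_box m j)) \<and>
     (\<forall>j\<in>mesh_cubes m. \<forall>i. \<theta> / (\<theta> - 1) \<le> width \<theta> m j i * real m * real kn) \<and>
     (\<forall>x\<in>unit_cube. \<Omega> x * fine_error * (1 / (real m * real kn))\<^sup>2 \<le> (\<theta> - 1) * (\<theta> ^ 8 * L))"
proof -
  obtain \<rho> where \<rho>: "\<rho> > 0" "\<And>S. S \<subseteq> unit_cube \<Longrightarrow> (\<forall>y\<in>S. \<forall>z\<in>S. \<forall>i. \<bar>y $ i - z $ i\<bar> \<le> \<rho>) \<Longrightarrow> flat_on \<theta> S"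
    using flat_on_small_sets[OF \<theta>] by metis
  obtain m where m: "0 < m" "1 / real m < \<rho>" using \<rho>(1) by (metis nat_approx_posE zero_less_Suc)
  have fl: "flat_on \<theta> (mesh_box m j)" if "j \<in> mesh_cubes m" for j
  proof (rule \<rho>(2))
    show "mesh_box m j \<subseteq> unit_cube" by (rule mesh_box_facts(2)[OF m(1) that])
    show "\<forall>y\<in>mesh_box m j. \<forall>z\<in>mesh_box m j. \<forall>i. \<bar>y $ i - z $ i\<bar> \<le> \<rho>"
      by (intro ballI allI order_trans[OF mesh_box_facts(4)[OF m(1) that] less_imp_le[OF m(2)]])
  qed
  obtain B where B: "B > 0" "\<And>x. x \<in> unit_cube \<Longrightarrow> \<Omega> x \<le> B" using bounded_\<Omega> by auto
  have ev1: "eventually (\<lambda>n. \<theta> / (\<theta> - 1) \<le> width \<theta> m j i * real m * real n) sequentially" if "j \<in> mesh_cubes m" for j i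
  proof -
    have w: "0 < width \<theta> m j i * real m" using width_pos[OF m(1) that, of \<theta> i] \<theta> m by simp
    have "eventually (\<lambda>n. \<theta> / (\<theta> - 1) / (width \<theta> m j i * real m) \<le> real n) sequentially"
      by (simp add: eventually_sequentially) (meson of_nat_le_iff order_trans real_arch_simple)
    then show ?thesis
    proof eventually_elim
      case (elim n)
      then show ?case unfolding pos_divide_le_eq[OF w] by (simp add: mult_ac)
    qed
  qed
  have "(\<lambda>n. B * \<bar>fine_error\<bar> * (1 / (real m * real n))\<^sup>2) \<longlonglongrightarrow> B * \<bar>fine_error\<bar> * 0\<^sup>2"
    using m by (intro tendsto_intros tendsto_divide_0[OF tendsto_const] filterlim_at_top_imp_at_infinity
      filterlim_tendsto_pos_mult_at_top[OF tendsto_const] filterlim_real_sequentially) auto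
  moreover have "B * \<bar>fine_error\<bar> * 0\<^sup>2 < (\<theta> - 1) * (\<theta> ^ 8 * L)" using \<theta> L_pos by simp
  ultimately have ev2: "eventually (\<lambda>n. B * \<bar>fine_error\<bar> * (1 / (real m * real n))\<^sup>2 < (\<theta> - 1) * (\<theta> ^ 8 * L)) sequentially"
    by (rule order_tendstoD(2))
  have "eventually (\<lambda>n. 0 < n \<and> (\<forall>j\<in>mesh_cubes m. \<forall>i. \<theta> / (\<theta> - 1) \<le> width \<theta> m j i * real m * real n) \<and>
     B * \<bar>fine_error\<bar> * (1 / (real m * real n))\<^sup>2 < (\<theta> - 1) * (\<theta> ^ 8 * L)) sequentially"
    using ev1 ev2 by (intro eventually_conj eventually_gt_at_top)
      (auto simp: eventually_ball_finite_distrib[OF finite_mesh_cubes] eventually_all_finite)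
  then obtain kn where kn: "0 < kn" "\<forall>j\<in>mesh_cubes m. \<forall>i. \<theta> / (\<theta> - 1) \<le> width \<theta> m j i * real m * real kn"
     "B * \<bar>fine_error\<bar> * (1 / (real m * real kn))\<^sup>2 < (\<theta> - 1) * (\<theta> ^ 8 * L)"
    by (auto simp: eventually_sequentially)
  have "\<Omega> x * fine_error * (1 / (real m * real kn))\<^sup>2 \<le> (\<theta> - 1) * (\<theta> ^ 8 * L)" if "x \<in> unit_cube" for x
  proof -
    have "\<Omega> x * fine_error \<le> \<Omega> x * \<bar>fine_error\<bar>"
      using \<Omega>_pos[OF that] by (intro mult_left_mono) auto
    also have "\<dots> \<le> B * \<bar>fine_error\<bar>" using B(2)[OF that] by (intro mult_right_mono) auto
    finally have "\<Omega> x * fine_error \<le> B * \<bar>fine_error\<bar>" .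
    then have "\<Omega> x * fine_error * (1 / (real m * real kn))\<^sup>2 \<le> B * \<bar>fine_error\<bar> * (1 / (real m * real kn))\<^sup>2"
      by (intro mult_right_mono) auto
    then show ?thesis using kn(3) by simp
  qed
  then show ?thesis using m fl kn by blast
qed

end

section \<open>Asymptotically optimal partitions\<close>

context multilinear_approximation
begin

text \<open>The block sizes \<open>r\<close> do not depend on \<open>n\<close>, the integer that plays the role of \<open>N\<^bsup>1/d\<^esup>\<close>; only the mesh shrinks.\<close>

lemma grid_approximation_instance:
  assumes \<theta>: "1 < \<theta>" and m: "0 < m" and kn: "0 < kn" and n: "0 < n"
    and flat: "\<And>j. j \<in> mesh_cubes m \<Longrightarrow> flat_on \<theta> (mesh_box m j)"
    and r_pos: "\<And>j i. 0 < r j i"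
    and r_le: "\<And>j i. j \<in> mesh_cubes m \<Longrightarrow> real (r j i) \<le> width \<theta> m j i * real m * real kn"
    and fine: "\<And>x. x \<in> unit_cube \<Longrightarrow> \<Omega> x * fine_error * (1 / (real m * real kn))\<^sup>2 \<le> (\<theta> - 1) * (\<theta> ^ 8 * L)"
    and E: "\<theta> ^ 8 * L \<le> E * (real n)\<^sup>2"
  shows "grid_approximation \<Omega> f a G m (kn * n) r \<theta> E"
proof -
  interpret core_grid m "kn * n" r
    by unfold_locales (use m kn n r_pos in auto)
  have cubes_eq: "cubes = mesh_cubes m" by (simp add: cubes_def mesh_cubes_def)
  have M_eq: "real M = real m * real kn * real n" by (simp add: M_def)
  have corner_eq: "pt (\<lambda>i. kn * n * j i) = mesh_corner m j" for j
    using kn n m by (auto simp: vec_eq_iff M_eq mesh_corner_def)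
  have box_eq: "rbox (\<lambda>i. kn * n * j i, \<lambda>i. kn * n * Suc (j i)) = mesh_box m j" for j
  proof -
    have "pt (\<lambda>i. kn * n * Suc (j i)) = mesh_corner m (succ j)"
      using corner_eq[of "succ j"] by simp
    then show ?thesis using corner_eq[of j] by (simp add: grid_box_def mesh_box_def mesh_corner_def)
  qed
  have nE: "0 < \<theta> ^ 8 * L" using \<theta> L_pos by simp
  have n2: "0 < (real n)\<^sup>2" using n by simp
  show ?thesis
  proof unfold_locales
    show "1 \<le> \<theta>" using \<theta> by simp
    show "0 < E" using nE E n2 by (metis less_le_trans zero_less_mult_pos2)
    show "flat_on \<theta> (rbox (\<lambda>i. kn * n * j i, \<lambda>i. kn * n * Suc (j i)))" if "j \<in> cubes" for j
      using flat that by (simp only: box_eq cubes_eq)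
    show "\<theta>\<^sup>2 * \<kappa> i * \<Omega> (pt (\<lambda>i. kn * n * j i)) * a i (pt (\<lambda>i. kn * n * j i)) * (real (r j i) / real M)\<^sup>2 \<le> 8 * E"
      if j: "j \<in> cubes" for j i
    proof -
      have jm: "j \<in> mesh_cubes m" using j by (simp add: cubes_eq)
      define y where "y = mesh_corner m j"
      have yc: "y \<in> unit_cube" using mesh_box_facts[OF m jm] by (auto simp: y_def)
      define A where "A = \<theta>\<^sup>2 * \<kappa> i * \<Omega> y * a i y"
      have A: "0 < A" using \<Omega>_pos[OF yc] a_pos[OF yc, of i] \<kappa>_ge_1[of i] \<theta> by (auto simp: A_def intro!: mult_pos_pos)
      have w2: "(width \<theta> m j i)\<^sup>2 = 8 * (\<theta> ^ 8 * L) / A"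
        using nE A unfolding width_def y_def[symmetric] A_def[symmetric] by (intro real_sqrt_pow2) auto
      have "real (r j i) / real M \<le> (width \<theta> m j i * real m * real kn) / real M"
        using r_le[OF jm] by (intro divide_right_mono) auto
      also have "\<dots> = width \<theta> m j i / real n" using m kn by (simp add: M_eq)
      finally have "(real (r j i) / real M)\<^sup>2 \<le> (width \<theta> m j i / real n)\<^sup>2" by (intro power_mono) auto
      then have "A * (real (r j i) / real M)\<^sup>2 \<le> A * (width \<theta> m j i / real n)\<^sup>2" using A by (intro mult_left_mono) auto
      also have "\<dots> = 8 * (\<theta> ^ 8 * L) / (real n)\<^sup>2" using A by (simp add: power_divide w2)
      also have "\<dots> \<le> 8 * E" using E n2 by (simp add: divide_le_eq)
      finally show ?thesis by (simp add: A_def corner_eq y_def)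
    qed
    show "\<Omega> x * (\<Sum>i\<in>(UNIV::'n set). (SUP y\<in>unit_cube. a i y) * (1 / real M)\<^sup>2 / 8) \<le> (\<theta> - 1) * E"
      if x: "x \<in> unit_cube" for x
    proof -
      have "(\<Sum>i\<in>(UNIV::'n set). (SUP y\<in>unit_cube. a i y) * (1 / real M)\<^sup>2 / 8) = fine_error * (1 / real M)\<^sup>2"
        by (simp add: fine_error_def sum_distrib_right)
      then have "\<Omega> x * (\<Sum>i\<in>(UNIV::'n set). (SUP y\<in>unit_cube. a i y) * (1 / real M)\<^sup>2 / 8)
        = \<Omega> x * fine_error * (1 / (real m * real kn))\<^sup>2 / (real n)\<^sup>2"
        by (simp add: M_eq power_divide power_mult_distrib)
      also have "\<dots> \<le> (\<theta> - 1) * (\<theta> ^ 8 * L) / (real n)\<^sup>2" using fine[OF x] by (intro divide_right_mono) auto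
      also have "\<dots> \<le> (\<theta> - 1) * E" using E n2 \<theta> by (simp add: divide_le_eq mult.assoc mult_left_mono)
      finally show ?thesis .
    qed
  qed
qed

text \<open>A bound that is uniform in \<open>\<theta>\<close> and \<open>m\<close>, since the final sequence of partitions runs through infinitely many
  choices of these parameters and must be admissible as a whole.\<close>

lemma widths_bounded: "\<exists>C>0. \<forall>\<theta> m j i. 1 < \<theta> \<longrightarrow> \<theta> \<le> 2 \<longrightarrow> 0 < m \<longrightarrow> j \<in> mesh_cubes m \<longrightarrow> width \<theta> m j i \<le> C"
proof -
  obtain \<alpha> where \<alpha>: "\<alpha> > 0" "\<And>i x. x \<in> unit_cube \<Longrightarrow> \<alpha> \<le> a i x" using a_bounded_below by blast
  obtain \<omega> where \<omega>: "\<omega> > 0" "\<And>x. x \<in> unit_cube \<Longrightarrow> \<omega> \<le> \<Omega> x"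
    using positive_continuous_lower_bound[OF \<Omega>_cont \<Omega>_pos] by blast
  have "width \<theta> m j i \<le> sqrt (8 * (2 ^ 8 * L) / (\<omega> * \<alpha>))" if \<theta>: "1 < \<theta>" "\<theta> \<le> 2" and m: "0 < m" and j: "j \<in> mesh_cubes m" for \<theta> m j i
  proof -
    define y where "y = mesh_corner m j"
    have yc: "y \<in> unit_cube" using mesh_box_facts[OF m j] by (auto simp: y_def)
    have "1 * \<omega> * \<alpha> \<le> (\<theta>\<^sup>2 * \<kappa> i) * \<Omega> y * a i y"
    proof (intro mult_mono)
      show "1 \<le> \<theta>\<^sup>2 * \<kappa> i" using mult_mono[of 1 "\<theta>\<^sup>2" 1 "\<kappa> i"] \<theta> \<kappa>_ge_1[of i] by simp
      show "\<alpha> \<le> a i y" by (rule \<alpha>(2)[OF yc])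
      show "\<omega> \<le> \<Omega> y" by (rule \<omega>(2)[OF yc])
      show "0 \<le> \<theta>\<^sup>2 * \<kappa> i" "0 \<le> \<theta>\<^sup>2 * \<kappa> i * \<Omega> y" "0 \<le> \<alpha>" "0 \<le> \<omega>" using \<alpha>(1) \<omega>(1) \<kappa>_ge_1[of i] \<Omega>_pos[OF yc] by auto
    qed
    moreover have "\<theta> ^ 8 * L \<le> 2 ^ 8 * L" using \<theta> L_pos by (intro mult_right_mono power_mono) auto
    ultimately have "8 * (\<theta> ^ 8 * L) / (\<theta>\<^sup>2 * \<kappa> i * \<Omega> y * a i y) \<le> 8 * (2 ^ 8 * L) / (\<omega> * \<alpha>)"
      using \<alpha>(1) \<omega>(1) L_pos \<theta> by (intro frac_le) auto
    then show ?thesis unfolding width_def y_def[symmetric] by (rule real_sqrt_le_mono)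
  qed
  moreover have "0 < sqrt (8 * (2 ^ 8 * L) / (\<omega> * \<alpha>))" using \<alpha>(1) \<omega>(1) L_pos by simp
  ultimately show ?thesis by blast
qed

lemma block_count_le:
  assumes \<theta>: "1 < \<theta>" and m: "0 < m" and kn: "0 < kn"
    and flat: "\<And>j. j \<in> mesh_cubes m \<Longrightarrow> flat_on \<theta> (mesh_box m j)"
    and r: "\<And>j i. 0 < r j i" "\<And>j i. j \<in> mesh_cubes m \<Longrightarrow> width \<theta> m j i * real m * real kn / \<theta> \<le> real (r j i)"
  shows "real (\<Sum>j\<in>mesh_cubes m. \<Prod>i\<in>UNIV. (kn * n - 1) div r j i) \<le> real n ^ CARD('n) / \<theta> ^ CARD('n)"
proof -
  have "real (\<Prod>i\<in>UNIV. (kn * n - 1) div r j i) \<le> (\<theta> * real n) ^ CARD('n) * (1 / (real m ^ CARD('n) * (\<Prod>i\<in>UNIV. width \<theta> m j i)))"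
    if j: "j \<in> mesh_cubes m" for j
  proof -
    have w: "0 < width \<theta> m j i" for i using width_pos[OF m j] \<theta> by simp
    have "real ((kn * n - 1) div r j i) \<le> \<theta> * real n * (1 / (real m * width \<theta> m j i))" for i
    proof -
      have "real ((kn * n - 1) div r j i) \<le> real (kn * n - 1) / real (r j i)" by (rule of_nat_div_le_of_nat)
      also have "\<dots> \<le> real (kn * n) / (width \<theta> m j i * real m * real kn / \<theta>)"
      proof (rule frac_le)
        show "real (kn * n - 1) \<le> real (kn * n)" unfolding of_nat_le_iff by simp
        show "0 < width \<theta> m j i * real m * real kn / \<theta>" using w[of i] m kn \<theta> by simp
      qed (use r(2)[OF j] in auto)
      also have "\<dots> = \<theta> * real n * (1 / (real m * width \<theta> m j i))" using kn by (simp add: mult_ac)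
      finally show ?thesis .
    qed
    then have "(\<Prod>i\<in>UNIV. real ((kn * n - 1) div r j i)) \<le> (\<Prod>i\<in>UNIV. \<theta> * real n * (1 / (real m * width \<theta> m j i)))"
      by (intro prod_mono) auto
    also have "\<dots> = (\<theta> * real n) ^ CARD('n) * (1 / (real m ^ CARD('n) * (\<Prod>i\<in>UNIV. width \<theta> m j i)))"
    proof -
      have "(\<Prod>i\<in>UNIV. 1 / (real m * width \<theta> m j i)) = 1 / (real m ^ CARD('n) * (\<Prod>i\<in>UNIV. width \<theta> m j i))"
        by (simp only: prod_dividef prod.distrib prod_constant power_one)
      then show ?thesis by (simp only: prod.distrib prod_constant power_mult_distrib)
    qed
    finally show ?thesis by simp
  qed
  then have "real (\<Sum>j\<in>mesh_cubes m. \<Prod>i\<in>UNIV. (kn * n - 1) div r j i)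
      \<le> (\<Sum>j\<in>mesh_cubes m. (\<theta> * real n) ^ CARD('n) * (1 / (real m ^ CARD('n) * (\<Prod>i\<in>UNIV. width \<theta> m j i))))"
    unfolding of_nat_sum by (rule sum_mono)
  also have "\<dots> = (\<theta> * real n) ^ CARD('n) * (\<Sum>j\<in>mesh_cubes m. 1 / (real m ^ CARD('n) * (\<Prod>i\<in>UNIV. width \<theta> m j i)))"
    by (rule sum_distrib_left[symmetric])
  also have "\<dots> \<le> (\<theta> * real n) ^ CARD('n) * (1 / \<theta> ^ (2 * CARD('n)))"
    using \<theta> flat m by (intro mult_left_mono widths_sum) auto
  also have "\<theta> ^ (2 * CARD('n)) = \<theta> ^ CARD('n) * \<theta> ^ CARD('n)" by (simp add: mult_2 power_add)
  also have "(\<theta> * real n) ^ CARD('n) * (1 / (\<theta> ^ CARD('n) * \<theta> ^ CARD('n))) = real n ^ CARD('n) / \<theta> ^ CARD('n)"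
    using \<theta> by (simp add: power_mult_distrib)
  finally show ?thesis .
qed

lemma tendsto_inverse_root: "(\<lambda>N. 1 / root CARD('n) (real N)) \<longlonglongrightarrow> 0"
  by (rule tendsto_divide_0[OF tendsto_const filterlim_at_top_imp_at_infinity[OF root_nat_at_top]])

text \<open>The conditions in the order of use: admissibility, the optimal error, the continuous spline, the number of
  wrong vertices, and its error from above and from below.\<close>

definition near_optimal :: "real \<Rightarrow> real \<Rightarrow> nat \<Rightarrow> (real^'n) set set \<Rightarrow> (real^'n \<Rightarrow> real) \<Rightarrow> bool" where
  "near_optimal C \<theta> N P s \<longleftrightarrow>
     box_partition unit_cube N P \<and>
     (\<forall>R\<in>P. diameter R \<le> C / root CARD('n) (real N)) \<and>
     (\<forall>R\<in>P. \<forall>x\<in>R. \<bar>f x - interp f R x\<bar> * \<Omega> x \<le> \<theta> ^ 8 * L / (root CARD('n) (real N))\<^sup>2) \<and>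
     continuous_on unit_cube s \<and>
     (\<forall>R\<in>P. \<exists>p\<in>P1. \<forall>x\<in>R. s x = p x) \<and>
     real (card {v \<in> partition_vertices P. s v \<noteq> f v}) \<le> 3 * 2 ^ CARD('n) * (1 - 1 / \<theta> ^ (5 * CARD('n))) * real N \<and>
     (\<forall>x\<in>unit_cube. \<bar>f x - s x\<bar> * \<Omega> x \<le> (2 * \<theta> - 1) * (\<theta> ^ 8 * L / (root CARD('n) (real N))\<^sup>2)) \<and>
     \<bar>f 0 - s 0\<bar> * \<Omega> 0 = \<theta> ^ 8 * L / (root CARD('n) (real N))\<^sup>2"

text \<open>The blocks alone number at most \<open>N / \<theta>\<^sup>d\<close> up to rounding of \<open>N\<^bsup>1/d\<^esup>\<close>, and the single cells are of lower order,
  so for large \<open>N\<close> the partition has at most \<open>N\<close> boxes.  That it has not many fewer is not computed but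
  deduced from the lower bound: with \<open>T\<close> boxes it reaches the error \<open>\<theta>\<^sup>8 L / N\<^bsup>2/d\<^esup>\<close>, which is possible only if
  \<open>N \<le> \<theta>\<^bsup>5d\<^esup> T\<close>.\<close>

lemma near_optimal_exists:
  "\<exists>C>0. \<forall>\<theta>. 1 < \<theta> \<longrightarrow> \<theta> \<le> 2 \<longrightarrow> eventually (\<lambda>N. \<exists>P s. near_optimal C \<theta> N P s) sequentially"
proof -
  obtain C where C: "C > 0" "\<And>\<theta> m j i. 1 < \<theta> \<Longrightarrow> \<theta> \<le> 2 \<Longrightarrow> 0 < m \<Longrightarrow> j \<in> mesh_cubes m \<Longrightarrow> width \<theta> m j i \<le> C"
    using widths_bounded by blast
  have "eventually (\<lambda>N. \<exists>P s. near_optimal (real CARD('n) * C) \<theta> N P s) sequentially"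
    if \<theta>: "1 < \<theta>" "\<theta> \<le> 2" for \<theta>
  proof -
    define \<nu> where "\<nu> N = root CARD('n) (real N)" for N :: nat
    obtain m kn where m: "0 < m" and kn: "0 < kn"
      and flat: "\<And>j. j \<in> mesh_cubes m \<Longrightarrow> flat_on \<theta> (mesh_box m j)"
      and big: "\<And>j i. j \<in> mesh_cubes m \<Longrightarrow> \<theta> / (\<theta> - 1) \<le> width \<theta> m j i * real m * real kn"
      and fine: "\<And>x. x \<in> unit_cube \<Longrightarrow> \<Omega> x * fine_error * (1 / (real m * real kn))\<^sup>2 \<le> (\<theta> - 1) * (\<theta> ^ 8 * L)"
      using parameters_exist[OF \<theta>(1)] by metis
    define r where "r j i = max 1 (nat \<lfloor>width \<theta> m j i * real m * real kn\<rfloor>)" for j i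
    have r_pos: "0 < r j i" for j i by (simp add: r_def)
    have r_le: "real (r j i) \<le> width \<theta> m j i * real m * real kn"
      and r_ge: "width \<theta> m j i * real m * real kn / \<theta> \<le> real (r j i)" if j: "j \<in> mesh_cubes m" for j i
    proof -
      define X where "X = width \<theta> m j i * real m * real kn"
      have X: "\<theta> / (\<theta> - 1) \<le> X" using big[OF j, of i] by (simp add: X_def)
      have X1: "1 < X" using \<theta> by (intro less_le_trans[OF _ X]) (simp add: less_divide_eq)
      then show "real (r j i) \<le> width \<theta> m j i * real m * real kn"
        unfolding r_def X_def[symmetric] by (simp add: max_def)
      \<comment> \<open>the lower bound on \<open>X\<close> in \<open>big\<close> is exactly what makes rounding down harmless\<close>
      have "X / \<theta> \<le> X - 1" using X \<theta> by (simp add: field_simps)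
      also have "\<dots> \<le> real (nat \<lfloor>X\<rfloor>)" using X1 by linarith
      also have "\<dots> \<le> real (r j i)" by (simp add: r_def X_def)
      finally show "width \<theta> m j i * real m * real kn / \<theta> \<le> real (r j i)" by (simp add: X_def)
    qed
    \<comment> \<open>there are at most \<open>R0 * n ^ (CARD('n) - 1)\<close> single cells, and \<open>g (1 / \<nu> N)\<close> bounds their share in \<open>N\<close>\<close>
    define R0 where "R0 = (\<Sum>j\<in>mesh_cubes m. \<Sum>i\<in>UNIV. real (r j i) * real kn ^ (CARD('n) - 1))"
    have R0: "0 \<le> R0" unfolding R0_def by (intro sum_nonneg) simp
    \<comment> \<open>the share of \<open>N\<close> by which the number of boxes may fall short before slabs are cut\<close>
    define \<eta> where "\<eta> = 1 - 1 / \<theta> ^ (5 * CARD('n))"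
    have \<eta>: "0 < \<eta>" using \<theta> by (simp add: \<eta>_def one_less_power)
    obtain E0 where E0: "E0 > 0" "\<And>P E. P division_of unit_cube \<Longrightarrow> (\<forall>R\<in>P. interior R \<noteq> {}) \<Longrightarrow> 0 < E \<Longrightarrow> E \<le> E0 \<Longrightarrow>
       (\<forall>R\<in>P. \<forall>x\<in>R. \<bar>f x - interp f R x\<bar> * \<Omega> x \<le> E) \<Longrightarrow> L \<le> \<theta>^2 * (root CARD('n) (real (card P)))^2 * E"
      using partition_lower_bound_L[OF \<theta>(1)] by metis
    define g where "g h = R0 * (1 + h) ^ (CARD('n) - 1) * h" for h :: real
    have lim1: "(\<lambda>N. (1 + 1 / \<nu> N) ^ CARD('n) / \<theta> ^ CARD('n) + g (1 / \<nu> N)) \<longlonglongrightarrow> (1 + 0) ^ CARD('n) / \<theta> ^ CARD('n) + R0 * (1 + 0) ^ (CARD('n) - 1) * 0"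
      and lim2: "(\<lambda>N. g (1 / \<nu> N)) \<longlonglongrightarrow> R0 * (1 + 0) ^ (CARD('n) - 1) * 0"
      unfolding g_def \<nu>_def using \<theta> by (intro tendsto_intros tendsto_inverse_root; simp)+
    have "eventually (\<lambda>N. (1 + 1 / \<nu> N) ^ CARD('n) / \<theta> ^ CARD('n) + g (1 / \<nu> N) < 1) sequentially"
      using \<theta> by (intro order_tendstoD(2)[OF lim1]) (simp add: one_less_power)
    moreover have "eventually (\<lambda>N. g (1 / \<nu> N) < \<eta>) sequentially"
      using \<eta> by (intro order_tendstoD(2)[OF lim2]) simp
    moreover have "eventually (\<lambda>N. 1 / \<eta> \<le> real N) sequentially"
      using filterlim_real_sequentially by (simp add: filterlim_at_top)
    moreover have "eventually (\<lambda>N. \<theta> ^ 8 * L / E0 \<le> (\<nu> N)\<^sup>2) sequentially"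
      unfolding \<nu>_def by (rule eventually_le_root_square)
    ultimately show ?thesis
      using eventually_ge_at_top[of 1]
    proof eventually_elim
      case (elim N)
      have N1: "1 \<le> real N" using elim(5) by simp
      have \<nu>1: "1 \<le> \<nu> N" using N1 by (simp add: \<nu>_def)
      have \<nu>N: "\<nu> N ^ CARD('n) = real N" by (simp add: \<nu>_def)
      \<comment> \<open>rounding up keeps the boxes at most as large as intended\<close>
      define n where "n = nat \<lceil>\<nu> N\<rceil>"
      have n: "\<nu> N \<le> real n" "real n \<le> \<nu> N + 1" using \<nu>1 by (auto simp: n_def) 
      have n0: "0 < n" using n(1) \<nu>1 by (cases n) auto
      define E where "E = \<theta> ^ 8 * L / (\<nu> N)\<^sup>2"
      have Epos: "0 < E" using \<theta> L_pos \<nu>1 by (simp add: E_def)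
      have "\<theta> ^ 8 * L = E * (\<nu> N)\<^sup>2" using \<nu>1 by (simp add: E_def)
      also have "\<dots> \<le> E * (real n)\<^sup>2" using Epos n(1) \<nu>1 by (intro mult_left_mono power_mono) auto
      finally have En: "\<theta> ^ 8 * L \<le> E * (real n)\<^sup>2" .
      interpret gp: grid_approximation \<Omega> f a G m "kn * n" r \<theta> E
        by (rule grid_approximation_instance[OF \<theta>(1) m kn n0 flat r_pos r_le fine En])
      have cubes_eq: "gp.cubes = mesh_cubes m" by (simp add: gp.cubes_def mesh_cubes_def)
      have \<nu>h: "\<nu> N + 1 = \<nu> N * (1 + 1 / \<nu> N)" using \<nu>1 by (simp add: field_simps)
      have nd: "real n ^ CARD('n) \<le> real N * (1 + 1 / \<nu> N) ^ CARD('n)"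
        using power_mono[OF n(2), of "CARD('n)"] unfolding \<nu>h power_mult_distrib \<nu>N by simp
      have nd1: "real n ^ (CARD('n) - 1) \<le> real N * ((1 + 1 / \<nu> N) ^ (CARD('n) - 1) * (1 / \<nu> N))"
      proof -
        have "\<nu> N * \<nu> N ^ (CARD('n) - 1) = real N"
          using \<nu>N by (metis power_minus_mult zero_less_card_finite mult.commute)
        then have e: "\<nu> N ^ (CARD('n) - 1) = real N * (1 / \<nu> N)" using \<nu>1 by (simp add: field_simps)
        have "real n ^ (CARD('n) - 1) \<le> \<nu> N ^ (CARD('n) - 1) * (1 + 1 / \<nu> N) ^ (CARD('n) - 1)"
          using power_mono[OF n(2), of "CARD('n) - 1"] unfolding \<nu>h power_mult_distrib by simp
        then show ?thesis unfolding e by (simp only: mult_ac)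
      qed
      define Fn where "Fn = (\<Sum>j\<in>gp.cubes. \<Sum>i\<in>UNIV. r j i * (kn * n) ^ (CARD('n) - 1))"
      have Fn_eq: "real Fn = R0 * real n ^ (CARD('n) - 1)"
        unfolding Fn_def cubes_eq R0_def sum_distrib_right by (simp add: power_mult_distrib mult.assoc)
      have Fn: "real Fn \<le> real N * g (1 / \<nu> N)"
        unfolding Fn_eq using mult_left_mono[OF nd1 R0] by (simp add: g_def mult_ac)
      have "real (card gp.base) \<le> real (\<Sum>j\<in>gp.cubes. \<Prod>i\<in>UNIV. gp.q j i) + real Fn"
        using gp.card_base_le unfolding Fn_def of_nat_add[symmetric] of_nat_le_iff .
      also have "real (\<Sum>j\<in>gp.cubes. \<Prod>i\<in>UNIV. gp.q j i) \<le> real n ^ CARD('n) / \<theta> ^ CARD('n)"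
        unfolding cubes_eq gp.q_def by (rule block_count_le[OF \<theta>(1) m kn flat r_pos r_ge])
      also have "\<dots> \<le> real N * ((1 + 1 / \<nu> N) ^ CARD('n) / \<theta> ^ CARD('n))"
        using nd \<theta> by (simp add: divide_right_mono)
      finally have "real (card gp.base) \<le> real N * ((1 + 1 / \<nu> N) ^ CARD('n) / \<theta> ^ CARD('n) + g (1 / \<nu> N))"
        using Fn by (simp add: distrib_left)
      also have "\<dots> \<le> real N * 1" using elim(1) by (intro mult_left_mono) auto
      finally have baseN: "card gp.base \<le> N" by simp
      obtain P where P_obj: "box_partition unit_cube N P"
        "\<forall>R\<in>P. \<forall>x\<in>R. \<bar>f x - interp f R x\<bar> * \<Omega> x \<le> E"
        "\<forall>R\<in>P. \<exists>l u. R = cbox l u \<and> (\<forall>i. l $ i < u $ i) \<and> (\<exists>j\<in>gp.cubes. \<forall>i. u $ i - l $ i \<le> real (r j i) / gp.M)"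
        "\<forall>R\<in>P. \<exists>p\<in>P1. \<forall>x\<in>R. gp.quasi_spline f gp.z x = p x"
        "card {v \<in> partition_vertices P. gp.quasi_spline f gp.z v \<noteq> f v} \<le> 2 ^ CARD('n) * (Fn + (N - card gp.base + 1))"
        using gp.refined_partition[OF baseN] unfolding Fn_def[symmetric]
        by (elim exE conjE) (rule that; assumption)
      note P = P_obj(1) P_obj(2)[rule_format] P_obj(3)[rule_format] P_obj(4)[rule_format] P_obj(5)
      let ?T = "card gp.base"
      have NT: "real N / \<theta> ^ (5 * CARD('n)) \<le> real ?T"
      proof -
        have "E \<le> E0" using elim(4) E0(1) \<nu>1 by (simp add: E_def field_simps)
        then have "L \<le> \<theta>^2 * (root CARD('n) (real ?T))^2 * E"
          using gp.base_division gp.base_interior gp.base_error Epos by (intro E0(2)) auto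
        also have "\<dots> = ((\<theta> ^ 5 * root CARD('n) (real ?T))\<^sup>2 / (\<nu> N)\<^sup>2) * L"
          by (simp add: E_def power_mult_distrib flip: power_mult power_add)
        finally have "1 * L \<le> ((\<theta> ^ 5 * root CARD('n) (real ?T))\<^sup>2 / (\<nu> N)\<^sup>2) * L" by simp
        then have "1 \<le> (\<theta> ^ 5 * root CARD('n) (real ?T))\<^sup>2 / (\<nu> N)\<^sup>2"
          using L_pos by (simp only: mult_le_cancel_right_pos)
        then have "(\<nu> N)\<^sup>2 \<le> (\<theta> ^ 5 * root CARD('n) (real ?T))\<^sup>2" using \<nu>1 by (simp add: le_divide_eq)
        then have "\<nu> N \<le> \<theta> ^ 5 * root CARD('n) (real ?T)"
          by (rule power2_le_imp_le) (use \<theta> in simp)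
        then have "\<nu> N ^ CARD('n) \<le> (\<theta> ^ 5 * root CARD('n) (real ?T)) ^ CARD('n)"
          using \<nu>1 by (intro power_mono) auto
        then have "real N \<le> \<theta> ^ (5 * CARD('n)) * real ?T"
          by (simp add: \<nu>N power_mult_distrib power_mult)
        then show ?thesis using \<theta> by (simp add: divide_le_eq mult.commute)
      qed
      have "real (card {v \<in> partition_vertices P. gp.quasi_spline f gp.z v \<noteq> f v})
        \<le> real (2 ^ CARD('n) * (Fn + (N - ?T + 1)))"
        using P(5) by (simp only: of_nat_le_iff)
      also have "\<dots> = 2 ^ CARD('n) * (real Fn + ((real N - real ?T) + 1))"
      proof -
        have "real (Fn + (N - ?T + 1)) = real Fn + ((real N - real ?T) + 1)"
          using baseN by (simp add: of_nat_diff)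
        then show ?thesis by (simp only: of_nat_mult of_nat_power of_nat_numeral)
      qed
      also have "\<dots> \<le> 2 ^ CARD('n) * (\<eta> * real N + (\<eta> * real N + \<eta> * real N))"
      proof (intro mult_left_mono add_mono)
        show "real Fn \<le> \<eta> * real N"
          using Fn mult_left_mono[OF less_imp_le[OF elim(2)], of "real N"] by (simp add: mult.commute)
        show "real N - real ?T \<le> \<eta> * real N" using NT by (simp add: \<eta>_def left_diff_distrib)
        show "1 \<le> \<eta> * real N" using elim(3) \<eta> by (simp add: divide_le_eq mult.commute)
      qed simp
      finally have bad: "real (card {v \<in> partition_vertices P. gp.quasi_spline f gp.z v \<noteq> f v})
        \<le> 3 * 2 ^ CARD('n) * \<eta> * real N" by (simp add: algebra_simps)
      have diam: "diameter R \<le> real CARD('n) * C / \<nu> N" if R: "R \<in> P" for R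
      proof -
        obtain l u j where lu: "R = cbox l u" "\<And>i. l $ i < u $ i" "j \<in> mesh_cubes m" "\<And>i. u $ i - l $ i \<le> real (r j i) / gp.M"
          using P(3)[OF R] unfolding cubes_eq by blast
        have "u $ i - l $ i \<le> C / \<nu> N" for i
        proof -
          have "real (r j i) / gp.M \<le> (width \<theta> m j i * real m * real kn) / gp.M"
            using r_le[OF lu(3)] by (intro divide_right_mono) auto
          also have "\<dots> = width \<theta> m j i / real n" using m kn by (simp add: gp.M_def)
          also have "\<dots> \<le> C / \<nu> N"
            using C(2)[OF \<theta> m lu(3), of i] C(1) n(1) \<nu>1 by (intro frac_le) auto
          finally show ?thesis using lu(4)[of i] by simp
        qed
        then have "diameter R \<le> real CARD('n) * (C / \<nu> N)"
          unfolding lu(1) using lu(2) by (intro diameter_cbox_le) (auto simp: less_imp_le)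
        then show ?thesis by simp
      qed
      show ?case
        unfolding near_optimal_def \<nu>_def[symmetric] E_def[symmetric] \<eta>_def[symmetric]
        by (intro exI[of _ P] exI[of _ "gp.quasi_spline f gp.z"] conjI ballI)
          (rule P(1) diam P(2) gp.quasi_spline_continuous P(4) bad gp.quasi_spline_error gp.quasi_spline_error_origin; assumption)+
    qed
  qed
  then show ?thesis using C(1) by (intro exI[of _ "real CARD('n) * C"]) auto
qed

end

section \<open>Passage to the limit\<close>

text \<open>Take for each \<open>N\<close> the best level \<open>l \<le> N\<close> that is available; every level is available eventually.\<close>

lemma diagonal_choice:
  assumes zero: "\<And>N. \<exists>x. Q 0 N x" and ev: "\<And>l. eventually (\<lambda>N. \<exists>x. Q l N x) sequentially"
  shows "\<exists>(l :: nat \<Rightarrow> nat) X. filterlim l at_top sequentially \<and> (\<forall>N. Q (l N) N (X N))"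
proof -
  define A where "A N = {l. l \<le> N \<and> (\<exists>x. Q l N x)}" for N
  define l where "l N = Max (A N)" for N
  have fin: "finite (A N)" for N by (rule finite_subset[of _ "{..N}"]) (auto simp: A_def)
  have "0 \<in> A N" for N using zero by (simp add: A_def)
  then have "l N \<in> A N" for N unfolding l_def using fin by (intro Max_in) auto
  then have "\<forall>N. \<exists>x. Q (l N) N x" by (simp add: A_def)
  then obtain X where "\<And>N. Q (l N) N (X N)" by metis
  moreover have "eventually (\<lambda>N. Z \<le> l N) sequentially" for Z
    using ev[of Z] eventually_ge_at_top[of Z]
  proof eventually_elim
    case (elim N)
    then show ?case unfolding l_def using fin by (intro Max_ge) (auto simp: A_def)
  qed
  ultimately show ?thesis by (auto simp: filterlim_at_top)
qed

lemma eventually_at_right_ex: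
  assumes "eventually Q (at_right (1::real))"
  shows "\<exists>\<theta>>1. \<theta> \<le> 2 \<and> Q \<theta>"
proof -
  have "eventually (\<lambda>\<theta>. \<theta> \<in> {1<..<2}) (at_right (1::real))"
    by (rule eventually_at_right_real) simp
  with assms have "eventually (\<lambda>\<theta>. Q \<theta> \<and> \<theta> \<in> {1<..<2}) (at_right 1)" by (rule eventually_conj)
  then obtain \<theta> where "Q \<theta>" "\<theta> \<in> {1<..<2}"
    using eventually_happens'[OF trivial_limit_at_right_real] by blast
  then show ?thesis by (intro exI[of _ \<theta>]) auto
qed

lemma powr_root_square:
  assumes "0 < N"
  shows "real N powr (2 / real CARD('n::finite)) = (root CARD('n) (real N))\<^sup>2"
proof -
  have "(root CARD('n) (real N))\<^sup>2 = (real N powr (1 / real CARD('n))) powr 2"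
    using assms by (simp add: root_powr_inverse powr_numeral)
  then show ?thesis by (simp add: powr_powr)
qed

context multilinear_approximation
begin

lemma prod_\<kappa>_powr: "(\<Prod>i\<in>UNIV. \<kappa> i / 8) powr (1 / real CARD('n)) = gamma_const (card G) CARD('n)"
proof -
  let ?k = "card G" and ?d = "CARD('n)"
  have kd: "?k + card (- G) = ?d"
    using card_Un_disjoint[of G "- G"] by simp
  have "(\<Prod>i\<in>UNIV. \<kappa> i / 8) = (\<Prod>i\<in>G. \<kappa> i / 8) * (\<Prod>i\<in>-G. \<kappa> i / 8)"
    by (subst prod.union_disjoint[symmetric]) auto
  also have "(\<Prod>i\<in>G. \<kappa> i / 8) = (real ?k / 8) ^ ?k" by (simp add: \<kappa>_def)
  also have "(\<Prod>i\<in>-G. \<kappa> i / 8) = (real (card (- G)) / 8) ^ card (- G)" by (simp add: \<kappa>_def)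
  finally have p: "(\<Prod>i\<in>UNIV. \<kappa> i / 8) = (real ?k / 8) ^ ?k * (real (card (- G)) / 8) ^ card (- G)" .
  have d: "0 < ?d" by simp
  show ?thesis
  proof (cases "0 < ?k \<and> ?k < ?d")
    case True
    then have k: "0 < real ?k" "0 < real (card (- G))" using kd by auto
    have "(\<Prod>i\<in>UNIV. \<kappa> i / 8) powr (1 / real ?d)
      = ((real ?k / 8) powr real ?k * (real (card (- G)) / 8) powr real (card (- G))) powr (1 / real ?d)"
      unfolding p using k by (simp add: powr_realpow)
    also have "\<dots> = (real ?k / 8) powr (real ?k / real ?d) * (real (card (- G)) / 8) powr (real (card (- G)) / real ?d)"
      using k by (simp add: powr_mult powr_powr)
    also have "\<dots> = real ?k powr (real ?k / real ?d) * real (card (- G)) powr (real (card (- G)) / real ?d)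
       / (8 powr (real ?k / real ?d) * 8 powr (real (card (- G)) / real ?d))"
      using k by (simp add: powr_divide)
    also have "8 powr (real ?k / real ?d) * 8 powr (real (card (- G)) / real ?d) = (8::real)"
    proof -
      have "real ?k / real ?d + real (card (- G)) / real ?d = 1"
        using kd d by (simp add: add_divide_distrib[symmetric] flip: of_nat_add)
      then show ?thesis by (simp flip: powr_add)
    qed
    also have "real (card (- G)) / real ?d = 1 - real ?k / real ?d"
      using kd d by (simp add: field_simps flip: of_nat_add)
    also have "card (- G) = ?d - ?k" using kd by simp
    finally show ?thesis using True by (simp add: gamma_const_def)
  next
    case False
    then have "?k = 0 \<or> card (- G) = 0" using kd by linarith
    then have "(\<Prod>i\<in>UNIV. \<kappa> i / 8) = (real ?d / 8) ^ ?d" unfolding p using kd by auto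
    also have "\<dots> = (real ?d / 8) powr real ?d" using d by (simp add: powr_realpow)
    finally have "(\<Prod>i\<in>UNIV. \<kappa> i / 8) powr (1 / real ?d) = real ?d / 8" using d by (simp add: powr_powr)
    moreover have "gamma_const ?k ?d = real ?d / 8" using False unfolding gamma_const_def by (rule if_not_P)
    ultimately show ?thesis by simp
  qed
qed

lemma L_eq: "L = gamma_const (card G) CARD('n) * (integral unit_cube density) powr (2 / real CARD('n))"
proof -
  have I: "0 < integral unit_cube density" using J_pos \<Gamma>_pos by (simp add: J_def zero_less_mult_iff)
  have p: "0 \<le> (\<Prod>i\<in>UNIV. \<kappa> i / 8)" using \<kappa>_ge_1 by (intro prod_nonneg) (auto intro: order_trans[OF zero_le_one])
  have "L = (J powr 2) powr (1 / real CARD('n))"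
    unfolding L_def using J_pos by (simp add: root_powr_inverse powr_numeral)
  also have "\<dots> = J powr (2 / real CARD('n))" unfolding powr_powr by simp
  also have "\<dots> = \<Gamma> powr (2 / real CARD('n)) * (integral unit_cube density) powr (2 / real CARD('n))"
    unfolding J_def using I \<Gamma>_pos by (simp add: powr_mult)
  also have "\<Gamma> powr (2 / real CARD('n)) = ((\<Prod>i\<in>UNIV. \<kappa> i / 8) powr (1 / 2)) powr (2 / real CARD('n))"
    unfolding \<Gamma>_def using p by (simp add: powr_half_sqrt)
  also have "\<dots> = (\<Prod>i\<in>UNIV. \<kappa> i / 8) powr (1 / real CARD('n))" by (simp add: powr_powr)
  finally show ?thesis by (simp only: prod_\<kappa>_powr)
qed

text \<open>Level 0 asks only for a partition with a continuous spline and is available for every \<open>N \<ge> 1\<close>; it fills the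
  finitely many places at which nothing better is known.\<close>

lemma optimal_sequence_exists:
  "\<exists>P s. admissible unit_cube P \<and> quasi_interpolating unit_cube f P s \<and>
     (\<lambda>N. (root CARD('n) (real N))\<^sup>2 * wnorm unit_cube \<Omega> (\<lambda>x. f x - s N x)) \<longlonglongrightarrow> L"
proof -
  define \<nu> where "\<nu> N = root CARD('n) (real N)" for N :: nat
  obtain C where C: "C > 0"
    and ex: "\<And>\<theta>. 1 < \<theta> \<Longrightarrow> \<theta> \<le> 2 \<Longrightarrow> eventually (\<lambda>N. \<exists>P s. near_optimal C \<theta> N P s) sequentially"
    using near_optimal_exists by blast
  define pieces where "pieces N P s \<longleftrightarrow> box_partition unit_cube N P \<and> continuous_on unit_cube s \<and>
     (\<forall>R\<in>P. \<exists>p\<in>P1. \<forall>x\<in>R. s x = p x)" for N P and s :: "real^'n \<Rightarrow> real"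
  define close where "close l N P s \<longleftrightarrow> (\<forall>R\<in>P. diameter R \<le> C / \<nu> N) \<and>
     real (card {v \<in> partition_vertices P. s v \<noteq> f v}) \<le> real N / real l \<and>
     \<bar>(\<nu> N)\<^sup>2 * wnorm unit_cube \<Omega> (\<lambda>x. f x - s x) - L\<bar> \<le> 1 / real l" for l N P and s :: "real^'n \<Rightarrow> real"
  have triv: "\<exists>P s. 1 \<le> N \<longrightarrow> pieces N P s" for N
  proof (cases "1 \<le> N")
    case True
    obtain P where P: "P division_of (unit_cube :: (real^'n) set)" "\<forall>R\<in>P. interior R \<noteq> {}" "card P = N"
      using box_slices[of 0 "1 :: real^'n" N] True by auto
    have "(\<lambda>_. 0) \<in> (P1 :: (real^'n \<Rightarrow> real) set)"
      unfolding P1_def by (intro CollectI exI[of _ "\<lambda>_. 0"]) simp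
    then have "pieces N P (\<lambda>_. 0)" using P by (auto simp: pieces_def box_partition_def)
    then show ?thesis by blast
  qed simp
  have ev: "eventually (\<lambda>N. \<exists>P s. pieces N P s \<and> close l N P s) sequentially" if l: "0 < l" for l
  proof -
    have "((\<lambda>\<theta>. 3 * 2 ^ CARD('n) * (1 - 1 / \<theta> ^ (5 * CARD('n)))) \<longlongrightarrow> 3 * 2 ^ CARD('n) * (1 - 1 / 1 ^ (5 * CARD('n)))) (at_right (1::real))"
      by (intro tendsto_intros) simp
    then have e1: "eventually (\<lambda>\<theta>. 3 * 2 ^ CARD('n) * (1 - 1 / \<theta> ^ (5 * CARD('n))) < 1 / real l) (at_right (1::real))"
      by (rule order_tendstoD(2)) (use l in simp)
    have "((\<lambda>\<theta>. (2 * \<theta> - 1) * (\<theta> ^ 8 * L)) \<longlongrightarrow> (2 * 1 - 1) * (1 ^ 8 * L)) (at_right (1::real))"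
      by (intro tendsto_intros)
    then have e2: "eventually (\<lambda>\<theta>. (2 * \<theta> - 1) * (\<theta> ^ 8 * L) < L + 1 / real l) (at_right (1::real))"
      by (rule order_tendstoD(2)) (use l in simp)
    obtain \<theta> where \<theta>: "1 < \<theta>" "\<theta> \<le> 2" "3 * 2 ^ CARD('n) * (1 - 1 / \<theta> ^ (5 * CARD('n))) < 1 / real l"
       "(2 * \<theta> - 1) * (\<theta> ^ 8 * L) < L + 1 / real l"
      using eventually_at_right_ex[OF eventually_conj[OF e1 e2]] by blast
    show ?thesis
      using ex[OF \<theta>(1,2)] eventually_ge_at_top[of 1]
    proof eventually_elim
      case (elim N)
      have \<nu>: "0 < (\<nu> N)\<^sup>2" using elim(2) by (simp add: \<nu>_def)
      from elim(1)[unfolded near_optimal_def, folded \<nu>_def] obtain P s where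
        P: "box_partition unit_cube N P" "\<forall>R\<in>P. diameter R \<le> C / \<nu> N"
        and s: "continuous_on unit_cube s" "\<forall>R\<in>P. \<exists>p\<in>P1. \<forall>x\<in>R. s x = p x"
        and bad: "real (card {v \<in> partition_vertices P. s v \<noteq> f v}) \<le> 3 * 2 ^ CARD('n) * (1 - 1 / \<theta> ^ (5 * CARD('n))) * real N"
        and err: "\<forall>x\<in>unit_cube. \<bar>f x - s x\<bar> * \<Omega> x \<le> (2 * \<theta> - 1) * (\<theta> ^ 8 * L / (\<nu> N)\<^sup>2)"
        and err0: "\<bar>f 0 - s 0\<bar> * \<Omega> 0 = \<theta> ^ 8 * L / (\<nu> N)\<^sup>2"
        by (elim exE conjE) (rule that; assumption)
      let ?w = "wnorm unit_cube \<Omega> (\<lambda>x. f x - s x)"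
      have "?w \<le> (2 * \<theta> - 1) * (\<theta> ^ 8 * L / (\<nu> N)\<^sup>2)" by (rule wnorm_le) (use err in blast)
      then have up: "(\<nu> N)\<^sup>2 * ?w \<le> (2 * \<theta> - 1) * (\<theta> ^ 8 * L)" using \<nu> by (simp add: field_simps)
      have "\<bar>f 0 - s 0\<bar> * \<Omega> 0 \<le> ?w"
        by (rule le_wnorm[where g = "\<lambda>x. f x - s x" and x = 0]) (use err in \<open>auto simp: mem_box_cart\<close>)
      then have lo: "\<theta> ^ 8 * L \<le> (\<nu> N)\<^sup>2 * ?w" using \<nu> unfolding err0 by (simp add: field_simps)
      have "1 * L \<le> \<theta> ^ 8 * L" using \<theta> L_pos by (intro mult_right_mono one_le_power) auto
      then have "\<bar>(\<nu> N)\<^sup>2 * ?w - L\<bar> \<le> 1 / real l" using up lo \<theta>(4) l by (simp add: abs_le_iff)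
      moreover have "3 * 2 ^ CARD('n) * (1 - 1 / \<theta> ^ (5 * CARD('n))) * real N \<le> 1 / real l * real N"
        using \<theta>(3) by (intro mult_right_mono) auto
      ultimately have "close l N P s" using P(2) bad by (simp add: close_def)
      moreover have "pieces N P s" using P(1) s by (simp add: pieces_def)
      ultimately show ?case by blast
    qed
  qed
  define Q where "Q l N x \<longleftrightarrow> (1 \<le> N \<longrightarrow> pieces N (fst x) (snd x) \<and> (0 < l \<longrightarrow> close l N (fst x) (snd x)))" for l N x
  have Q0: "\<exists>x. Q 0 N x" for N using triv[of N] by (simp add: Q_def)
  have Qev: "eventually (\<lambda>N. \<exists>x. Q l N x) sequentially" for l
  proof (cases "0 < l")
    case True
    from ev[OF True] show ?thesis
    proof eventually_elim
      case (elim N)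
      then obtain P s where "pieces N P s" "close l N P s" by blast
      then have "Q l N (P, s)" by (simp add: Q_def)
      then show ?case by blast
    qed
  qed (use Q0 in simp)
  obtain l X where l: "filterlim l at_top sequentially" and X: "\<And>N. Q (l N) N (X N)"
    using diagonal_choice[of Q, OF Q0 Qev] by blast
  define P where "P N = fst (X N)" for N
  define s where "s N = snd (X N)" for N
  have pc: "pieces N (P N) (s N)" if "1 \<le> N" for N using X[of N] that by (simp add: Q_def P_def s_def)
  have cl: "close (l N) N (P N) (s N)" if "1 \<le> N" "0 < l N" for N using X[of N] that by (simp add: Q_def P_def s_def)
  have lev: "eventually (\<lambda>N. 1 \<le> N \<and> Z \<le> l N) sequentially" for Z
    using l by (intro eventually_conj eventually_ge_at_top) (simp add: filterlim_at_top)
  have "admissible unit_cube P"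
  proof -
    let ?h = "\<lambda>N. real N powr (1 / real CARD('n)) * Max (diameter ` P N)"
    obtain N0 where N0: "\<And>N. N0 \<le> N \<Longrightarrow> 1 \<le> N \<and> 1 \<le> l N" using lev[of 1] by (auto simp: eventually_sequentially)
    have "?h N \<le> C" if N: "N0 \<le> N" for N
    proof -
      have N1: "1 \<le> N" "0 < l N" using N0[OF N] by auto
      have bp: "P N division_of unit_cube" "card (P N) = N" using pc[OF N1(1)] by (auto simp: pieces_def box_partition_def)
      then have "finite (P N)" "P N \<noteq> {}" using N1(1) by auto
      then have "Max (diameter ` P N) \<le> C / \<nu> N" using cl[OF N1] by (simp add: close_def)
      moreover have "real N powr (1 / real CARD('n)) = \<nu> N" using N1(1) by (simp add: \<nu>_def root_powr_inverse)
      moreover have "0 < \<nu> N" using N1(1) by (simp add: \<nu>_def)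
      ultimately show ?thesis by (simp add: field_simps)
    qed
    then have "bdd_above (?h ` {N0..})" by (intro bdd_aboveI2[of _ _ C]) auto
    moreover have "bdd_above (?h ` {..N0})" by (intro bdd_above_finite) simp
    ultimately have "bdd_above (?h ` {N0..} \<union> ?h ` {..N0})" by simp
    then have "bdd_above (?h ` {1..})"
      unfolding image_Un[symmetric] by (rule bdd_above_mono) (intro image_mono, auto)
    then show ?thesis using pc by (auto simp: admissible_def pieces_def)
  qed
  moreover have "quasi_interpolating unit_cube f P s"
  proof -
    have "(\<lambda>N. real (card {v \<in> partition_vertices (P N). s N v \<noteq> f v})) \<in> o(\<lambda>N. real N)"
    proof (rule landau_o.smallI)
      fix c :: real assume c: "0 < c"
      show "eventually (\<lambda>N. norm (real (card {v \<in> partition_vertices (P N). s N v \<noteq> f v})) \<le> c * norm (real N)) sequentially"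
        using lev[of "nat \<lceil>1 / c\<rceil> + 1"]
      proof eventually_elim
        case (elim N)
        then have lN: "0 < l N" "1 / c \<le> real (l N)" by linarith+
        have "real (card {v \<in> partition_vertices (P N). s N v \<noteq> f v}) \<le> real N / real (l N)"
          using cl[of N] elim lN by (simp add: close_def)
        also have "\<dots> \<le> c * real N"
        proof -
          have "1 \<le> c * real (l N)" using lN c by (simp add: divide_le_eq mult.commute)
          then have "1 * real N \<le> c * real (l N) * real N" by (intro mult_right_mono) auto
          then show ?thesis using lN by (simp add: divide_le_eq mult_ac)
        qed
        finally show ?case by simp
      qed
    qed
    then show ?thesis using pc by (simp add: quasi_interpolating_def pieces_def)
  qed
  moreover have "(\<lambda>N. (\<nu> N)\<^sup>2 * wnorm unit_cube \<Omega> (\<lambda>x. f x - s N x)) \<longlonglongrightarrow> L"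
  proof (rule tendstoI)
    fix e :: real assume e: "0 < e"
    show "eventually (\<lambda>N. dist ((\<nu> N)\<^sup>2 * wnorm unit_cube \<Omega> (\<lambda>x. f x - s N x)) L < e) sequentially"
      using lev[of "nat \<lceil>1 / e\<rceil> + 1"]
    proof eventually_elim
      case (elim N)
      then have lN: "0 < l N" "1 / e < real (l N)" by linarith+
      have "\<bar>(\<nu> N)\<^sup>2 * wnorm unit_cube \<Omega> (\<lambda>x. f x - s N x) - L\<bar> \<le> 1 / real (l N)"
        using cl[of N] elim lN by (simp add: close_def)
      also have "\<dots> < e" using lN e by (simp add: field_simps)
      finally show ?case by (simp add: dist_real_def)
    qed
  qed
  ultimately show ?thesis unfolding \<nu>_def by blast
qed

text \<open>By \<open>admissible_update\<close> the existence of one admissible sequence lets the infimum range over all partitions.\<close>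

lemma opt_error_limit:
  fixes S :: "nat \<Rightarrow> (real^'n) set set"
  assumes S: "admissible unit_cube S"
  shows "(\<lambda>N. (root CARD('n) (real N))\<^sup>2 * opt_error unit_cube \<Omega> f N) \<longlonglongrightarrow> L"
proof (rule order_tendstoI)
  fix y assume y: "y < L"
  have "((\<lambda>\<theta>. \<theta>\<^sup>2 * y) \<longlongrightarrow> 1\<^sup>2 * y) (at_right (1::real))" by (intro tendsto_intros)
  then have "eventually (\<lambda>\<theta>. \<theta>\<^sup>2 * y < L) (at_right (1::real))" by (rule order_tendstoD(2)) (use y in simp)
  then obtain \<theta> where \<theta>: "1 < \<theta>" "\<theta>\<^sup>2 * y < L" using eventually_at_right_ex by blast
  show "eventually (\<lambda>N. y < (root CARD('n) (real N))\<^sup>2 * opt_error unit_cube \<Omega> f N) sequentially"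
    using opt_error_lower[OF \<theta>(1) S]
  proof eventually_elim
    case (elim N)
    then have "\<theta>\<^sup>2 * y < \<theta>\<^sup>2 * ((root CARD('n) (real N))\<^sup>2 * opt_error unit_cube \<Omega> f N)" using \<theta>(2) by (simp add: mult.assoc)
    then show ?case using \<theta>(1) by simp
  qed
next
  fix y assume y: "L < y"
  have "((\<lambda>\<theta>. \<theta> ^ 8 * L) \<longlongrightarrow> 1 ^ 8 * L) (at_right (1::real))" by (intro tendsto_intros)
  then have "eventually (\<lambda>\<theta>. \<theta> ^ 8 * L < y) (at_right (1::real))" by (rule order_tendstoD(2)) (use y in simp)
  then obtain \<theta> where \<theta>: "1 < \<theta>" "\<theta> \<le> 2" "\<theta> ^ 8 * L < y" using eventually_at_right_ex by blast
  obtain C where "eventually (\<lambda>N. \<exists>P s. near_optimal C \<theta> N P s) sequentially"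
    using near_optimal_exists \<theta>(1,2) by blast
  then show "eventually (\<lambda>N. (root CARD('n) (real N))\<^sup>2 * opt_error unit_cube \<Omega> f N < y) sequentially"
    using eventually_ge_at_top[of 1]
  proof eventually_elim
    case (elim N)
    have \<nu>: "0 < (root CARD('n) (real N))\<^sup>2" using elim(2) by simp
    from elim(1) obtain P s where P: "near_optimal C \<theta> N P s" by blast
    have "opt_error unit_cube \<Omega> f N \<le> \<theta> ^ 8 * L / (root CARD('n) (real N))\<^sup>2"
      using P unfolding near_optimal_def by (intro opt_error_le[OF S elim(2), of P]) blast+
    then have "(root CARD('n) (real N))\<^sup>2 * opt_error unit_cube \<Omega> f N \<le> \<theta> ^ 8 * L"
      using \<nu> by (simp add: le_divide_eq mult.commute)
    then show ?case using \<theta>(3) by simp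
  qed
qed

end

text \<open>The quotient in the second claim is the quotient of two sequences that tend to the same positive limit after
  multiplication by \<open>N\<^bsup>2/d\<^esup>\<close>.\<close>

theorem theorem1:
  fixes D :: "(real^'n) set" and \<Omega> f :: "real^'n \<Rightarrow> real"
    and idx :: "'n \<Rightarrow> nat" and k :: nat
  assumes "CARD('n) \<ge> 2"
    and "bij_betw idx UNIV {1..CARD('n)}"
    and "D = {x. \<forall>i. 0 \<le> x $ i \<and> x $ i \<le> 1}"
    and "continuous_on D \<Omega>" and "\<forall>x\<in>D. \<Omega> x > 0"
    and "k \<le> CARD('n)"
    and "f \<in> C2k D idx k"
  shows "((\<lambda>N. real N powr (2 / real CARD('n)) * opt_error D \<Omega> f N) \<longlonglongrightarrow>
            gamma_const k CARD('n) *
            (integral D (\<lambda>x. \<bar>H D f x\<bar> powr (1 / 2) * \<Omega> x powr (real CARD('n) / 2)))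
              powr (2 / real CARD('n)))
       \<and> (\<exists>P s. admissible D P \<and> quasi_interpolating D f P s \<and>
            (\<lambda>N. wnorm D \<Omega> (\<lambda>x. f x - s N x) / opt_error D \<Omega> f N) \<longlonglongrightarrow> 1)"
proof -
  have D: "D = unit_cube" using assms(3) by (auto simp: mem_box_cart)
  define a where "a = (\<lambda>i x. \<bar>pderiv_within unit_cube i (pderiv_within unit_cube i f) x\<bar>)"
  define G where "G = {i. idx i \<le> k}"
  interpret multilinear_approximation \<Omega> f a G
    unfolding a_def G_def by (rule multilinear_approximation_C2k) (use assms(4,5,7) D in auto)
  have cardG: "card G = k"
  proof -
    have inj: "inj_on idx G" using assms(2) by (auto simp: bij_betw_def inj_on_def)
    have "idx ` G = {1..k}"
    proof
      show "idx ` G \<subseteq> {1..k}" using assms(2) by (auto simp: G_def bij_betw_def)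
      show "{1..k} \<subseteq> idx ` G"
      proof
        fix y assume y: "y \<in> {1..k}"
        then have "y \<in> idx ` UNIV" using assms(2,6) by (auto simp: bij_betw_def)
        then show "y \<in> idx ` G" using y by (auto simp: G_def)
      qed
    qed
    then show ?thesis using card_image[OF inj] by simp
  qed
  have "density x = \<bar>H D f x\<bar> powr (1 / 2) * \<Omega> x powr (real CARD('n) / 2)" if x: "x \<in> D" for x
  proof -
    have \<Omega>x: "0 < \<Omega> x" using assms(5) x by blast
    have "\<Omega> x powr (real CARD('n) / 2) = (\<Omega> x powr real CARD('n)) powr (1 / 2)" by (simp add: powr_powr)
    also have "\<dots> = sqrt (\<Omega> x ^ CARD('n))" using \<Omega>x by (simp add: powr_realpow powr_half_sqrt)
    finally have \<Omega>_powr: "\<Omega> x powr (real CARD('n) / 2) = sqrt (\<Omega> x ^ CARD('n))" .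
    have "(\<Prod>i\<in>UNIV. a i x) = \<bar>H D f x\<bar>" by (simp add: H_def D a_def abs_prod)
    then have "density x = sqrt (\<bar>H D f x\<bar> * \<Omega> x ^ CARD('n))" unfolding density_def by simp
    then show ?thesis unfolding \<Omega>_powr by (simp add: powr_half_sqrt real_sqrt_mult)
  qed
  then have I: "integral D (\<lambda>x. \<bar>H D f x\<bar> powr (1 / 2) * \<Omega> x powr (real CARD('n) / 2)) = integral unit_cube density"
    unfolding D[symmetric] by (intro integral_cong) auto
  obtain P s where P: "admissible unit_cube P" "quasi_interpolating unit_cube f P s"
    "(\<lambda>N. (root CARD('n) (real N))\<^sup>2 * wnorm unit_cube \<Omega> (\<lambda>x. f x - s N x)) \<longlonglongrightarrow> L"
    using optimal_sequence_exists by blast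
  note lim = opt_error_limit[OF P(1)]
  have "eventually (\<lambda>N. (root CARD('n) (real N))\<^sup>2 * opt_error unit_cube \<Omega> f N
      = real N powr (2 / real CARD('n)) * opt_error unit_cube \<Omega> f N) sequentially"
    using eventually_gt_at_top[of 0] by eventually_elim (simp add: powr_root_square)
  then have "(\<lambda>N. real N powr (2 / real CARD('n)) * opt_error unit_cube \<Omega> f N) \<longlonglongrightarrow> L"
    by (rule Lim_transform_eventually[OF lim])
  moreover have "(\<lambda>N. wnorm unit_cube \<Omega> (\<lambda>x. f x - s N x) / opt_error unit_cube \<Omega> f N) \<longlonglongrightarrow> 1"
  proof (rule Lim_transform_eventually)
    show "(\<lambda>N. ((root CARD('n) (real N))\<^sup>2 * wnorm unit_cube \<Omega> (\<lambda>x. f x - s N x)) /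
        ((root CARD('n) (real N))\<^sup>2 * opt_error unit_cube \<Omega> f N)) \<longlonglongrightarrow> 1"
      using tendsto_divide[OF P(3) lim] L_pos by simp
    show "eventually (\<lambda>N. ((root CARD('n) (real N))\<^sup>2 * wnorm unit_cube \<Omega> (\<lambda>x. f x - s N x)) /
        ((root CARD('n) (real N))\<^sup>2 * opt_error unit_cube \<Omega> f N)
        = wnorm unit_cube \<Omega> (\<lambda>x. f x - s N x) / opt_error unit_cube \<Omega> f N) sequentially"
      using eventually_gt_at_top[of 0] by eventually_elim simp
  qed
  ultimately show ?thesis
    using P(1,2) unfolding I L_eq cardG unfolding D by blast
qed

end
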